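(* Let $\gamma>0$ and let $\mathbb{S}$ be the circle of unit length. Assume that $u_0\in H^s(\mathbb{S})$, $s\ge2$, and $\int_{\mathbb{S}}u_0(x)\,dx=0$. Then there exist a maximal time $T=T(u_0)>0$ and a unique solution $u(t,x)$ to the Cauchy problem $(u_t+uu_x)_x=\gamma u$, $t>0$, $u(0,x)=u_0(x)$, such that $$u\in C([0,T);H^s(\mathbb{S}))\cap C^1([0,T);H^{s-1}(\mathbb{S})),$$ with the following two conserved quantities: $$\int_{\mathbb{S}}u(t,x)\,dx=0,\qquad\int_{\mathbb{S}}u^2(t,x)\,dx=\int_{\mathbb{S}}u_0^2(x)\,dx,\qquad t\in[0,T).$$ Moreover, the solution depends continuously on the initial data, i.e. the mapping $u_0\mapsto u:\ H^s(\mathbb{S})\to C([0,T);H^s(\mathbb{S}))\cap C^1([0,T);H^{s-1}(\mathbb{S}))$ is continuous.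
   Context: All functions are real-valued. $H^s(\mathbb{S})$ is the $L^2$-based Sobolev space on the circle. The solution map is considered on initial data with zero mean. *)

theory Defs
  imports "HOL-Analysis.Analysis"
begin

text \<open>
  Functions on the circle of unit length are 1-periodic functions on the real line, integrated
  over one period. Elements of \<open>L\<^sup>2\<close> and \<open>H\<^sup>s\<close> are represented by functions rather than by classes;
  equality of elements is \<open>circle_ae_eq\<close>.
\<close>

abbreviation circle_measure :: "real measure" where
  "circle_measure \<equiv> lebesgue_on {0..1}"

definition circle_fun :: "(real \<Rightarrow> real) \<Rightarrow> bool" where
  "circle_fun f \<longleftrightarrow> (\<forall>x. f (x + 1) = f x) \<and> f \<in> borel_measurable lebesgue"

definition circle_ae_eq :: "(real \<Rightarrow> real) \<Rightarrow> (real \<Rightarrow> real) \<Rightarrow> bool" where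
  "circle_ae_eq f g \<longleftrightarrow> (AE x in circle_measure. f x = g x)"

definition circle_integral :: "(real \<Rightarrow> real) \<Rightarrow> real" where
  "circle_integral f = (LINT x|circle_measure. f x)"

definition circle_L1 :: "(real \<Rightarrow> real) set" where
  "circle_L1 = {f. circle_fun f \<and> integrable circle_measure f}"

definition circle_L2 :: "(real \<Rightarrow> real) set" where
  "circle_L2 = {f. circle_fun f \<and> integrable circle_measure (\<lambda>x. (f x)\<^sup>2)}"

definition fourier_coeff :: "(real \<Rightarrow> real) \<Rightarrow> int \<Rightarrow> complex" where
  "fourier_coeff f k =
     (LINT x|circle_measure. complex_of_real (f x) * cis (- (2 * pi * real_of_int k * x)))"

definition sobolev_term :: "real \<Rightarrow> (real \<Rightarrow> real) \<Rightarrow> int \<Rightarrow> real" where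
  "sobolev_term s f k =
     (1 + (2 * pi * real_of_int k)\<^sup>2) powr s * (cmod (fourier_coeff f k))\<^sup>2"

text \<open>
  The following is \<open>H\<^sup>s\<close> of the circle for \<open>s \<ge> 0\<close>; for negative \<open>s\<close> it only contains the
  \<open>L\<^sup>2\<close> functions and is not used. \<open>sobolev_norm\<close> is meaningful only on \<open>sobolev s\<close>.
\<close>

definition sobolev :: "real \<Rightarrow> (real \<Rightarrow> real) set" where
  "sobolev s = {f \<in> circle_L2. sobolev_term s f summable_on UNIV}"

definition sobolev_norm :: "real \<Rightarrow> (real \<Rightarrow> real) \<Rightarrow> real" where
  "sobolev_norm s f = sqrt (\<Sum>\<^sub>\<infinity>k. sobolev_term s f k)"

definition sobolev_mean_zero :: "real \<Rightarrow> (real \<Rightarrow> real) set" where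
  "sobolev_mean_zero s = {f \<in> sobolev s. circle_integral f = 0}"

definition circle_test_fun :: "(real \<Rightarrow> real) \<Rightarrow> bool" where
  "circle_test_fun \<phi> \<longleftrightarrow>
     (\<forall>x. \<phi> (x + 1) = \<phi> x) \<and> (\<forall>n x. (deriv ^^ n) \<phi> field_differentiable at x)"

definition has_weak_deriv :: "(real \<Rightarrow> real) \<Rightarrow> (real \<Rightarrow> real) \<Rightarrow> bool" where
  "has_weak_deriv f g \<longleftrightarrow> f \<in> circle_L1 \<and> g \<in> circle_L1 \<and>
     (\<forall>\<phi>. circle_test_fun \<phi> \<longrightarrow>
        circle_integral (\<lambda>x. f x * deriv \<phi> x) = - circle_integral (\<lambda>x. g x * \<phi> x))"

text \<open>
  \<open>sobolev_C s I u\<close> is \<open>u \<in> C(I; H\<^sup>s)\<close>, and \<open>sobolev_C1 s I u u'\<close> is \<open>u \<in> C\<^sup>1(I; H\<^sup>s)\<close> with time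
  derivative \<open>u'\<close>; at end points of \<open>I\<close> belonging to \<open>I\<close> the derivative is one-sided.
\<close>

definition sobolev_C :: "real \<Rightarrow> real set \<Rightarrow> (real \<Rightarrow> real \<Rightarrow> real) \<Rightarrow> bool" where
  "sobolev_C s I u \<longleftrightarrow>
     (\<forall>t\<in>I. u t \<in> sobolev s \<and>
        ((\<lambda>\<tau>. sobolev_norm s (\<lambda>x. u \<tau> x - u t x)) \<longlongrightarrow> 0) (at t within I))"

definition sobolev_C1 ::
  "real \<Rightarrow> real set \<Rightarrow> (real \<Rightarrow> real \<Rightarrow> real) \<Rightarrow> (real \<Rightarrow> real \<Rightarrow> real) \<Rightarrow> bool" where
  "sobolev_C1 s I u u' \<longleftrightarrow>
     sobolev_C s I u \<and> sobolev_C s I u' \<and>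
     (\<forall>t\<in>I. ((\<lambda>\<tau>. sobolev_norm s (\<lambda>x. (u \<tau> x - u t x) / (\<tau> - t) - u' t x)) \<longlongrightarrow> 0)
               (at t within I))"

definition life_span :: "ereal \<Rightarrow> real set" where
  "life_span T = {t. 0 \<le> t \<and> ereal t < T}"

text \<open>
  \<open>u\<close>, with time derivative \<open>u'\<close>, solves \<open>(u\<^sub>t + u u\<^sub>x)\<^sub>x = \<gamma> u\<close>, \<open>u(0) = u0\<close> on \<open>[0, T)\<close>,
  in the class \<open>C([0, T); H\<^sup>s) \<inter> C\<^sup>1([0, T); H\<^sup>s\<^sup>-\<^sup>1)\<close>.
\<close>

definition solution ::
  "real \<Rightarrow> real \<Rightarrow> (real \<Rightarrow> real) \<Rightarrow> ereal \<Rightarrow> (real \<Rightarrow> real \<Rightarrow> real) \<Rightarrow> (real \<Rightarrow> real \<Rightarrow> real) \<Rightarrow> bool"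
  where
  "solution \<gamma> s u0 T u u' \<longleftrightarrow>
     sobolev_C s (life_span T) u \<and>
     sobolev_C1 (s - 1) (life_span T) u u' \<and>
     circle_ae_eq (u 0) u0 \<and>
     (\<forall>t\<in>life_span T. t > 0 \<longrightarrow>
        (\<exists>ux. has_weak_deriv (u t) ux \<and>
              has_weak_deriv (\<lambda>x. u' t x + u t x * ux x) (\<lambda>x. \<gamma> * u t x)))"

text \<open>
  Continuity of the data-to-solution map \<open>u0 \<mapsto> U u0\<close>, where \<open>U u0\<close> lives on \<open>[0, T u0)\<close> and has
  time derivative \<open>U' u0\<close>. Since the interval of existence varies with the datum, convergence in
  \<open>C([0, T); H\<^sup>s) \<inter> C\<^sup>1([0, T); H\<^sup>s\<^sup>-\<^sup>1)\<close> is uniform convergence on compact subintervals \<open>[0, T1]\<close> of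
  \<open>[0, T u0)\<close>, on which solutions with nearby data are required to exist.
\<close>

definition solution_map_continuous ::
  "real \<Rightarrow> ((real \<Rightarrow> real) \<Rightarrow> ereal) \<Rightarrow> ((real \<Rightarrow> real) \<Rightarrow> real \<Rightarrow> real \<Rightarrow> real)
     \<Rightarrow> ((real \<Rightarrow> real) \<Rightarrow> real \<Rightarrow> real \<Rightarrow> real) \<Rightarrow> bool"
  where
  "solution_map_continuous s T U U' \<longleftrightarrow>
     (\<forall>u0\<in>sobolev_mean_zero s. \<forall>T1\<in>life_span (T u0). \<forall>\<epsilon>>0. \<exists>\<delta>>0.
        \<forall>v0\<in>sobolev_mean_zero s. sobolev_norm s (\<lambda>x. v0 x - u0 x) < \<delta> \<longrightarrow>
          T1 \<in> life_span (T v0) \<and>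
          (\<forall>t\<in>{0..T1}.
             sobolev_norm s (\<lambda>x. U v0 t x - U u0 t x) < \<epsilon> \<and>
             sobolev_norm (s - 1) (\<lambda>x. U v0 t x - U u0 t x) < \<epsilon> \<and>
             sobolev_norm (s - 1) (\<lambda>x. U' v0 t x - U' u0 t x) < \<epsilon>))"

end

theory Submission
  imports Defs
begin

text \<open>
  In terms of Fourier coefficients the equation for mean-zero \<open>u\<close> is the system
  \<open>a\<^sub>k' = - \<pi> i k (a * a)\<^sub>k - i \<gamma> a\<^sub>k / (2 \<pi> k)\<close>, and everything rests on two estimates for its
  Galerkin truncations.
  First, for an even weight \<open>W\<close> of moderate growth the energy \<open>\<Sum> W\<^sub>k |a\<^sub>k|\<^sup>2\<close> changes at a rate at most
  \<open>C \<Sum> |k| |a\<^sub>k|\<close> times itself, because symmetrising the cubic sum over \<open>k + j + l = 0\<close> leaves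
  \<open>k W\<^sub>k + j W\<^sub>j + l W\<^sub>l\<close>, which is bounded by the smallest frequency times the two other weights.
  Secondly, the \<open>L\<^sup>2\<close> distance of two approximate solutions obeys a Gronwall inequality that only
  involves \<open>\<Sum> |k| |a\<^sub>k|\<close> of one of them.
  The constant \<open>C\<close> depends on \<open>W\<close> only through a growth exponent, hence the first estimate applies to the
  weights \<open>W\<^sub>k min(1, |k|/N)\<close> uniformly in \<open>N\<close>: the high-frequency part of the \<open>H\<^sup>s\<close> norm stays as small
  as it is initially, uniformly over nearby data. Thus \<open>L\<^sup>2\<close> convergence upgrades to
  convergence in \<open>H\<^sup>s\<close>, which yields continuity in time and continuous dependence without loss of
  derivatives. Since the Galerkin solutions are global, comparing them with a given solution shows
  that nearby data have solutions on the same time interval, and no local solutions need to be glued.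
\<close>

subsection \<open>Weights and the cancellation in the energy estimate\<close>

text \<open>The obstacle is the loss of one derivative in \<open>u * u_x\<close>: the vector field
  does not map \<open>H^s\<close> into itself, so neither a fixed point argument nor a direct
  difference estimate closes there. In \<open>L^2\<close> differences can be estimated because, with
  \<open>d = b - c\<close>, the term cubic in \<open>d\<close> cancels and in the mixed term the
  derivative can be moved from \<open>d\<close> to \<open>b\<close>. That only one of the two
  functions enters through its sum of \<open>|k| |a_k|\<close> is decisive: the other may be a
  Galerkin solution about which nothing is known yet, and its own bound is then recovered by
  interpolating between smallness in \<open>L^2\<close> and the energy bound. The assumption
  \<open>s \<ge> 2\<close> enters as \<open>k^4 \<le> W_k\<close>: Cauchy-Schwarz against the sum of
  \<open>1/k^2\<close> bounds the sum of \<open>|k| |a_k|\<close> by the energy. The dispersive term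
  with \<gamma> is a skew-adjoint Fourier multiplier and drops out of every energy identity. Weights
  are described by monotonicity and growth alone because the tail weights have a corner at
  \<open>|k| = N\<close>.\<close>

text \<open>The last conjunct says that \<open>W k / \<bar>k\<bar> ^ p\<close> is nonincreasing in \<open>\<bar>k\<bar>\<close>; the constants below depend on
  \<open>W\<close> only through \<open>p\<close>.\<close>

definition weight :: "nat \<Rightarrow> (int \<Rightarrow> real) \<Rightarrow> bool" where
  "weight p W \<longleftrightarrow> (\<forall>k. 0 \<le> W k) \<and>
     (\<forall>j k. \<bar>j\<bar> \<le> \<bar>k\<bar> \<longrightarrow> W j \<le> W k \<and> W k * real_of_int \<bar>j\<bar> ^ p \<le> W j * real_of_int \<bar>k\<bar> ^ p)"

lemma weight_nonneg: "weight p W \<Longrightarrow> 0 \<le> W k"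
  and weight_mono: "weight p W \<Longrightarrow> \<bar>j\<bar> \<le> \<bar>k\<bar> \<Longrightarrow> W j \<le> W k"
  and weight_growth: "weight p W \<Longrightarrow> \<bar>j\<bar> \<le> \<bar>k\<bar> \<Longrightarrow> W k * real_of_int \<bar>j\<bar> ^ p \<le> W j * real_of_int \<bar>k\<bar> ^ p"
  by (auto simp: weight_def)

lemma weight_minus: "weight p W \<Longrightarrow> W (- k) = W k"
  by (intro antisym) (auto intro: weight_mono)

text \<open>Discrete stand-in for a bound on the derivative of \<open>x * W x\<close>, as no
  smoothness of \<open>W\<close> is available. Growth gives
  \<open>W j \<ge> (|j|/|k|)^p * W k\<close>, and Bernoulli's inequality makes this lower bound
  linear in the gap \<open>|k| - |j|\<close>.\<close>

lemma weight_diff: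
  assumes W: "weight p W" and jk: "\<bar>j\<bar> \<le> \<bar>k\<bar>"
  shows "\<bar>real_of_int \<bar>k\<bar> * W k - real_of_int \<bar>j\<bar> * W j\<bar> \<le> (real p + 1) * real_of_int (\<bar>k\<bar> - \<bar>j\<bar>) * W k"
proof (cases "k = 0")
  case True
  then show ?thesis using jk by simp
next
  case False
  define x y where "x = real_of_int \<bar>k\<bar>" and "y = real_of_int \<bar>j\<bar>"
  have x: "x > 0" and y: "0 \<le> y" "y \<le> x" using False jk by (auto simp: x_def y_def)
  have Wk: "0 \<le> W k" and Wj: "W j \<le> W k" using W jk by (auto intro: weight_nonneg weight_mono)
  have "1 + real p * (y / x - 1) \<le> (1 + (y / x - 1)) ^ p"
    by (rule Bernoulli_inequality) (use x y in auto)
  then have B: "1 + real p * (y / x - 1) \<le> (y / x) ^ p" by simp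
  have "W k * (y / x) ^ p \<le> W j"
    using weight_growth[OF W jk] x by (simp add: power_divide field_simps x_def y_def)
  then have "W k * (1 + real p * (y / x - 1)) \<le> W j"
    using mult_left_mono[OF B Wk] by linarith
  then have "y * (W k * (1 + real p * (y / x - 1))) \<le> y * W j"
    using y by (intro mult_left_mono) auto
  moreover have "y * (W k * (1 + real p * (y / x - 1))) = y * W k - (y / x) * (real p * (x - y) * W k)"
    using x by (simp add: field_simps)
  moreover have "(y / x) * (real p * (x - y) * W k) \<le> 1 * (real p * (x - y) * W k)"
    using x y Wk by (intro mult_right_mono) auto
  ultimately have 1: "y * W k - real p * (x - y) * W k \<le> y * W j" by linarith
  have 2: "y * W j \<le> x * W k" using y Wj Wk x weight_nonneg[OF W, of j] by (intro mult_mono) auto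
  have "x * W k - y * W j \<le> (real p + 1) * (x - y) * W k" using 1 by (simp add: algebra_simps)
  with 2 show ?thesis by (simp add: x_def y_def)
qed

lemma weight_double:
  assumes W: "weight p W" and "\<bar>k\<bar> \<le> 2 * \<bar>j\<bar>"
  shows "W k \<le> 2 ^ p * W j"
proof (cases "\<bar>k\<bar> \<le> \<bar>j\<bar>")
  case True
  have "W k \<le> 1 * W j" using weight_mono[OF W True] by simp
  also have "\<dots> \<le> 2 ^ p * W j" using weight_nonneg[OF W] by (intro mult_right_mono) auto
  finally show ?thesis .
next
  case False
  then have j: "0 < real_of_int \<bar>j\<bar>" using assms(2) by auto
  have "W k * real_of_int \<bar>j\<bar> ^ p \<le> W j * real_of_int \<bar>k\<bar> ^ p"
    using False by (intro weight_growth[OF W]) auto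
  also have "\<dots> \<le> W j * (2 * real_of_int \<bar>j\<bar>) ^ p"
    using assms(2) by (intro mult_left_mono power_mono weight_nonneg[OF W]) auto
  finally have "W k * real_of_int \<bar>j\<bar> ^ p \<le> (2 ^ p * W j) * real_of_int \<bar>j\<bar> ^ p"
    by (simp add: power_mult_distrib mult_ac)
  then show ?thesis using j by (simp add: mult_le_cancel_right)
qed

text \<open>Comparable numbers are comparable to their geometric mean. This shares the weight evenly
  between the two large frequencies, so that the trilinear sum becomes quadratic in
  \<open>sqrt (W k) * cmod (a k)\<close>.\<close>

lemma le_sqrt_mult_sqrt:
  assumes "0 \<le> a" "a \<le> C * b" "1 \<le> (C::real)" "b \<le> a"  "0 \<le> b"
  shows "a \<le> C * (sqrt a * sqrt b)"
proof -
  have "a * a \<le> a * (C * b)" using assms by (intro mult_left_mono) auto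
  also have "\<dots> \<le> C * (C * (a * b))" 
  proof -
    have "a * (C * b) = 1 * (C * (a * b))" by simp
    also have "\<dots> \<le> C * (C * (a * b))" using assms by (intro mult_right_mono) auto
    finally show ?thesis .
  qed
  also have "\<dots> = (C * sqrt (a * b))\<^sup>2" using assms by (simp add: power2_eq_square)
  finally have "a\<^sup>2 \<le> (C * sqrt (a * b))\<^sup>2" by (simp add: power2_eq_square)
  then have "a \<le> C * sqrt (a * b)" by (rule power2_le_imp_le) (use assms in auto)
  then show ?thesis by (simp add: real_sqrt_mult)
qed

text \<open>The factor \<open>p + 2\<close> collects \<open>p + 1\<close> from
  \<open>weight_diff\<close> and 1 from the smallest frequency; \<open>2 ^ p\<close> is the price of
  comparing the two larger weights by \<open>weight_double\<close>.\<close>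

definition comm_const :: "nat \<Rightarrow> real" where "comm_const p = (real p + 2) * 2 ^ p"

lemma comm_const_pos: "0 < comm_const p" by (simp add: comm_const_def)

text \<open>The two large frequencies have opposite signs, so their contributions nearly cancel and
  leave a multiple of \<open>|k| - |j|\<close>, which is at most \<open>|l|\<close>. Moreover
  \<open>|k| \<le> |j| + |l| \<le> 2 * |j|\<close>, so the two large weights are comparable.\<close>

lemma weight_triple_ordered:
  assumes W: "weight p W" and 0: "k + j + l = 0" and o: "\<bar>l\<bar> \<le> \<bar>j\<bar>" "\<bar>j\<bar> \<le> \<bar>k\<bar>"
  shows "\<bar>real_of_int k * W k + real_of_int j * W j + real_of_int l * W l\<bar>
     \<le> comm_const p * (real_of_int \<bar>l\<bar> * (sqrt (W j) * sqrt (W k)))"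
proof -
  have Wk: "0 \<le> W k" "0 \<le> W j" using W by (auto intro: weight_nonneg)
  have kj: "real_of_int k * W k + real_of_int j * W j = real_of_int \<bar>k\<bar> * W k - real_of_int \<bar>j\<bar> * W j
    \<or> real_of_int k * W k + real_of_int j * W j = - (real_of_int \<bar>k\<bar> * W k - real_of_int \<bar>j\<bar> * W j)"
  proof (cases "k \<ge> 0")
    case True then have "j \<le> 0" using 0 o by linarith
    then show ?thesis using True by simp
  next
    case False then have "j \<ge> 0" using 0 o by linarith
    then show ?thesis using False by simp
  qed
  have "\<bar>real_of_int k * W k + real_of_int j * W j + real_of_int l * W l\<bar>
    \<le> \<bar>real_of_int \<bar>k\<bar> * W k - real_of_int \<bar>j\<bar> * W j\<bar> + real_of_int \<bar>l\<bar> * W l"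
    using kj weight_nonneg[OF W, of l] by (auto simp: abs_mult intro: order_trans[OF abs_triangle_ineq])
  also have "\<dots> \<le> (real p + 1) * real_of_int (\<bar>k\<bar> - \<bar>j\<bar>) * W k + real_of_int \<bar>l\<bar> * W k"
    using o by (intro add_mono weight_diff[OF W] mult_left_mono weight_mono[OF W]) auto
  also have "\<dots> \<le> (real p + 1) * real_of_int \<bar>l\<bar> * W k + real_of_int \<bar>l\<bar> * W k"
    using 0 Wk by (intro add_mono mult_right_mono mult_left_mono) auto
  also have "\<dots> = (real p + 2) * (real_of_int \<bar>l\<bar> * W k)" by (simp add: algebra_simps)
  also have "W k \<le> 2 ^ p * (sqrt (W k) * sqrt (W j))"
    using Wk o 0 by (intro le_sqrt_mult_sqrt weight_double[OF W] weight_mono[OF W]) auto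
  then have "(real p + 2) * (real_of_int \<bar>l\<bar> * W k) \<le> (real p + 2) * (real_of_int \<bar>l\<bar> * (2 ^ p * (sqrt (W k) * sqrt (W j))))"
    by (intro mult_left_mono) auto
  finally show ?thesis by (simp add: comm_const_def mult_ac)
qed

text \<open>In each ordering of the frequencies one of the three terms suffices. Adding all three
  makes the bound symmetric, so that it can be summed without case distinction.\<close>

lemma weight_triple:
  assumes W: "weight p W" and 0: "k + j + l = 0"
  shows "\<bar>real_of_int k * W k + real_of_int j * W j + real_of_int l * W l\<bar>
     \<le> comm_const p * (real_of_int \<bar>k\<bar> * (sqrt (W j) * sqrt (W l)) + real_of_int \<bar>j\<bar> * (sqrt (W k) * sqrt (W l))
        + real_of_int \<bar>l\<bar> * (sqrt (W k) * sqrt (W j)))" (is "?L \<le> _ * (?a + ?b + ?c)")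
proof -
  have nn: "0 \<le> ?a" "0 \<le> ?b" "0 \<le> ?c" using weight_nonneg[OF W] by auto
  have "?L \<le> comm_const p * ?a \<or> ?L \<le> comm_const p * ?b \<or> ?L \<le> comm_const p * ?c"
  proof -
    consider "\<bar>l\<bar> \<le> \<bar>j\<bar>" "\<bar>j\<bar> \<le> \<bar>k\<bar>" | "\<bar>l\<bar> \<le> \<bar>k\<bar>" "\<bar>k\<bar> \<le> \<bar>j\<bar>" | "\<bar>j\<bar> \<le> \<bar>l\<bar>" "\<bar>l\<bar> \<le> \<bar>k\<bar>"
      | "\<bar>j\<bar> \<le> \<bar>k\<bar>" "\<bar>k\<bar> \<le> \<bar>l\<bar>" | "\<bar>k\<bar> \<le> \<bar>j\<bar>" "\<bar>j\<bar> \<le> \<bar>l\<bar>" | "\<bar>k\<bar> \<le> \<bar>l\<bar>" "\<bar>l\<bar> \<le> \<bar>j\<bar>" by linarith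
    then show ?thesis
    proof cases
      case 1 from weight_triple_ordered[OF W _ this] 0 show ?thesis by (simp add: ac_simps)
    next
      case 2 from weight_triple_ordered[OF W _ this] 0 show ?thesis by (simp add: ac_simps)
    next
      case 3 from weight_triple_ordered[OF W _ this] 0 show ?thesis by (simp add: ac_simps)
    next
      case 4 from weight_triple_ordered[OF W _ this] 0 show ?thesis by (simp add: ac_simps)
    next
      case 5 from weight_triple_ordered[OF W _ this] 0 show ?thesis by (simp add: ac_simps)
    next
      case 6 from weight_triple_ordered[OF W _ this] 0 show ?thesis by (simp add: ac_simps)
    qed
  qed
  moreover have "comm_const p * ?a \<le> comm_const p * (?a + ?b + ?c)" "comm_const p * ?b \<le> comm_const p * (?a + ?b + ?c)"
    "comm_const p * ?c \<le> comm_const p * (?a + ?b + ?c)"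
    using nn comm_const_pos[of p] by (auto intro!: mult_left_mono)
  ultimately show ?thesis by linarith
qed

section \<open>Frequency bands and sums over triples of frequencies with sum zero\<close>

definition band :: "nat \<Rightarrow> int set" where "band n = {- int n..int n}"

lemma finite_band[simp, intro]: "finite (band n)" by (simp add: band_def)
lemma band_uminus[simp]: "- k \<in> band n \<longleftrightarrow> k \<in> band n" by (auto simp: band_def)
lemma band_iff: "k \<in> band n \<longleftrightarrow> \<bar>k\<bar> \<le> int n" by (auto simp: band_def)
lemma band_mono: "n \<le> m \<Longrightarrow> band n \<subseteq> band m" by (auto simp: band_def)
lemma finite_subset_band:
  assumes "finite K"
  shows "\<exists>m. K \<subseteq> band m"
proof (intro exI subsetI)
  fix k assume "k \<in> K"
  then have "\<bar>k\<bar> \<le> Max (insert 0 (abs ` K))" using assms by (intro Max_ge) auto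
  then show "k \<in> band (nat (Max (insert 0 (abs ` K))))" by (auto simp: band_iff)
qed

lemma sum_band_uminus: "(\<Sum>k\<in>band n. f (- k)) = (\<Sum>k\<in>band n. f k)"
  by (rule sum.reindex_bij_witness[of _ uminus uminus]) auto

definition triples :: "nat \<Rightarrow> (int \<times> int \<times> int) set" where
  "triples n = {(k, j, l). k \<in> band n \<and> j \<in> band n \<and> l \<in> band n \<and> k + j + l = 0}"

lemma finite_triples[simp, intro]: "finite (triples n)"
  by (rule finite_subset[of _ "band n \<times> band n \<times> band n"]) (auto simp: triples_def)

lemma sum_triples_swap12: "(\<Sum>(k, j, l)\<in>triples n. f k j l) = (\<Sum>(k, j, l)\<in>triples n. f j k l)"
  by (rule sum.reindex_bij_witness[of _ "\<lambda>(k, j, l). (j, k, l)" "\<lambda>(k, j, l). (j, k, l)"]) (auto simp: triples_def)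
lemma sum_triples_swap23: "(\<Sum>(k, j, l)\<in>triples n. f k j l) = (\<Sum>(k, j, l)\<in>triples n. f k l j)"
  by (rule sum.reindex_bij_witness[of _ "\<lambda>(k, j, l). (k, l, j)" "\<lambda>(k, j, l). (k, l, j)"]) (auto simp: triples_def)
lemma sum_triples_swap13: "(\<Sum>(k, j, l)\<in>triples n. f k j l) = (\<Sum>(k, j, l)\<in>triples n. f l j k)"
  by (rule sum.reindex_bij_witness[of _ "\<lambda>(k, j, l). (l, j, k)" "\<lambda>(k, j, l). (l, j, k)"]) (auto simp: triples_def)

lemma sum_triples_le:
  fixes f :: "int \<Rightarrow> int \<Rightarrow> real"
  assumes "\<And>k j. 0 \<le> f k j"
  shows "(\<Sum>(k, j, l)\<in>triples n. f k j) \<le> (\<Sum>k\<in>band n. \<Sum>j\<in>band n. f k j)"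
proof -
  have inj: "inj_on (\<lambda>(k, j, l). (k, j)) (triples n)" by (auto simp: inj_on_def triples_def)
  have "(\<Sum>(k, j, l)\<in>triples n. f k j) = (\<Sum>(k, j)\<in>(\<lambda>(k, j, l). (k, j)) ` triples n. f k j)"
    by (subst sum.reindex[OF inj]) (auto intro!: sum.cong)
  also have "\<dots> \<le> (\<Sum>(k, j)\<in>band n \<times> band n. f k j)"
    by (rule sum_mono2) (auto simp: triples_def assms)
  finally show ?thesis by (simp add: sum.cartesian_product)
qed

lemma sum_triples_young:
  fixes x y :: "int \<Rightarrow> real"
  assumes "\<And>k. 0 \<le> x k" "\<And>k. 0 \<le> y k"
  shows "(\<Sum>(k, j, l)\<in>triples n. x k * (y j * y l)) \<le> (\<Sum>k\<in>band n. x k) * (\<Sum>k\<in>band n. (y k)\<^sup>2)"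
proof -
  have "(\<Sum>(k, j, l)\<in>triples n. x k * (y j * y l)) \<le> (\<Sum>(k, j, l)\<in>triples n. x k * ((y j)\<^sup>2 / 2) + x k * ((y l)\<^sup>2 / 2))"
  proof (rule sum_mono, clarify)
    fix k j l
    have "y j * y l \<le> (y j)\<^sup>2 / 2 + (y l)\<^sup>2 / 2" using sum_squares_bound[of "y j" "y l"] by simp
    from mult_left_mono[OF this assms(1)[of k]] show "x k * (y j * y l) \<le> x k * ((y j)\<^sup>2 / 2) + x k * ((y l)\<^sup>2 / 2)"
      by (simp add: distrib_left)
  qed
  also have "\<dots> = (\<Sum>(k, j, l)\<in>triples n. x k * ((y j)\<^sup>2 / 2)) + (\<Sum>(k, j, l)\<in>triples n. x k * ((y l)\<^sup>2 / 2))"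
    by (simp add: sum.distrib split_def)
  also have "(\<Sum>(k, j, l)\<in>triples n. x k * ((y l)\<^sup>2 / 2)) = (\<Sum>(k, j, l)\<in>triples n. x k * ((y j)\<^sup>2 / 2))"
    by (rule sum_triples_swap23)
  also have "(\<Sum>(k, j, l)\<in>triples n. x k * ((y j)\<^sup>2 / 2)) \<le> (\<Sum>k\<in>band n. \<Sum>j\<in>band n. x k * ((y j)\<^sup>2 / 2))"
    by (rule sum_triples_le) (simp add: assms)
  then have "(\<Sum>(k, j, l)\<in>triples n. x k * ((y j)\<^sup>2 / 2)) + (\<Sum>(k, j, l)\<in>triples n. x k * ((y j)\<^sup>2 / 2))
    \<le> 2 * (\<Sum>k\<in>band n. \<Sum>j\<in>band n. x k * ((y j)\<^sup>2 / 2))" by simp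
  also have "\<dots> = (\<Sum>k\<in>band n. \<Sum>j\<in>band n. x k * (y j)\<^sup>2)" by (simp add: sum_distrib_left)
  also have "\<dots> = (\<Sum>k\<in>band n. x k) * (\<Sum>k\<in>band n. (y k)\<^sup>2)" by (simp add: sum_product)
  finally show ?thesis .
qed

section \<open>Convolution and the two cancellations behind the energy estimates\<close>

definition conv :: "(int \<Rightarrow> complex) \<Rightarrow> (int \<Rightarrow> complex) \<Rightarrow> int \<Rightarrow> complex" where
  "conv a b k = (\<Sum>\<^sub>\<infinity>j. a j * b (k - j))"

definition supp :: "nat \<Rightarrow> (int \<Rightarrow> complex) \<Rightarrow> bool" where
  "supp n a \<longleftrightarrow> (\<forall>k. k \<notin> band n \<longrightarrow> a k = 0)"

definition herm :: "(int \<Rightarrow> complex) \<Rightarrow> bool" where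
  "herm a \<longleftrightarrow> (\<forall>k. a (- k) = cnj (a k))"

lemma conv_commute: "conv a b k = conv b a k"
  unfolding conv_def by (rule infsum_reindex_bij_witness[of _ "\<lambda>j. k - j" "\<lambda>j. k - j"]) auto

lemma conv_finite: "supp n a \<Longrightarrow> conv a b k = (\<Sum>j\<in>band n. a j * b (k - j))"
  unfolding conv_def by (subst infsum_finite[symmetric], simp, rule infsum_cong_neutral) (auto simp: supp_def)

text \<open>Evaluating at \<open>- k\<close> turns the form into a sum over triples with
  \<open>k + j + l = 0\<close>, a set on which all permutations of the frequencies act.\<close>

lemma conv_pairing:
  assumes "supp n a" "supp n b"
  shows "(\<Sum>k\<in>band n. g k * conv a b (- k)) = (\<Sum>(k, j, l)\<in>triples n. g k * (a j * b l))"
proof -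
  have "(\<Sum>k\<in>band n. g k * conv a b (- k)) = (\<Sum>(k, j)\<in>band n \<times> band n. g k * (a j * b (- k - j)))"
    by (simp add: conv_finite[OF assms(1)] sum_distrib_left sum.cartesian_product)
  also have "\<dots> = (\<Sum>(k, j)\<in>{(k, j). k \<in> band n \<and> j \<in> band n \<and> - k - j \<in> band n}. g k * (a j * b (- k - j)))"
    using assms(2) by (intro sum.mono_neutral_right) (auto simp: supp_def)
  also have "\<dots> = (\<Sum>(k, j, l)\<in>triples n. g k * (a j * b l))"
    by (rule sum.reindex_bij_witness[of _ "\<lambda>(k, j, l). (k, j)" "\<lambda>(k, j). (k, j, - k - j)"])
       (auto simp: triples_def band_def eq_neg_iff_add_eq_0 split: prod.splits intro!: arg_cong[of _ _ a] arg_cong[of _ _ b])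
  finally show ?thesis .
qed

text \<open>The right-hand side of the equation in Fourier variables. Its component at \<open>k = 0\<close> vanishes, also
  because \<open>\<gamma> / 0 = 0\<close>.\<close>

definition ost :: "real \<Rightarrow> (int \<Rightarrow> complex) \<Rightarrow> int \<Rightarrow> complex" where
  "ost \<gamma> a k = - (\<i> * of_real (pi * k)) * conv a a k - \<i> * of_real (\<gamma> / (2 * pi * k)) * a k"

definition A1 :: "nat \<Rightarrow> (int \<Rightarrow> complex) \<Rightarrow> real" where
  "A1 n a = (\<Sum>k\<in>band n. real_of_int \<bar>k\<bar> * cmod (a k))"

definition en :: "(int \<Rightarrow> real) \<Rightarrow> nat \<Rightarrow> (int \<Rightarrow> complex) \<Rightarrow> real" where
  "en W n a = (\<Sum>k\<in>band n. W k * (cmod (a k))\<^sup>2)"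

text \<open>Averaging over the permutations of a triple replaces \<open>k * W k\<close> by a third
  of the combination bounded in \<open>weight_triple\<close>. The three terms of that bound
  contribute equally to the sum, which cancels the factor 1/3.\<close>

lemma energy_cancellation:
  assumes W: "weight p W" and a: "supp n a" "herm a"
  shows "\<bar>\<Sum>k\<in>band n. W k * Re (cnj (a k) * ost \<gamma> a k)\<bar> \<le> pi * comm_const p * A1 n a * en W n a"
proof -
  let ?m = "\<lambda>k j l. of_real (real_of_int k * W k + real_of_int j * W j + real_of_int l * W l) * (a k * (a j * a l))"
  \<comment> \<open>The dispersive term gives an imaginary multiple of \<open>(cmod (a k))^2\<close>
    and disappears with the real part.\<close>
  have "(\<Sum>k\<in>band n. W k * Re (cnj (a k) * ost \<gamma> a k))
     = Re (\<Sum>k\<in>band n. - (\<i> * of_real (pi * k * W k) * cnj (a k)) * conv a a k)"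
    by (simp add: ost_def sum_distrib_left algebra_simps)
  \<comment> \<open>Reflection \<open>k\<close> to \<open>- k\<close>: the weight is even and
    \<open>cnj (a (- k)) = a k\<close>, while the factor \<open>k\<close> changes sign.\<close>
  also have "(\<Sum>k\<in>band n. - (\<i> * of_real (pi * k * W k) * cnj (a k)) * conv a a k)
     = (\<Sum>k\<in>band n. (\<i> * of_real (pi * k * W k) * a k) * conv a a (- k))"
    by (subst sum_band_uminus[symmetric]) (use a in \<open>simp add: herm_def weight_minus[OF W]\<close>)
  also have "\<dots> = (\<Sum>(k, j, l)\<in>triples n. (\<i> * of_real (pi * k * W k) * a k) * (a j * a l))"
    by (rule conv_pairing[OF a(1) a(1)])
  also have "\<dots> = \<i> * of_real pi * (\<Sum>(k, j, l)\<in>triples n. of_real (k * W k) * (a k * (a j * a l)))"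
    by (simp add: sum_distrib_left split_def mult_ac)
  also have "(\<Sum>(k, j, l)\<in>triples n. of_real (k * W k) * (a k * (a j * a l)))
      = (\<Sum>(k, j, l)\<in>triples n. ?m k j l) / 3" (is "?S = _")
  proof -
    have 2: "?S = (\<Sum>(k, j, l)\<in>triples n. of_real (j * W j) * (a k * (a j * a l)))"
      by (subst sum_triples_swap12) (simp add: mult_ac)
    have 3: "?S = (\<Sum>(k, j, l)\<in>triples n. of_real (l * W l) * (a k * (a j * a l)))"
      by (subst sum_triples_swap13) (simp add: mult_ac)
    have "(\<Sum>(k, j, l)\<in>triples n. ?m k j l) = ?S + (\<Sum>(k, j, l)\<in>triples n. of_real (j * W j) * (a k * (a j * a l)))
       + (\<Sum>(k, j, l)\<in>triples n. of_real (l * W l) * (a k * (a j * a l)))"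
      by (simp add: sum.distrib[symmetric] split_def algebra_simps)
    also have "\<dots> = ?S + ?S + ?S" using 2 3 by metis
    finally show ?thesis by simp
  qed
  finally have eq: "(\<Sum>k\<in>band n. W k * Re (cnj (a k) * ost \<gamma> a k))
     = Re (\<i> * of_real pi * ((\<Sum>(k, j, l)\<in>triples n. ?m k j l) / 3))" .
  define y where "y k = sqrt (W k) * cmod (a k)" for k
  define x where "x k = real_of_int \<bar>k\<bar> * cmod (a k)" for k
  have "\<bar>\<Sum>k\<in>band n. W k * Re (cnj (a k) * ost \<gamma> a k)\<bar> \<le> cmod (\<i> * of_real pi * ((\<Sum>(k, j, l)\<in>triples n. ?m k j l) / 3))"
    unfolding eq by (rule abs_Re_le_cmod)
  also have "\<dots> = pi / 3 * cmod (\<Sum>(k, j, l)\<in>triples n. ?m k j l)" by (simp add: norm_mult norm_divide)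
  also have "cmod (\<Sum>(k, j, l)\<in>triples n. ?m k j l) \<le> (\<Sum>(k, j, l)\<in>triples n. cmod (?m k j l))"
    by (rule order_trans[OF norm_sum]) (simp add: split_def)
  also have "\<dots> \<le> (\<Sum>(k, j, l)\<in>triples n. comm_const p * (x k * (y j * y l) + x j * (y k * y l) + x l * (y k * y j)))"
  proof (rule sum_mono, clarify)
    fix k j l assume "(k, j, l) \<in> triples n"
    then have "k + j + l = 0" by (simp add: triples_def)
    from mult_right_mono[OF weight_triple[OF W this], of "cmod (a k) * (cmod (a j) * cmod (a l))"]
    show "cmod (?m k j l) \<le> comm_const p * (x k * (y j * y l) + x j * (y k * y l) + x l * (y k * y j))"
      by (simp only: norm_mult norm_of_real x_def y_def) (simp add: algebra_simps)
  qed
  also have "\<dots> = comm_const p * ((\<Sum>(k, j, l)\<in>triples n. x k * (y j * y l)) + (\<Sum>(k, j, l)\<in>triples n. x j * (y k * y l))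
     + (\<Sum>(k, j, l)\<in>triples n. x l * (y k * y j)))"
    unfolding split_def sum.distrib[symmetric] sum_distrib_left ..
  also have "(\<Sum>(k, j, l)\<in>triples n. x j * (y k * y l)) = (\<Sum>(k, j, l)\<in>triples n. x k * (y j * y l))"
    by (rule sum_triples_swap12)
  also have "(\<Sum>(k, j, l)\<in>triples n. x l * (y k * y j)) = (\<Sum>(k, j, l)\<in>triples n. x k * (y j * y l))"
    by (subst sum_triples_swap13) (simp add: mult_ac)
  also have "(\<Sum>(k, j, l)\<in>triples n. x k * (y j * y l)) + (\<Sum>(k, j, l)\<in>triples n. x k * (y j * y l))
     + (\<Sum>(k, j, l)\<in>triples n. x k * (y j * y l)) = 3 * (\<Sum>(k, j, l)\<in>triples n. x k * (y j * y l))" by simp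
  also have "(\<Sum>(k, j, l)\<in>triples n. x k * (y j * y l)) \<le> (\<Sum>k\<in>band n. x k) * (\<Sum>k\<in>band n. (y k)\<^sup>2)"
    by (rule sum_triples_young) (auto simp: x_def y_def weight_nonneg[OF W])
  also have "(\<Sum>k\<in>band n. x k) = A1 n a" by (simp add: A1_def x_def)
  also have "(\<Sum>k\<in>band n. (y k)\<^sup>2) = en W n a"
    by (simp add: en_def y_def power_mult_distrib weight_nonneg[OF W])
  finally show ?thesis using comm_const_pos[of p] by (simp add: mult_left_mono)
qed

text \<open>Expanding around \<open>b\<close> instead of using \<open>(b - c) * (b + c)\<close>
  eliminates \<open>c\<close>; the remaining quadratic term in the difference will not
  contribute.\<close>

lemma conv_diff_square:
  assumes "supp n b" "supp n c"
  shows "conv b b k - conv c c k = 2 * conv b (\<lambda>k. b k - c k) k - conv (\<lambda>k. b k - c k) (\<lambda>k. b k - c k) k"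
proof -
  have d: "supp n (\<lambda>k. b k - c k)" using assms by (auto simp: supp_def)
  have 1: "conv b c k = conv c b k" by (rule conv_commute)
  show ?thesis using 1
    by (simp add: conv_finite[OF assms(1)] conv_finite[OF assms(2)] conv_finite[OF d] algebra_simps sum_subtractf sum.distrib)
qed

text \<open>With \<open>d = b - c\<close>, the cubic term in \<open>d\<close> corresponds to the
  integral of the derivative of \<open>d^3\<close> and vanishes. In the mixed term an integration by
  parts puts the derivative on \<open>b\<close>. Hence no norm of \<open>c\<close> appears.\<close>

lemma difference_cancellation:
  assumes b: "supp n b" "herm b" and c: "supp n c" "herm c"
  shows "\<bar>\<Sum>k\<in>band n. Re (cnj (b k - c k) * (ost \<gamma> b k - ost \<gamma> c k))\<bar> \<le> pi * A1 n b * en (\<lambda>_. 1) n (\<lambda>k. b k - c k)"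
proof -
  define d where "d = (\<lambda>k. b k - c k)"
  have d: "supp n d" "herm d" using b c by (auto simp: supp_def herm_def d_def)
  have ost_diff: "ost \<gamma> b k - ost \<gamma> c k = - (\<i> * of_real (pi * k)) * (2 * conv b d k - conv d d k) - \<i> * of_real (\<gamma> / (2 * pi * k)) * d k" for k
    unfolding ost_def d_def conv_diff_square[OF b(1) c(1), symmetric] by algebra
  have "(\<Sum>k\<in>band n. Re (cnj (d k) * (ost \<gamma> b k - ost \<gamma> c k)))
     = Re (\<Sum>k\<in>band n. - (\<i> * of_real (pi * k) * cnj (d k)) * (2 * conv b d k - conv d d k))"
    unfolding ost_diff by (simp add: algebra_simps)
  also have "(\<Sum>k\<in>band n. - (\<i> * of_real (pi * k) * cnj (d k)) * (2 * conv b d k - conv d d k))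
     = (\<Sum>k\<in>band n. (\<i> * of_real (pi * k) * d k) * (2 * conv b d (- k) - conv d d (- k)))"
    by (subst sum_band_uminus[symmetric]) (use d in \<open>simp add: herm_def\<close>)
  also have "\<dots> = 2 * (\<Sum>k\<in>band n. (\<i> * of_real (pi * k) * d k) * conv b d (- k))
      - (\<Sum>k\<in>band n. (\<i> * of_real (pi * k) * d k) * conv d d (- k))"
    by (simp add: sum_subtractf sum_distrib_left algebra_simps)
  also have "(\<Sum>k\<in>band n. (\<i> * of_real (pi * k) * d k) * conv b d (- k))
      = \<i> * of_real pi * (\<Sum>(k, j, l)\<in>triples n. of_int k * (d k * b j * d l))"
    unfolding conv_pairing[OF b(1) d(1)] by (simp add: sum_distrib_left split_def mult_ac)
  also have "(\<Sum>k\<in>band n. (\<i> * of_real (pi * k) * d k) * conv d d (- k))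
      = \<i> * of_real pi * (\<Sum>(k, j, l)\<in>triples n. of_int k * (d k * d j * d l))"
    unfolding conv_pairing[OF d(1) d(1)] by (simp add: sum_distrib_left split_def mult_ac)
  \<comment> \<open>Symmetrising replaces \<open>k\<close> by \<open>(k + j + l) / 3\<close>, which
    is zero.\<close>
  also have "(\<Sum>(k, j, l)\<in>triples n. of_int k * (d k * d j * d l)) = 0" (is "?S = 0")
  proof -
    have 2: "?S = (\<Sum>(k, j, l)\<in>triples n. of_int j * (d k * d j * d l))"
      by (subst sum_triples_swap12) (simp add: mult_ac)
    have 3: "?S = (\<Sum>(k, j, l)\<in>triples n. of_int l * (d k * d j * d l))"
      by (subst sum_triples_swap13) (simp add: mult_ac)
    have "?S + ?S + ?S = ?S + (\<Sum>(k, j, l)\<in>triples n. of_int j * (d k * d j * d l))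
       + (\<Sum>(k, j, l)\<in>triples n. of_int l * (d k * d j * d l))" using 2 3 by metis
    also have "\<dots> = (\<Sum>(k, j, l)\<in>triples n. of_int (k + j + l) * (d k * d j * d l))"
      by (simp add: sum.distrib[symmetric] split_def algebra_simps)
    also have "\<dots> = 0"
    proof (rule sum.neutral, clarify)
      fix k j l assume "(k, j, l) \<in> triples n"
      then have "k + j + l = 0" by (simp add: triples_def)
      then show "of_int (k + j + l) * (d k * d j * d l) = 0" by (simp only: of_int_0 mult_zero_left)
    qed
    finally show ?thesis by simp
  qed
  \<comment> \<open>Symmetrising over the two places occupied by \<open>d\<close> gives
    \<open>k + l\<close>, which equals \<open>- j\<close>, the frequency of
    \<open>b\<close>.\<close>
  also have "2 * (\<i> * of_real pi * (\<Sum>(k, j, l)\<in>triples n. of_int k * (d k * b j * d l))) - \<i> * of_real pi * 0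
    = - (\<i> * of_real pi * (\<Sum>(k, j, l)\<in>triples n. of_int k * (b k * (d j * d l))))"
  proof -
    let ?S = "\<Sum>(k, j, l)\<in>triples n. of_int k * (d k * b j * d l)"
    have 3: "?S = (\<Sum>(k, j, l)\<in>triples n. of_int l * (d k * b j * d l))"
      by (subst sum_triples_swap13) (simp add: mult_ac)
    have "2 * ?S = ?S + (\<Sum>(k, j, l)\<in>triples n. of_int l * (d k * b j * d l))"
      unfolding 3[symmetric] by (rule mult_2)
    also have "\<dots> = (\<Sum>(k, j, l)\<in>triples n. of_int (k + l) * (d k * b j * d l))"
      by (simp add: sum.distrib[symmetric] split_def algebra_simps)
    also have "\<dots> = (\<Sum>(k, j, l)\<in>triples n. - (of_int j * (b j * (d k * d l))))"
    proof (rule sum.cong[OF refl], clarify)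
      fix k j l assume "(k, j, l) \<in> triples n"
      then have "k + l = - j" by (auto simp: triples_def)
      then show "of_int (k + l) * (d k * b j * d l) = - (of_int j * (b j * (d k * d l)))" by (simp only:) simp
    qed
    also have "\<dots> = - (\<Sum>(k, j, l)\<in>triples n. of_int j * (b j * (d k * d l)))" by (simp add: sum_negf split_def)
    also have "(\<Sum>(k, j, l)\<in>triples n. of_int j * (b j * (d k * d l))) = (\<Sum>(k, j, l)\<in>triples n. of_int k * (b k * (d j * d l)))"
      by (rule sum_triples_swap12)
    finally have e: "2 * ?S = - (\<Sum>(k, j, l)\<in>triples n. of_int k * (b k * (d j * d l)))" .
    have "2 * (\<i> * of_real pi * ?S) - \<i> * of_real pi * 0 = \<i> * of_real pi * (2 * ?S)"
      by (simp only: mult_zero_right diff_zero mult.left_commute[of 2])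
    then show ?thesis unfolding e by (simp only: mult_minus_right)
  qed
  finally have eq: "(\<Sum>k\<in>band n. Re (cnj (d k) * (ost \<gamma> b k - ost \<gamma> c k)))
     = Re (- (\<i> * of_real pi * (\<Sum>(k, j, l)\<in>triples n. of_int k * (b k * (d j * d l)))))" .
  have "\<bar>\<Sum>k\<in>band n. Re (cnj (d k) * (ost \<gamma> b k - ost \<gamma> c k))\<bar>
     \<le> cmod (- (\<i> * of_real pi * (\<Sum>(k, j, l)\<in>triples n. of_int k * (b k * (d j * d l)))))"
    unfolding eq by (rule abs_Re_le_cmod)
  also have "\<dots> = pi * cmod (\<Sum>(k, j, l)\<in>triples n. of_int k * (b k * (d j * d l)))" by (simp add: norm_mult)
  also have "\<dots> \<le> pi * (\<Sum>(k, j, l)\<in>triples n. (real_of_int \<bar>k\<bar> * cmod (b k)) * (cmod (d j) * cmod (d l)))"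
    by (intro mult_left_mono order_trans[OF norm_sum]) (simp_all add: split_def norm_mult mult_ac)
  also have "\<dots> \<le> pi * (A1 n b * en (\<lambda>_. 1) n d)"
    unfolding A1_def en_def mult_1 by (intro mult_left_mono sum_triples_young) auto
  finally show ?thesis by (simp add: d_def mult_ac)
qed

subsection \<open>Weighted square sums\<close>

text \<open>Bounding all finite partial sums expresses membership in a weighted \<open>\<ell>\<^sup>2\<close> space together with a bound
  on the squared norm, without summability side conditions, and it passes to pointwise limits.\<close>

definition hb :: "(int \<Rightarrow> real) \<Rightarrow> (int \<Rightarrow> complex) \<Rightarrow> real \<Rightarrow> bool" where
  "hb W a A \<longleftrightarrow> (\<forall>K. finite K \<longrightarrow> (\<Sum>k\<in>K. W k * (cmod (a k))\<^sup>2) \<le> A)"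

definition trunc :: "nat \<Rightarrow> (int \<Rightarrow> complex) \<Rightarrow> int \<Rightarrow> complex" where
  "trunc n a k = (if k \<in> band n then a k else 0)"

lemma hbD: "hb W a A \<Longrightarrow> finite K \<Longrightarrow> (\<Sum>k\<in>K. W k * (cmod (a k))\<^sup>2) \<le> A" by (simp add: hb_def)
lemma hb_bound_nonneg: "hb W a A \<Longrightarrow> 0 \<le> A" using hbD[of W a A "{}"] by simp
lemma hb_single: "hb W a A \<Longrightarrow> W k * (cmod (a k))\<^sup>2 \<le> A" using hbD[of W a A "{k}"] by simp
lemma hb_le: "hb W a A \<Longrightarrow> A \<le> B \<Longrightarrow> hb W a B" unfolding hb_def by (meson order_trans)
lemma hb_en: "hb W a A \<Longrightarrow> en W n a \<le> A" by (simp add: en_def hb_def)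

lemma hb_dominate:
  assumes "hb W a A" "0 \<le> c" "\<And>k. V k * (cmod (b k))\<^sup>2 \<le> c * (W k * (cmod (a k))\<^sup>2)"
  shows "hb V b (c * A)"
  unfolding hb_def
proof safe
  fix K :: "int set" assume K: "finite K"
  have "(\<Sum>k\<in>K. V k * (cmod (b k))\<^sup>2) \<le> (\<Sum>k\<in>K. c * (W k * (cmod (a k))\<^sup>2))" by (intro sum_mono assms)
  also have "\<dots> \<le> c * A" unfolding sum_distrib_left[symmetric] by (intro mult_left_mono hbD[OF assms(1) K] assms)
  finally show "(\<Sum>k\<in>K. V k * (cmod (b k))\<^sup>2) \<le> c * A" .
qed

lemma hb_mono:
  assumes "hb W a A" "\<And>k. V k * (cmod (b k))\<^sup>2 \<le> W k * (cmod (a k))\<^sup>2"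
  shows "hb V b A"
  using hb_dominate[OF assms(1), of 1 V b] assms(2) by simp

lemma hb_weight_mono: "hb W a A \<Longrightarrow> (\<And>k. V k \<le> W k) \<Longrightarrow> hb V a A"
  by (erule hb_mono) (auto intro: mult_right_mono)

lemma supp_trunc[simp]: "supp n (trunc n a)" by (simp add: supp_def trunc_def)
lemma herm_trunc: "herm a \<Longrightarrow> herm (trunc n a)" by (simp add: herm_def trunc_def)
lemma hb_trunc: "hb W a A \<Longrightarrow> (\<And>k. 0 \<le> W k) \<Longrightarrow> hb W (trunc n a) A"
  by (erule hb_mono) (auto simp: trunc_def)

lemma supp_hb_en: "supp n a \<Longrightarrow> (\<And>k. 0 \<le> W k) \<Longrightarrow> hb W a (en W n a)"
  unfolding hb_def
proof safe
  fix K :: "int set" assume a: "supp n a" and K: "finite K" and W: "\<And>k. 0 \<le> W k"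
  have "(\<Sum>k\<in>K. W k * (cmod (a k))\<^sup>2) \<le> (\<Sum>k\<in>K \<union> band n. W k * (cmod (a k))\<^sup>2)"
    using K W by (intro sum_mono2) auto
  also have "\<dots> = en W n a" unfolding en_def using a K by (intro sum.mono_neutral_right) (auto simp: supp_def)
  finally show "(\<Sum>k\<in>K. W k * (cmod (a k))\<^sup>2) \<le> en W n a" .
qed

lemma norm_add_sq_le: "(cmod (x + y))\<^sup>2 \<le> 2 * (cmod x)\<^sup>2 + 2 * (cmod y)\<^sup>2"
proof -
  have "(cmod (x + y))\<^sup>2 \<le> (cmod x + cmod y)\<^sup>2" by (intro power_mono norm_triangle_ineq) auto
  also have "\<dots> \<le> 2 * (cmod x)\<^sup>2 + 2 * (cmod y)\<^sup>2" using sum_squares_bound[of "cmod x" "cmod y"] by (simp add: power2_sum)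
  finally show ?thesis .
qed

lemma hb_add:
  assumes "hb W a A" "hb W b B" "\<And>k. 0 \<le> W k"
  shows "hb W (\<lambda>k. a k + b k) (2 * A + 2 * B)"
  unfolding hb_def
proof safe
  fix K :: "int set" assume K: "finite K"
  have "(\<Sum>k\<in>K. W k * (cmod (a k + b k))\<^sup>2) \<le> (\<Sum>k\<in>K. 2 * (W k * (cmod (a k))\<^sup>2) + 2 * (W k * (cmod (b k))\<^sup>2))"
  proof (rule sum_mono)
    fix k show "W k * (cmod (a k + b k))\<^sup>2 \<le> 2 * (W k * (cmod (a k))\<^sup>2) + 2 * (W k * (cmod (b k))\<^sup>2)"
      using mult_left_mono[OF norm_add_sq_le[of "a k" "b k"] assms(3)[of k]] by (simp add: algebra_simps)
  qed
  also have "\<dots> = 2 * (\<Sum>k\<in>K. W k * (cmod (a k))\<^sup>2) + 2 * (\<Sum>k\<in>K. W k * (cmod (b k))\<^sup>2)"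
    by (simp add: sum.distrib sum_distrib_left)
  also have "\<dots> \<le> 2 * A + 2 * B" using hbD[OF assms(1) K] hbD[OF assms(2) K] by simp
  finally show "(\<Sum>k\<in>K. W k * (cmod (a k + b k))\<^sup>2) \<le> 2 * A + 2 * B" .
qed

lemma hb_uminus: "hb W (\<lambda>k. - a k) A \<longleftrightarrow> hb W a A" by (simp add: hb_def)

lemma hb_diff:
  assumes "hb W a A" "hb W b B" "\<And>k. 0 \<le> W k"
  shows "hb W (\<lambda>k. a k - b k) (2 * A + 2 * B)"
  using hb_add[OF assms(1), of "\<lambda>k. - b k" B] assms by (simp add: hb_uminus)

lemma hb_tendsto:
  assumes "\<And>k. ((\<lambda>n. a n k) \<longlongrightarrow> b k) F" "F \<noteq> bot" "eventually (\<lambda>n. hb W (a n) A) F"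
  shows "hb W b A"
  unfolding hb_def
proof safe
  fix K :: "int set" assume K: "finite K"
  show "(\<Sum>k\<in>K. W k * (cmod (b k))\<^sup>2) \<le> A"
  proof (rule tendsto_upperbound[OF _ _ assms(2)])
    show "((\<lambda>n. \<Sum>k\<in>K. W k * (cmod (a n k))\<^sup>2) \<longlongrightarrow> (\<Sum>k\<in>K. W k * (cmod (b k))\<^sup>2)) F"
      by (intro tendsto_intros assms)
    show "\<forall>\<^sub>F n in F. (\<Sum>k\<in>K. W k * (cmod (a n k))\<^sup>2) \<le> A"
      using assms(3) by eventually_elim (rule hbD[OF _ K])
  qed
qed

section \<open>Sums of moduli controlled by weighted square sums\<close>

definition zsum :: real where "zsum = (\<Sum>\<^sub>\<infinity>k::int. 1 / (real_of_int k)\<^sup>2)"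

text \<open>The term at \<open>k = 0\<close> is \<open>1 / 0 = 0\<close>, so this is the sum over
  nonzero integers.\<close>

lemma summable_inverse_squares_int: "(\<lambda>k::int. 1 / (real_of_int k)\<^sup>2) summable_on UNIV"
proof -
  have 0: "(\<lambda>n::nat. 1 / (real n)\<^sup>2) summable_on UNIV"
    by (rule norm_summable_imp_summable_on) (use inverse_power_summable[of 2, where 'a=real] in \<open>simp add: inverse_eq_divide power_divide\<close>)
  have 1: "(\<lambda>k::int. 1 / (real_of_int k)\<^sup>2) summable_on range int"
    by (subst summable_on_reindex) (use 0 in \<open>auto simp: o_def\<close>)
  have 2: "(\<lambda>k::int. 1 / (real_of_int k)\<^sup>2) summable_on range (\<lambda>n. - int n)"
    by (subst summable_on_reindex) (use 0 in \<open>auto simp: o_def inj_on_def\<close>)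
  have "UNIV = range int \<union> range (\<lambda>n. - int n)"
  proof (intro set_eqI iffI UNIV_I)
    fix k :: int show "k \<in> range int \<union> range (\<lambda>n. - int n)"
      by (cases k rule: int_cases2) auto
  qed
  then show ?thesis using summable_on_union[OF 1 2] by simp
qed

lemma zsum_bound: "finite K \<Longrightarrow> (\<Sum>k\<in>K. 1 / (real_of_int k)\<^sup>2) \<le> zsum"
  unfolding zsum_def by (rule finite_sum_le_infsum[OF summable_inverse_squares_int]) auto

lemma zsum_nonneg: "0 \<le> zsum" using zsum_bound[of "{}"] by simp

text \<open>Cauchy-Schwarz for the products \<open>(1 / |k|) * (|k| * cmod (a k))\<close>. At
  \<open>k = 0\<close> this product is 0, whence the side condition.\<close>

lemma l1_bound_aux:
  assumes "finite K" "0 \<notin> K \<or> a 0 = 0"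
  shows "(\<Sum>k\<in>K. cmod (a k))\<^sup>2 \<le> (\<Sum>k\<in>K. 1 / (real_of_int k)\<^sup>2) * (\<Sum>k\<in>K. (real_of_int k)\<^sup>2 * (cmod (a k))\<^sup>2)"
proof -
  have "(\<Sum>k\<in>K. cmod (a k)) = (\<Sum>k\<in>K. (1 / \<bar>real_of_int k\<bar>) * (\<bar>real_of_int k\<bar> * cmod (a k)))"
    using assms by (intro sum.cong) auto
  then show ?thesis
    using Cauchy_Schwarz_ineq_sum[of "\<lambda>k. 1 / \<bar>real_of_int k\<bar>" "\<lambda>k. \<bar>real_of_int k\<bar> * cmod (a k)" K]
    by (simp add: power_divide power_mult_distrib)
qed

lemma l1_bound:
  assumes a: "hb (\<lambda>k. (real_of_int k)\<^sup>2) a A" "a 0 = 0" and K: "finite K"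
  shows "(\<Sum>k\<in>K. cmod (a k)) \<le> sqrt (zsum * A)"
proof -
  have "(\<Sum>k\<in>K. cmod (a k))\<^sup>2 \<le> (\<Sum>k\<in>K. 1 / (real_of_int k)\<^sup>2) * (\<Sum>k\<in>K. (real_of_int k)\<^sup>2 * (cmod (a k))\<^sup>2)"
    using l1_bound_aux[OF K] a(2) by auto
  also have "\<dots> \<le> zsum * A"
    by (intro mult_mono zsum_bound K hbD[OF a(1)] zsum_nonneg sum_nonneg) auto
  finally show ?thesis by (rule real_le_rsqrt)
qed

lemma hb_times_freq:
  "hb (\<lambda>k. (real_of_int k) ^ 4) a A \<Longrightarrow> hb (\<lambda>k. (real_of_int k)\<^sup>2) (\<lambda>k. of_int k * a k) A"
  by (erule hb_mono) (simp add: norm_mult power_mult_distrib)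

lemma A1_bound:
  assumes a: "hb (\<lambda>k. (real_of_int k) ^ 4) a A"
  shows "A1 n a \<le> sqrt (zsum * A)"
  using l1_bound[OF hb_times_freq[OF a] _ finite_band, of n]
  by (simp add: A1_def norm_mult)

text \<open>Interpolation between \<open>L^2\<close> and \<open>H^2\<close>, in qualitative form: on
  a finite set of frequencies smallness in \<open>L^2\<close> suffices, and outside it the tail of
  the sum of \<open>1 / k^2\<close> is small against the fixed bound \<open>M\<close>. The threshold
  is the same for all \<open>n\<close>.\<close>

lemma A1_small:
  assumes "\<epsilon> > 0" "M \<ge> 0"
  shows "\<exists>\<eta>>0. \<forall>n d. hb (\<lambda>k. (real_of_int k) ^ 4) d M \<longrightarrow> hb (\<lambda>_. 1) d \<eta> \<longrightarrow> A1 n d \<le> \<epsilon>"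
proof -
  \<comment> \<open>Chosen so that \<open>\<theta> * (M + 1) = (\<epsilon> / 2)^2\<close>; the added
    1 avoids division by zero when \<open>M = 0\<close>.\<close>
  define \<theta> where "\<theta> = (\<epsilon> / 2)\<^sup>2 / (M + 1)"
  have "\<theta> > 0" using assms by (simp add: \<theta>_def)
  then obtain F where F: "finite F" "dist (sum (\<lambda>k. 1 / (real_of_int k)\<^sup>2) F) zsum \<le> \<theta>"
    using infsum_finite_approximation[OF summable_inverse_squares_int, of \<theta>] unfolding zsum_def by blast
  have tail: "(\<Sum>k\<in>K. 1 / (real_of_int k)\<^sup>2) \<le> \<theta>" if K: "finite K" "K \<inter> F = {}" for K
  proof -
    have "(\<Sum>k\<in>K. 1 / (real_of_int k)\<^sup>2) + (\<Sum>k\<in>F. 1 / (real_of_int k)\<^sup>2) \<le> zsum"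
      using zsum_bound[of "K \<union> F"] K F by (simp add: sum.union_disjoint)
    then show ?thesis using F(2) by (simp add: dist_real_def)
  qed
  define Q where "Q = (\<Sum>k\<in>F. (real_of_int k)\<^sup>2)"
  have Q: "Q \<ge> 0" by (simp add: Q_def sum_nonneg)
  define \<eta> where "\<eta> = (\<epsilon> / 2)\<^sup>2 / (Q + 1)"
  have "\<eta> > 0" using assms Q by (simp add: \<eta>_def)
  moreover have "A1 n d \<le> \<epsilon>" if d: "hb (\<lambda>k. (real_of_int k) ^ 4) d M" "hb (\<lambda>_. 1) d \<eta>" for n d
  proof -
    let ?f = "\<lambda>k. cmod (of_int k * d k)"
    have "A1 n d = (\<Sum>k\<in>band n \<inter> F. ?f k) + (\<Sum>k\<in>band n - F. ?f k)"
      unfolding A1_def by (subst sum.union_disjoint[symmetric]) (auto simp: norm_mult intro!: sum.cong)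
    also have "(\<Sum>k\<in>band n \<inter> F. ?f k) \<le> \<epsilon> / 2"
    proof -
      have "(\<Sum>k\<in>band n \<inter> F. ?f k)\<^sup>2 \<le> (\<Sum>k\<in>band n \<inter> F. (real_of_int k)\<^sup>2) * (\<Sum>k\<in>band n \<inter> F. (cmod (d k))\<^sup>2)"
        using Cauchy_Schwarz_ineq_sum[of "\<lambda>k. \<bar>real_of_int k\<bar>" "\<lambda>k. cmod (d k)" "band n \<inter> F"] by (simp add: norm_mult)
      also have "\<dots> \<le> Q * \<eta>"
        using hbD[OF d(2), of "band n \<inter> F"] F(1) Q unfolding Q_def
        by (intro mult_mono sum_mono2) (auto intro: sum_nonneg)
      also have "\<dots> \<le> (Q + 1) * \<eta>" using \<open>\<eta> > 0\<close> by (intro mult_right_mono) auto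
      also have "\<dots> = (\<epsilon> / 2)\<^sup>2" using Q by (simp add: \<eta>_def)
      finally show ?thesis by (rule power2_le_imp_le) (use assms in auto)
    qed
    also have "(\<Sum>k\<in>band n - F. ?f k) \<le> \<epsilon> / 2"
    proof -
      have "(\<Sum>k\<in>band n - F. ?f k)\<^sup>2 \<le> (\<Sum>k\<in>band n - F. 1 / (real_of_int k)\<^sup>2) * (\<Sum>k\<in>band n - F. (real_of_int k)\<^sup>2 * (?f k)\<^sup>2)"
        by (rule l1_bound_aux) auto
      also have "\<dots> \<le> \<theta> * M"
        using \<open>\<theta> > 0\<close> by (intro mult_mono tail hbD[OF hb_times_freq[OF d(1)]] sum_nonneg) auto
      also have "\<dots> \<le> \<theta> * (M + 1)" using \<open>\<theta> > 0\<close> by (intro mult_left_mono) auto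
      also have "\<dots> = (\<epsilon> / 2)\<^sup>2" using assms by (simp add: \<theta>_def)
      finally show ?thesis by (rule power2_le_imp_le) (use assms in auto)
    qed
    finally show ?thesis by simp
  qed
  ultimately show ?thesis by blast
qed

section \<open>Young's inequality and the algebra property of weighted spaces\<close>

lemma sum_le_bounded:
  fixes \<beta> :: "int \<Rightarrow> real"
  assumes "\<And>L. finite L \<Longrightarrow> sum \<beta> L \<le> B" "finite K"
  shows "(\<Sum>k\<in>K. \<beta> (k - j)) \<le> B" and "(\<Sum>k\<in>K. \<beta> (j - k)) \<le> B"
proof -
  have "(\<Sum>k\<in>K. \<beta> (k - j)) = sum \<beta> ((\<lambda>k. k - j) ` K)" for j :: int
    by (subst sum.reindex) (auto simp: inj_on_def)
  then show "(\<Sum>k\<in>K. \<beta> (k - j)) \<le> B" using assms by simp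
  have "(\<Sum>k\<in>K. \<beta> (j - k)) = sum \<beta> ((\<lambda>k. j - k) ` K)" for j :: int
    by (subst sum.reindex) (auto simp: inj_on_def)
  then show "(\<Sum>k\<in>K. \<beta> (j - k)) \<le> B" using assms by simp
qed

text \<open>Young's inequality on finite sections: Cauchy-Schwarz with respect to the measure with
  masses \<open>\<alpha> j\<close>, of total mass at most \<open>A\<close>, followed by summation
  over \<open>k\<close> first. The index sets \<open>J\<close> and \<open>K\<close> are independent,
  so that the limit in \<open>J\<close> can be taken while \<open>K\<close> is fixed.\<close>

lemma young_l1_l2:
  fixes \<alpha> \<beta> :: "int \<Rightarrow> real"
  assumes \<alpha>: "\<And>k. 0 \<le> \<alpha> k" "\<And>L. finite L \<Longrightarrow> sum \<alpha> L \<le> A"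
    and \<beta>: "\<And>L. finite L \<Longrightarrow> (\<Sum>k\<in>L. (\<beta> k)\<^sup>2) \<le> B" and fin: "finite J" "finite K"
  shows "(\<Sum>k\<in>K. (\<Sum>j\<in>J. \<alpha> j * \<beta> (k - j))\<^sup>2) \<le> A\<^sup>2 * B"
proof -
  have A: "0 \<le> A" using \<alpha>(2)[of "{}"] by simp
  have B: "0 \<le> B" using \<beta>[of "{}"] by simp
  have "(\<Sum>j\<in>J. \<alpha> j * \<beta> (k - j))\<^sup>2 \<le> A * (\<Sum>j\<in>J. \<alpha> j * (\<beta> (k - j))\<^sup>2)" for k
  proof -
    have "(\<Sum>j\<in>J. \<alpha> j * \<beta> (k - j)) = (\<Sum>j\<in>J. sqrt (\<alpha> j) * (sqrt (\<alpha> j) * \<beta> (k - j)))"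
      using \<alpha>(1) by (simp add: mult.assoc[symmetric])
    then have "(\<Sum>j\<in>J. \<alpha> j * \<beta> (k - j))\<^sup>2 \<le> (\<Sum>j\<in>J. \<alpha> j) * (\<Sum>j\<in>J. \<alpha> j * (\<beta> (k - j))\<^sup>2)"
      using Cauchy_Schwarz_ineq_sum[of "\<lambda>j. sqrt (\<alpha> j)" "\<lambda>j. sqrt (\<alpha> j) * \<beta> (k - j)" J] \<alpha>(1)
      by (simp add: power_mult_distrib)
    also have "\<dots> \<le> A * (\<Sum>j\<in>J. \<alpha> j * (\<beta> (k - j))\<^sup>2)"
      by (intro mult_right_mono \<alpha>(2) fin sum_nonneg mult_nonneg_nonneg \<alpha>(1)) auto
    finally show ?thesis .
  qed
  then have "(\<Sum>k\<in>K. (\<Sum>j\<in>J. \<alpha> j * \<beta> (k - j))\<^sup>2) \<le> (\<Sum>k\<in>K. A * (\<Sum>j\<in>J. \<alpha> j * (\<beta> (k - j))\<^sup>2))"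
    by (intro sum_mono)
  also have "\<dots> = A * (\<Sum>j\<in>J. \<alpha> j * (\<Sum>k\<in>K. (\<beta> (k - j))\<^sup>2))"
    unfolding sum_distrib_left[symmetric] by (subst sum.swap) (simp add: sum_distrib_left)
  also have "\<dots> \<le> A * (\<Sum>j\<in>J. \<alpha> j * B)"
    using A fin by (intro mult_left_mono sum_mono \<alpha>(1) sum_le_bounded(1)[of "\<lambda>k. (\<beta> k)\<^sup>2"] \<beta>) auto
  also have "\<dots> = A * (sum \<alpha> J * B)" by (simp add: sum_distrib_right)
  also have "\<dots> \<le> A * (A * B)" by (intro mult_left_mono mult_right_mono \<alpha>(2) fin A B)
  finally show ?thesis by (simp add: power2_eq_square mult_ac)
qed

lemma young_l2_l1:
  fixes \<alpha> \<beta> :: "int \<Rightarrow> real"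
  assumes \<beta>: "\<And>k. 0 \<le> \<beta> k" "\<And>L. finite L \<Longrightarrow> sum \<beta> L \<le> B"
    and \<alpha>: "\<And>L. finite L \<Longrightarrow> (\<Sum>k\<in>L. (\<alpha> k)\<^sup>2) \<le> A" and fin: "finite J" "finite K"
  shows "(\<Sum>k\<in>K. (\<Sum>j\<in>J. \<alpha> j * \<beta> (k - j))\<^sup>2) \<le> A * B\<^sup>2"
proof -
  have A: "0 \<le> A" using \<alpha>[of "{}"] by simp
  have B: "0 \<le> B" using \<beta>(2)[of "{}"] by simp
  have "(\<Sum>j\<in>J. \<alpha> j * \<beta> (k - j))\<^sup>2 \<le> B * (\<Sum>j\<in>J. (\<alpha> j)\<^sup>2 * \<beta> (k - j))" for k
  proof -
    have *: "sqrt x * (y * sqrt x) = y * x" if "0 \<le> x" for x y :: real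
      using that by (simp add: mult.left_commute)
    have "(\<Sum>j\<in>J. \<alpha> j * \<beta> (k - j)) = (\<Sum>j\<in>J. sqrt (\<beta> (k - j)) * (\<alpha> j * sqrt (\<beta> (k - j))))"
      using \<beta>(1) by (simp only: *)
    then have "(\<Sum>j\<in>J. \<alpha> j * \<beta> (k - j))\<^sup>2 \<le> (\<Sum>j\<in>J. \<beta> (k - j)) * (\<Sum>j\<in>J. (\<alpha> j)\<^sup>2 * \<beta> (k - j))"
      using Cauchy_Schwarz_ineq_sum[of "\<lambda>j. sqrt (\<beta> (k - j))" "\<lambda>j. \<alpha> j * sqrt (\<beta> (k - j))" J] \<beta>(1)
      by (simp add: power_mult_distrib)
    also have "\<dots> \<le> B * (\<Sum>j\<in>J. (\<alpha> j)\<^sup>2 * \<beta> (k - j))"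
      by (intro mult_right_mono sum_le_bounded(2)[of \<beta>] \<beta>(2) fin sum_nonneg mult_nonneg_nonneg \<beta>(1)) auto
    finally show ?thesis .
  qed
  then have "(\<Sum>k\<in>K. (\<Sum>j\<in>J. \<alpha> j * \<beta> (k - j))\<^sup>2) \<le> (\<Sum>k\<in>K. B * (\<Sum>j\<in>J. (\<alpha> j)\<^sup>2 * \<beta> (k - j)))"
    by (intro sum_mono)
  also have "\<dots> = B * (\<Sum>j\<in>J. (\<alpha> j)\<^sup>2 * (\<Sum>k\<in>K. \<beta> (k - j)))"
    unfolding sum_distrib_left[symmetric] by (subst sum.swap) (simp add: sum_distrib_left)
  also have "\<dots> \<le> B * (\<Sum>j\<in>J. (\<alpha> j)\<^sup>2 * B)"
    using B fin by (intro mult_left_mono sum_mono sum_le_bounded(1)[of \<beta>] \<beta>(2)) auto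
  also have "\<dots> = B * ((\<Sum>j\<in>J. (\<alpha> j)\<^sup>2) * B)" by (simp add: sum_distrib_right)
  also have "\<dots> \<le> B * (A * B)" by (intro mult_left_mono mult_right_mono \<alpha> fin B)
  finally show ?thesis by (simp add: power2_eq_square mult_ac)
qed

lemma conv_summable:
  assumes a: "hb (\<lambda>_. 1) a A" and b: "hb (\<lambda>_. 1) b B"
  shows "(\<lambda>j. a j * b (k - j)) summable_on UNIV"
proof (rule abs_summable_summable, rule nonneg_bdd_above_summable_on)
  show "bdd_above (sum (\<lambda>j. norm (a j * b (k - j))) ` {F. F \<subseteq> UNIV \<and> finite F})"
  proof (rule bdd_aboveI2)
    fix J :: "int set" assume "J \<in> {F. F \<subseteq> UNIV \<and> finite F}"
    then have J: "finite J" by simp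
    have "(\<Sum>j\<in>J. norm (a j * b (k - j))) \<le> (\<Sum>j\<in>J. (cmod (a j))\<^sup>2 + (cmod (b (k - j)))\<^sup>2)"
    proof (rule sum_mono)
      fix j show "norm (a j * b (k - j)) \<le> (cmod (a j))\<^sup>2 + (cmod (b (k - j)))\<^sup>2"
        using sum_squares_bound[of "cmod (a j)" "cmod (b (k - j))"] mult_nonneg_nonneg[OF norm_ge_zero[of "a j"] norm_ge_zero[of "b (k - j)"]]
        unfolding norm_mult by linarith
    qed
    also have "\<dots> = (\<Sum>j\<in>J. (cmod (a j))\<^sup>2) + (\<Sum>j\<in>J. (cmod (b (k - j)))\<^sup>2)" by (simp add: sum.distrib)
    also have "\<dots> \<le> A + B"
      using hbD[OF a J] hbD[OF b] J by (intro add_mono sum_le_bounded(2)[of "\<lambda>k. (cmod (b k))\<^sup>2"]) auto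
    finally show "(\<Sum>j\<in>J. norm (a j * b (k - j))) \<le> A + B" .
  qed
qed auto

lemma conv_partial_sums:
  assumes a: "hb (\<lambda>_. 1) a A" and b: "hb (\<lambda>_. 1) b B"
  shows "((\<lambda>J. \<Sum>j\<in>J. a j * b (k - j)) \<longlongrightarrow> conv a b k) (finite_subsets_at_top UNIV)"
  using has_sum_infsum[OF conv_summable[OF a b]] unfolding has_sum_def conv_def .

lemma conv_bound:
  assumes a: "hb (\<lambda>_. 1) a A" and b: "hb (\<lambda>_. 1) b B"
  shows "cmod (conv a b k) \<le> sqrt A * sqrt B"
proof (rule tendsto_upperbound[OF tendsto_norm[OF conv_partial_sums[OF a b]] _ finite_subsets_at_top_neq_bot])
  show "\<forall>\<^sub>F J in finite_subsets_at_top UNIV. norm (\<Sum>j\<in>J. a j * b (k - j)) \<le> sqrt A * sqrt B"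
  proof (rule eventually_finite_subsets_at_top_weakI)
    fix J :: "int set" assume J: "finite J"
    have "(norm (\<Sum>j\<in>J. a j * b (k - j)))\<^sup>2 \<le> (\<Sum>j\<in>J. cmod (a j) * cmod (b (k - j)))\<^sup>2"
      by (intro power_mono order_trans[OF norm_sum]) (auto simp: norm_mult)
    also have "\<dots> \<le> (\<Sum>j\<in>J. (cmod (a j))\<^sup>2) * (\<Sum>j\<in>J. (cmod (b (k - j)))\<^sup>2)" by (rule Cauchy_Schwarz_ineq_sum)
    also have "\<dots> \<le> A * B"
      using hbD[OF a J] hbD[OF b] J hb_bound_nonneg[OF a]
      by (intro mult_mono sum_le_bounded(2)[of "\<lambda>k. (cmod (b k))\<^sup>2"] sum_nonneg) auto
    finally show "norm (\<Sum>j\<in>J. a j * b (k - j)) \<le> sqrt A * sqrt B"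
      unfolding real_sqrt_mult[symmetric] by (rule real_le_rsqrt)
  qed
qed

lemma conv_diff_left:
  assumes "hb (\<lambda>_. 1) a A" "hb (\<lambda>_. 1) b B" "hb (\<lambda>_. 1) c C"
  shows "conv (\<lambda>k. a k - b k) c k = conv a c k - conv b c k"
proof -
  have "((\<lambda>j. a j * c (k - j) + - (b j * c (k - j))) has_sum (conv a c k + - conv b c k)) UNIV"
    unfolding conv_def
    by (intro has_sum_add has_sum_uminusI has_sum_infsum conv_summable[OF assms(1,3)] conv_summable[OF assms(2,3)])
  then show ?thesis by (auto simp: conv_def left_diff_distrib intro!: infsumI)
qed

lemma conv_square_diff:
  assumes "hb (\<lambda>_. 1) a A" "hb (\<lambda>_. 1) b B"
  shows "conv a a k - conv b b k = conv (\<lambda>k. a k - b k) a k + conv (\<lambda>k. a k - b k) b k"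
  using conv_diff_left[OF assms assms(1), of k] conv_diff_left[OF assms assms(2), of k] conv_commute[of a b k] by simp

text \<open>Here \<open>4 ^ p\<close> is the square of the factor in
  \<open>sqrt_weight_subadd\<close>, one factor 2 comes from squaring a sum of two terms, and
  another from adding the two Young estimates.\<close>

definition alg_const :: "nat \<Rightarrow> real" where "alg_const p = 4 * 4 ^ p * zsum"

lemma alg_const_nonneg: "0 \<le> alg_const p" by (simp add: alg_const_def zsum_nonneg)

text \<open>One of \<open>j\<close> and \<open>k - j\<close> has at least half the size of
  \<open>k\<close>, and \<open>weight_double\<close> applies to it.\<close>

lemma sqrt_weight_subadd:
  assumes W: "weight p W"
  shows "sqrt (W k) \<le> 2 ^ p * (sqrt (W j) + sqrt (W (k - j)))"
proof -
  have *: "sqrt (W k) \<le> 2 ^ p * sqrt (W i)" if "\<bar>k\<bar> \<le> 2 * \<bar>i\<bar>" for i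
  proof (rule real_le_lsqrt)
    show "0 \<le> 2 ^ p * sqrt (W i)" using weight_nonneg[OF W, of i] by simp
    have "W k \<le> 1 * (2 ^ p * W i)" using weight_double[OF W that] by simp
    also have "\<dots> \<le> 2 ^ p * (2 ^ p * W i)" using weight_nonneg[OF W, of i] by (intro mult_right_mono) auto
    finally show "W k \<le> (2 ^ p * sqrt (W i))\<^sup>2" using weight_nonneg[OF W, of i] by (simp add: power_mult_distrib power2_eq_square[of "2 ^ p"])
  qed
  have "\<bar>k\<bar> \<le> 2 * \<bar>j\<bar> \<or> \<bar>k\<bar> \<le> 2 * \<bar>k - j\<bar>" by (rule disjCI) (use abs_triangle_ineq[of j "k - j"] in simp)
  then show ?thesis
  proof
    assume "\<bar>k\<bar> \<le> 2 * \<bar>j\<bar>" from *[OF this] weight_nonneg[OF W, of "k - j"] show ?thesis by (simp add: distrib_left add_increasing2)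
  next
    assume "\<bar>k\<bar> \<le> 2 * \<bar>k - j\<bar>" from *[OF this] weight_nonneg[OF W, of j] show ?thesis by (simp add: distrib_left add_increasing)
  qed
qed

text \<open>The weight can be put on either factor by \<open>sqrt_weight_subadd\<close>; the other
  factor is then absolutely summable, with a bound from \<open>l1_bound\<close>, and Young's
  inequality applies. The estimate is proved for partial sums in \<open>J\<close>, uniformly, and
  passes to the limit.\<close>

lemma hb_conv:
  assumes W: "weight p W" "\<And>k. (real_of_int k)\<^sup>2 \<le> W k"
    and a: "hb W a A" "a 0 = 0" and b: "hb W b B" "b 0 = 0"
  shows "hb W (conv a b) (alg_const p * (A * B))"
proof (rule hb_tendsto[of "\<lambda>J k. \<Sum>j\<in>J. a j * b (k - j)" _ "finite_subsets_at_top UNIV"])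
  have sq: "hb (\<lambda>k. (real_of_int k)\<^sup>2) a A" "hb (\<lambda>k. (real_of_int k)\<^sup>2) b B"
    using a b W by (auto intro: hb_weight_mono)
  have le1: "1 * (cmod (c k))\<^sup>2 \<le> (real_of_int k)\<^sup>2 * (cmod (c k))\<^sup>2" if "c 0 = 0" for c k
  proof (cases "k = 0")
    case False
    then have "1 \<le> \<bar>real_of_int k\<bar>" by linarith
    then have "1\<^sup>2 \<le> (real_of_int k)\<^sup>2" by (subst power2_abs[symmetric], intro power_mono) auto
    then show ?thesis by (intro mult_right_mono) auto
  qed (use that in auto)
  have one: "hb (\<lambda>_. 1) a A" "hb (\<lambda>_. 1) b B"
    by (rule hb_mono[OF sq(1)], rule le1, rule a(2)) (rule hb_mono[OF sq(2)], rule le1, rule b(2))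
  show "((\<lambda>J. \<Sum>j\<in>J. a j * b (k - j)) \<longlongrightarrow> conv a b k) (finite_subsets_at_top UNIV)" for k
    by (rule conv_partial_sums[OF one])
  show "\<forall>\<^sub>F J in finite_subsets_at_top UNIV. hb W (\<lambda>k. \<Sum>j\<in>J. a j * b (k - j)) (alg_const p * (A * B))"
  proof (rule eventually_finite_subsets_at_top_weakI)
    fix J :: "int set" assume J: "finite J"
    show "hb W (\<lambda>k. \<Sum>j\<in>J. a j * b (k - j)) (alg_const p * (A * B))"
      unfolding hb_def
    proof safe
      fix K :: "int set" assume K: "finite K"
      let ?a = "\<lambda>k. cmod (a k)" and ?b = "\<lambda>k. cmod (b k)"
      let ?wa = "\<lambda>k. sqrt (W k) * cmod (a k)" and ?wb = "\<lambda>k. sqrt (W k) * cmod (b k)"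
      define X where "X k = (\<Sum>j\<in>J. ?wa j * ?b (k - j))" for k
      define Y where "Y k = (\<Sum>j\<in>J. ?a j * ?wb (k - j))" for k
      have pt: "W k * (cmod (\<Sum>j\<in>J. a j * b (k - j)))\<^sup>2 \<le> 2 * 4 ^ p * ((X k)\<^sup>2 + (Y k)\<^sup>2)" for k
      proof -
        have "sqrt (W k) * cmod (\<Sum>j\<in>J. a j * b (k - j)) \<le> sqrt (W k) * (\<Sum>j\<in>J. ?a j * ?b (k - j))"
          using weight_nonneg[OF W(1)] by (intro mult_left_mono order_trans[OF norm_sum]) (auto simp: norm_mult)
        also have "\<dots> = (\<Sum>j\<in>J. sqrt (W k) * (?a j * ?b (k - j)))" by (simp add: sum_distrib_left)
        also have "\<dots> \<le> (\<Sum>j\<in>J. (2 ^ p * (sqrt (W j) + sqrt (W (k - j)))) * (?a j * ?b (k - j)))"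
          by (intro sum_mono mult_right_mono sqrt_weight_subadd[OF W(1)]) auto
        also have "\<dots> = 2 ^ p * (X k + Y k)"
          by (simp add: X_def Y_def sum_distrib_left sum.distrib[symmetric] algebra_simps)
        finally have "(sqrt (W k) * cmod (\<Sum>j\<in>J. a j * b (k - j)))\<^sup>2 \<le> (2 ^ p * (X k + Y k))\<^sup>2"
          using weight_nonneg[OF W(1)] by (intro power_mono) auto
        also have "\<dots> = 4 ^ p * (X k + Y k)\<^sup>2" 
          using power_mult_distrib[of "2::real" 2 p] by (simp add: power_mult_distrib power2_eq_square[of "2 ^ p"])
        also have "\<dots> \<le> 4 ^ p * (2 * ((X k)\<^sup>2 + (Y k)\<^sup>2))"
          using sum_squares_bound[of "X k" "Y k"] by (intro mult_left_mono) (auto simp: power2_sum)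
        finally show ?thesis using weight_nonneg[OF W(1)] by (simp add: power_mult_distrib algebra_simps)
      qed
      have nA: "0 \<le> zsum * A" "0 \<le> zsum * B" using hb_bound_nonneg[OF a(1)] hb_bound_nonneg[OF b(1)] zsum_nonneg by auto
      have "(\<Sum>k\<in>K. (X k)\<^sup>2) \<le> A * (sqrt (zsum * B))\<^sup>2"
        unfolding X_def using J K hbD[OF a(1)] weight_nonneg[OF W(1)]
        by (intro young_l2_l1 l1_bound[OF sq(2) b(2)]) (auto simp: power_mult_distrib)
      moreover have "(\<Sum>k\<in>K. (Y k)\<^sup>2) \<le> (sqrt (zsum * A))\<^sup>2 * B"
        unfolding Y_def using J K hbD[OF b(1)] weight_nonneg[OF W(1)]
        by (intro young_l1_l2 l1_bound[OF sq(1) a(2)]) (auto simp: power_mult_distrib)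
      ultimately have XY: "(\<Sum>k\<in>K. (X k)\<^sup>2) + (\<Sum>k\<in>K. (Y k)\<^sup>2) \<le> 2 * zsum * (A * B)" using nA by (simp add: algebra_simps)
      have "(\<Sum>k\<in>K. W k * (cmod (\<Sum>j\<in>J. a j * b (k - j)))\<^sup>2) \<le> (\<Sum>k\<in>K. 2 * 4 ^ p * ((X k)\<^sup>2 + (Y k)\<^sup>2))"
        by (intro sum_mono pt)
      also have "\<dots> = 2 * 4 ^ p * ((\<Sum>k\<in>K. (X k)\<^sup>2) + (\<Sum>k\<in>K. (Y k)\<^sup>2))"
        by (simp only: sum_distrib_left[symmetric] sum.distrib)
      also have "\<dots> \<le> 2 * 4 ^ p * (2 * zsum * (A * B))" by (intro mult_left_mono XY) auto
      finally show "(\<Sum>k\<in>K. W k * (cmod (\<Sum>j\<in>J. a j * b (k - j)))\<^sup>2) \<le> alg_const p * (A * B)"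
        by (simp add: alg_const_def)
    qed
  qed
qed simp

subsection \<open>Global Galerkin solutions\<close>

text \<open>Gains the factor \<open>1 / \<mu>\<close> in the exponentially weighted supremum norm,
  which makes the Picard operator below a contraction on the whole half-line.\<close>

lemma exp_weighted_integral_bound:
  fixes g :: "real \<Rightarrow> 'a::banach"
  assumes g: "continuous_on {0..s} g" and "\<And>\<sigma>. 0 \<le> \<sigma> \<Longrightarrow> norm (g \<sigma>) \<le> C * exp (\<mu> * \<sigma>)" and s: "0 \<le> s" and l: "0 < \<mu>"
  shows "exp (- \<mu> * s) * norm (integral {0..s} g) \<le> C / \<mu>"
proof -
  have C: "0 \<le> C" using order_trans[OF norm_ge_zero assms(2)[of 0]] by simp
  have I: "((\<lambda>\<sigma>. C * exp (\<mu> * \<sigma>)) has_integral (C / \<mu> * exp (\<mu> * s) - C / \<mu> * exp (\<mu> * 0))) {0..s}"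
    using s l by (intro fundamental_theorem_of_calculus) (auto intro!: derivative_eq_intros simp: has_real_derivative_iff_has_vector_derivative[symmetric])
  have "norm (integral {0..s} g) \<le> integral {0..s} (\<lambda>\<sigma>. C * exp (\<mu> * \<sigma>))"
    using assms I by (intro Henstock_Kurzweil_Integration.integral_norm_bound_integral integrable_continuous_real) (auto simp: has_integral_integrable intro!: continuous_intros)
  also have "\<dots> = C / \<mu> * exp (\<mu> * s) - C / \<mu>" using integral_unique[OF I] by simp
  also have "\<dots> \<le> C / \<mu> * exp (\<mu> * s)" using C l by simp
  finally have "exp (- \<mu> * s) * norm (integral {0..s} g) \<le> exp (- \<mu> * s) * (C / \<mu> * exp (\<mu> * s))"
    by (intro mult_left_mono) auto
  also have "\<dots> = C / \<mu> * (exp (- \<mu> * s) * exp (\<mu> * s))" by simp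
  also have "exp (- \<mu> * s) * exp (\<mu> * s) = 1" by (simp flip: exp_add)
  finally show ?thesis by simp
qed

lemma integral_has_vector_derivative_halfline:
  fixes g :: "real \<Rightarrow> 'a::banach"
  assumes "continuous_on {0..} g" "0 \<le> t"
  shows "((\<lambda>u. integral {0..u} g) has_vector_derivative g t) (at t within {0..})"
proof -
  have "((\<lambda>u. integral {0..u} g) has_vector_derivative g t) (at t within {0..t + 1})"
    using assms by (intro integral_has_vector_derivative) (auto intro: continuous_on_subset)
  moreover have "at t within {0..t + 1} = at t within {0..}"
    by (rule at_within_nhd[of _ "{..<t + 1}"]) auto
  ultimately show ?thesis by simp
qed

text \<open>The unknown of the fixed point problem is \<open>exp (- \<mu> * t)\<close> times the
  solution, so that exponentially growing solutions become bounded functions. With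
  \<open>\<mu> = 2 * L + 1\<close> the contraction factor \<open>L / \<mu>\<close> is below 1 for
  every \<open>L\<close>, and a global solution is obtained without continuation.\<close>

lemma picard_global:
  fixes f :: "'a::banach \<Rightarrow> 'a"
  assumes L: "0 \<le> L" and lip: "\<And>x y. norm (f x - f y) \<le> L * norm (x - y)"
  shows "\<exists>x. x 0 = x0 \<and> (\<forall>t\<ge>0. (x has_vector_derivative f (x t)) (at t within {0..}))"
proof -
  define \<mu> where "\<mu> = 2 * L + 1"
  have l: "\<mu> > 0" using L by (simp add: \<mu>_def)
  have fc: "continuous_on UNIV f"
    using L lip by (intro lipschitz_on_continuous_on[of L] lipschitz_onI) (auto simp: dist_norm)
  define g where "g b \<sigma> = f (exp (\<mu> * \<sigma>) *\<^sub>R apply_bcontfun b \<sigma>)" for b :: "real \<Rightarrow>\<^sub>C 'a" and \<sigma>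
  have gc: "continuous_on S (g b)" for b S
    unfolding g_def by (intro continuous_on_compose2[OF fc] continuous_intros) auto
  \<comment> \<open>The Picard operator in weighted form. Bounded continuous functions live on the
    whole line here, and \<open>max 0 t\<close> extends the result constantly to negative
    times.\<close>
  define \<Phi> where "\<Phi> b t = exp (- \<mu> * max 0 t) *\<^sub>R (x0 + integral {0..max 0 t} (g b))" for b t
  have gb: "norm (g b \<sigma>) \<le> (norm (f 0) + L * norm b) * exp (\<mu> * \<sigma>)" if "0 \<le> \<sigma>" for b \<sigma>
  proof -
    have "norm (g b \<sigma>) \<le> norm (f 0) + norm (g b \<sigma> - f 0)"
      by (metis add.commute diff_add_cancel norm_triangle_ineq)
    also have "norm (g b \<sigma> - f 0) \<le> L * norm (exp (\<mu> * \<sigma>) *\<^sub>R apply_bcontfun b \<sigma>)"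
      using lip[of "exp (\<mu> * \<sigma>) *\<^sub>R apply_bcontfun b \<sigma>" 0] by (simp add: g_def)
    also have "\<dots> \<le> L * (exp (\<mu> * \<sigma>) * norm b)" using L by (intro mult_left_mono) (auto intro: norm_bounded)
    also have "norm (f 0) \<le> norm (f 0) * exp (\<mu> * \<sigma>)" using that l by (simp add: mult_le_cancel_left1)
    finally show ?thesis by (simp add: algebra_simps)
  qed
  have \<Phi>b: "\<Phi> b \<in> bcontfun" for b
  proof -
    have "continuous_on {0..} (\<lambda>u. integral {0..u} (g b))"
      by (rule continuous_on_vector_derivative) (auto intro!: integral_has_vector_derivative_halfline gc)
    then have "continuous_on UNIV (\<lambda>t. integral {0..max 0 t} (g b))"
      by (rule continuous_on_compose2) (auto intro!: continuous_intros)
    then have c: "continuous_on UNIV (\<Phi> b)" unfolding \<Phi>_def by (intro continuous_intros)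
    have "norm (\<Phi> b t) \<le> norm x0 + (norm (f 0) + L * norm b) / \<mu>" for t
    proof -
      have "norm (\<Phi> b t) \<le> exp (- \<mu> * max 0 t) * (norm x0 + norm (integral {0..max 0 t} (g b)))"
        by (simp add: \<Phi>_def norm_triangle_ineq)
      also have "\<dots> = exp (- \<mu> * max 0 t) * norm x0 + exp (- \<mu> * max 0 t) * norm (integral {0..max 0 t} (g b))"
        by (simp add: algebra_simps)
      also have "exp (- \<mu> * max 0 t) * norm x0 \<le> 1 * norm x0" using l by (intro mult_right_mono) auto
      also have "exp (- \<mu> * max 0 t) * norm (integral {0..max 0 t} (g b)) \<le> (norm (f 0) + L * norm b) / \<mu>"
        by (rule exp_weighted_integral_bound) (auto intro: gc gb l)
      finally show ?thesis by simp
    qed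
    then show ?thesis using c by (auto simp: bcontfun_def intro!: boundedI)
  qed
  have app: "apply_bcontfun (Bcontfun (\<Phi> b)) = \<Phi> b" for b by (rule Bcontfun_inverse[OF \<Phi>b])
  have "\<exists>!b. Bcontfun (\<Phi> b) = b"
  proof (rule banach_fix_type)
    show "0 \<le> L / \<mu>" "L / \<mu> < 1" using L by (auto simp: \<mu>_def)
    show "\<forall>b c. dist (Bcontfun (\<Phi> b)) (Bcontfun (\<Phi> c)) \<le> L / \<mu> * dist b c"
    proof (intro allI dist_bound)
      fix b c t
      have "dist (Bcontfun (\<Phi> b) t) (Bcontfun (\<Phi> c) t) = exp (- \<mu> * max 0 t) * norm (integral {0..max 0 t} (\<lambda>\<sigma>. g b \<sigma> - g c \<sigma>))"
        unfolding app \<Phi>_def dist_norm scaleR_diff_right[symmetric] add_diff_add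
        by (subst integral_diff) (auto intro!: integrable_continuous_real gc)
      also have "\<dots> \<le> (L * dist b c) / \<mu>"
      proof (rule exp_weighted_integral_bound)
        show "continuous_on {0..max 0 t} (\<lambda>\<sigma>. g b \<sigma> - g c \<sigma>)" by (intro continuous_intros gc)
        fix \<sigma> :: real
        have "norm (g b \<sigma> - g c \<sigma>) \<le> L * norm (exp (\<mu> * \<sigma>) *\<^sub>R (apply_bcontfun b \<sigma> - apply_bcontfun c \<sigma>))"
          unfolding g_def scaleR_diff_right by (rule lip)
        also have "\<dots> \<le> L * (exp (\<mu> * \<sigma>) * dist b c)"
          using dist_bounded[of b \<sigma> c] L by (intro mult_left_mono) (auto simp: dist_norm intro!: mult_left_mono)
        finally show "norm (g b \<sigma> - g c \<sigma>) \<le> L * dist b c * exp (\<mu> * \<sigma>)" by (simp add: mult_ac)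
      qed (use l in auto)
      finally show "dist (Bcontfun (\<Phi> b) t) (Bcontfun (\<Phi> c) t) \<le> L / \<mu> * dist b c" by simp
    qed
  qed
  then obtain b where b: "Bcontfun (\<Phi> b) = b" by blast
  define x where "x t = x0 + integral {0..t} (g b)" for t
  have gx: "g b t = f (x t)" if "0 \<le> t" for t
  proof -
    have "apply_bcontfun b t = \<Phi> b t" using b app by metis
    then show ?thesis unfolding g_def using that by (simp add: \<Phi>_def x_def flip: exp_add)
  qed
  have "x 0 = x0" by (simp add: x_def)
  moreover have "(x has_vector_derivative f (x t)) (at t within {0..})" if "0 \<le> t" for t
    unfolding gx[OF that, symmetric] unfolding x_def
    using integral_has_vector_derivative_halfline[OF gc that] by (auto intro!: derivative_eq_intros)
  ultimately show ?thesis by blast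
qed

lemma has_real_derivative_cmod_square:
  assumes "(x has_vector_derivative x') (at t within S)"
  shows "((\<lambda>t. (cmod (x t))\<^sup>2) has_real_derivative 2 * Re (cnj (x t) * x')) (at t within S)"
proof -
  have D: "((\<lambda>t. Re (x t)) has_real_derivative Re x') (at t within S)" "((\<lambda>t. Im (x t)) has_real_derivative Im x') (at t within S)"
    using bounded_linear.has_vector_derivative[OF bounded_linear_Re assms] bounded_linear.has_vector_derivative[OF bounded_linear_Im assms]
    by (simp_all add: has_real_derivative_iff_has_vector_derivative)
  show ?thesis
    using DERIV_add[OF DERIV_power[OF D(1), of 2] DERIV_power[OF D(2), of 2]] by (simp add: cmod_power2 algebra_simps)
qed

section \<open>The Galerkin vector field and its cut-off\<close>

lemma ost_zero: "ost \<gamma> (\<lambda>_. 0) k = 0"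
  by (simp add: ost_def conv_def)

lemma herm_conv:
  assumes "herm a"
  shows "conv a a (- k) = cnj (conv a a k)"
proof -
  have "cnj (a (- j)) = a j" "cnj (a (k + j)) = a (- k - j)" for j
    using assms unfolding herm_def by (metis complex_cnj_cnj, metis minus_add_distrib diff_conv_add_uminus)
  then show ?thesis
    unfolding conv_def infsum_cnj[symmetric]
    by (intro infsum_reindex_bij_witness[of _ uminus uminus]) auto
qed

lemma herm_ost: "herm a \<Longrightarrow> ost \<gamma> a (- k) = cnj (ost \<gamma> a k)"
  unfolding ost_def herm_conv by (simp add: herm_def)

text \<open>The radial cut-off makes the quadratic vector field globally Lipschitz. As it multiplies the state by
  a scalar, the conservation law persists for the modified system and shows that the cut-off is never active.\<close>

definition radial :: "real \<Rightarrow> 'a::real_normed_vector \<Rightarrow> 'a" where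
  "radial R x = (R / max R (norm x)) *\<^sub>R x"

lemma norm_radial: "0 < R \<Longrightarrow> norm (radial R x) \<le> R"
  by (simp add: radial_def field_simps mult_left_mono)

text \<open>One unit of the constant comes from moving the argument, the other from the change of
  the scaling factor.\<close>

lemma radial_lipschitz:
  assumes R: "0 < R"
  shows "norm (radial R x - radial R y) \<le> 2 * norm (x - y)"
proof -
  define M where "M z = max R (norm z)" for z :: 'a
  have M: "0 < M z" "R \<le> M z" "norm z \<le> M z" for z using R by (auto simp: M_def)
  have "radial R x - radial R y = (R / M x) *\<^sub>R (x - y) + (R / M x - R / M y) *\<^sub>R y"
    by (simp add: radial_def M_def algebra_simps)
  then have "norm (radial R x - radial R y) \<le> R / M x * norm (x - y) + \<bar>R / M x - R / M y\<bar> * norm y"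
    using norm_triangle_ineq[of "(R / M x) *\<^sub>R (x - y)" "(R / M x - R / M y) *\<^sub>R y"] R M(1)[of x] by simp
  also have "R / M x * norm (x - y) \<le> 1 * norm (x - y)" using R M[of x] by (intro mult_right_mono) auto
  also have "\<bar>R / M x - R / M y\<bar> * norm y \<le> \<bar>M y - M x\<bar>"
  proof -
    have "R / M x - R / M y = R / M x * (M y - M x) / M y" using M(1)[of x] M(1)[of y] by (simp add: field_simps)
    then have "\<bar>R / M x - R / M y\<bar> * norm y = (R / M x) * (\<bar>M y - M x\<bar> * (norm y / M y))"
      using M(1)[of x] M(1)[of y] R by (simp add: abs_mult)
    also have "\<dots> \<le> 1 * (\<bar>M y - M x\<bar> * 1)"
      using M[of x] M[of y] R by (intro mult_mono mult_left_mono) auto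
    finally show ?thesis by simp
  qed
  also have "\<bar>M y - M x\<bar> \<le> norm (x - y)"
    using norm_triangle_ineq3[of x y] by (auto simp: M_def)
  finally show ?thesis by simp
qed

lemma abs_divide_freq_le:
  fixes k :: int
  shows "\<bar>\<gamma> / (2 * pi * k)\<bar> \<le> \<bar>\<gamma>\<bar>"
proof (cases "k = 0")
  case False
  then have "1 \<le> \<bar>real_of_int k\<bar>" by linarith
  moreover have "1 \<le> 2 * pi" using pi_gt3 by simp
  ultimately have "1 * 1 \<le> 2 * pi * \<bar>real_of_int k\<bar>" by (intro mult_mono) auto
  then have "\<bar>\<gamma>\<bar> / (2 * pi * \<bar>real_of_int k\<bar>) \<le> \<bar>\<gamma>\<bar> / 1" by (intro divide_left_mono) auto
  then show ?thesis by (simp add: abs_mult)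
qed simp

text \<open>The constant grows with \<open>n\<close>; it only serves to solve the finite system,
  while bounds uniform in \<open>n\<close> come from the energy estimates.\<close>

lemma ost_lipschitz:
  fixes R D \<gamma> :: real
  assumes a: "supp n a" "\<And>k. cmod (a k) \<le> R" and b: "supp n b" "\<And>k. cmod (b k) \<le> R"
    and D: "\<And>k. cmod (a k - b k) \<le> D" and k: "k \<in> band n"
  shows "cmod (ost \<gamma> a k - ost \<gamma> b k) \<le> (pi * n * (card (band n) * (2 * R)) + \<bar>\<gamma>\<bar>) * D"
proof -
  have R: "0 \<le> R" using order_trans[OF norm_ge_zero a(2)[of 0]] .
  have D0: "0 \<le> D" using order_trans[OF norm_ge_zero D[of 0]] .
  have "cmod (conv a a k - conv b b k) = cmod (\<Sum>j\<in>band n. a j * a (k - j) - b j * b (k - j))"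
    by (simp add: conv_finite[OF a(1)] conv_finite[OF b(1)] sum_subtractf)
  also have "\<dots> \<le> (\<Sum>j\<in>band n. 2 * R * D)"
  proof (rule order_trans[OF norm_sum sum_mono])
    fix j
    have "a j * a (k - j) - b j * b (k - j) = a j * (a (k - j) - b (k - j)) + (a j - b j) * b (k - j)"
      by (simp add: algebra_simps)
    then have "cmod (a j * a (k - j) - b j * b (k - j)) \<le> cmod (a j) * cmod (a (k - j) - b (k - j)) + cmod (a j - b j) * cmod (b (k - j))"
      by (metis norm_mult norm_triangle_ineq)
    also have "\<dots> \<le> R * D + D * R" using R D0 by (intro add_mono mult_mono a b D) auto
    finally show "cmod (a j * a (k - j) - b j * b (k - j)) \<le> 2 * R * D" by (simp add: mult_ac)
  qed
  finally have c: "cmod (conv a a k - conv b b k) \<le> card (band n) * (2 * R) * D" by simp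
  have kn: "\<bar>real_of_int k\<bar> \<le> n" using k by (auto simp: band_def)
  note g = abs_divide_freq_le[of \<gamma> k]
  have "ost \<gamma> a k - ost \<gamma> b k = - (\<i> * of_real (pi * k)) * (conv a a k - conv b b k) - \<i> * of_real (\<gamma> / (2 * pi * k)) * (a k - b k)"
    unfolding ost_def by algebra
  also have "cmod \<dots> \<le> pi * \<bar>real_of_int k\<bar> * cmod (conv a a k - conv b b k) + \<bar>\<gamma> / (2 * pi * k)\<bar> * cmod (a k - b k)"
    by (rule order_trans[OF norm_triangle_ineq4]) (simp only: norm_mult norm_minus_cancel norm_of_real norm_ii abs_mult, simp)
  also have "\<dots> \<le> pi * n * (card (band n) * (2 * R) * D) + \<bar>\<gamma>\<bar> * D"
    using kn by (intro add_mono mult_mono c g D) (auto simp: D0)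
  finally show ?thesis by (simp add: algebra_simps)
qed

text \<open>The finite-dimensional state space is embedded in the bounded functions on the discrete
  space of integers, which gives one Banach space for all \<open>n\<close>.\<close>

lemma finite_support_bcontfun:
  fixes g :: "int \<Rightarrow> complex"
  assumes "\<And>k. k \<notin> band n \<Longrightarrow> g k = 0"
  shows "g \<in> bcontfun"
proof -
  have "range g \<subseteq> insert 0 (g ` band n)" using assms by blast
  then have "finite (range g)" by (rule finite_subset) auto
  then show ?thesis by (auto simp: bcontfun_def finite_imp_bounded continuous_on_discrete)
qed

text \<open>Completeness of \<open>\<Rightarrow>\<^sub>C\<close> is only available over metric spaces.\<close>

instantiation int :: metric_space
begin

definition dist_int :: "int \<Rightarrow> int \<Rightarrow> real" where
  "dist_int m n = real_of_int \<bar>m - n\<bar>"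

definition uniformity_int :: "(int \<times> int) filter" where
  "uniformity_int = (INF e\<in>{0<..}. principal {(x, y). dist x y < e})"

instance
proof
  fix U :: "int set"
  have "\<forall>\<^sub>F (x', y) in uniformity. x' = x \<longrightarrow> y \<in> U" if "x \<in> U" for x
    unfolding uniformity_int_def
  proof (rule eventually_INF1[of 1])
    have "x = y" if "\<bar>real_of_int x - real_of_int y\<bar> < 1" for y using that by linarith
    then show "\<forall>\<^sub>F (x', y) in principal {(x, y). dist x y < 1}. x' = x \<longrightarrow> y \<in> U"
      using that by (auto simp: eventually_principal dist_int_def)
  qed simp
  then show "open U \<longleftrightarrow> (\<forall>x\<in>U. \<forall>\<^sub>F (x', y) in uniformity. x' = x \<longrightarrow> y \<in> U)"
    by (simp add: open_discrete)
qed (auto simp: dist_int_def uniformity_int_def)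

end

instance bcontfun :: (metric_space, banach) banach ..

lemma bounded_linear_component: "bounded_linear (\<lambda>x :: int \<Rightarrow>\<^sub>C complex. apply_bcontfun x k)"
  by (rule bounded_linear_intro[of _ 1]) (auto intro: norm_bounded)

text \<open>Besides cutting off, the state is symmetrised with its reflected conjugate. The field is
  therefore Hermitian whatever the state is, and the symmetry of the solution can be derived
  afterwards from the equation.\<close>

lemma galerkin_truncated_exists:
  fixes n :: nat and R \<gamma> :: real and v0 :: "int \<Rightarrow> complex"
  assumes R: "0 < R"
  defines "cutoff \<equiv> \<lambda>x :: int \<Rightarrow>\<^sub>C complex. trunc n (\<lambda>k. (apply_bcontfun (radial R x) k + cnj (apply_bcontfun (radial R x) (- k))) / 2)"
  shows "\<exists>x. apply_bcontfun (x 0) = trunc n v0 \<and>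
    (\<forall>t\<ge>0. \<forall>k. ((\<lambda>t. apply_bcontfun (x t) k) has_vector_derivative (if k \<in> band n then ost \<gamma> (cutoff (x t)) k else 0)) (at t within {0..}))"
proof -
  define G where "G x = (\<lambda>k. if k \<in> band n then ost \<gamma> (cutoff x) k else 0)" for x
  have Gb: "G x \<in> bcontfun" for x by (rule finite_support_bcontfun[of n]) (simp add: G_def)
  have app: "apply_bcontfun (Bcontfun (G x)) = G x" for x by (rule Bcontfun_inverse[OF Gb])
  define L where "L = (pi * n * (card (band n) * (2 * R)) + \<bar>\<gamma>\<bar>) * 2"
  have L: "0 \<le> L" using R by (simp add: L_def)
  have cutb: "cmod (cutoff x k) \<le> R" for x k
  proof -
    have "cmod (apply_bcontfun (radial R x) k + cnj (apply_bcontfun (radial R x) (- k))) \<le> cmod (apply_bcontfun (radial R x) k) + cmod (apply_bcontfun (radial R x) (- k))"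
      using norm_triangle_ineq[of "apply_bcontfun (radial R x) k" "cnj (apply_bcontfun (radial R x) (- k))"] by simp
    also have "\<dots> \<le> R + R"
      by (intro add_mono order_trans[OF norm_bounded norm_radial[OF R]])
    finally show ?thesis using R by (simp add: cutoff_def trunc_def norm_divide)
  qed
  have cutl: "cmod (cutoff x k - cutoff y k) \<le> 2 * norm (x - y)" for x y k
  proof -
    have le: "cmod (apply_bcontfun (radial R x) i - apply_bcontfun (radial R y) i) \<le> 2 * norm (x - y)" for i
      using order_trans[OF norm_bounded[of "radial R x - radial R y" i] radial_lipschitz[OF R]] by simp
    define P where "P = (apply_bcontfun (radial R x) k - apply_bcontfun (radial R y) k) + cnj (apply_bcontfun (radial R x) (- k) - apply_bcontfun (radial R y) (- k))"
    have "cmod P \<le> cmod (apply_bcontfun (radial R x) k - apply_bcontfun (radial R y) k) + cmod (apply_bcontfun (radial R x) (- k) - apply_bcontfun (radial R y) (- k))"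
      using norm_triangle_ineq[of "apply_bcontfun (radial R x) k - apply_bcontfun (radial R y) k" "cnj (apply_bcontfun (radial R x) (- k) - apply_bcontfun (radial R y) (- k))"]
      unfolding P_def by (simp only: complex_mod_cnj)
    also have "\<dots> \<le> 2 * norm (x - y) + 2 * norm (x - y)" by (intro add_mono le)
    finally have P: "cmod P / 2 \<le> 2 * norm (x - y)" by simp
    have "cutoff x k - cutoff y k = (if k \<in> band n then P / 2 else 0)"
      by (simp add: cutoff_def trunc_def P_def diff_divide_distrib add_divide_distrib)
    then show ?thesis using P by (simp add: norm_divide)
  qed
  have "norm (Bcontfun (G x) - Bcontfun (G y)) \<le> L * norm (x - y)" for x y
  proof (rule norm_bound)
    fix k
    have "norm (G x k - G y k) \<le> L * norm (x - y)"
    proof (cases "k \<in> band n")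
      case True
      have "cmod (ost \<gamma> (cutoff x) k - ost \<gamma> (cutoff y) k) \<le> (pi * n * (card (band n) * (2 * R)) + \<bar>\<gamma>\<bar>) * (2 * norm (x - y))"
        by (rule ost_lipschitz[OF _ cutb _ cutb cutl True]) (simp_all add: cutoff_def)
      then show ?thesis using True by (simp add: G_def L_def algebra_simps)
    qed (use L in \<open>simp add: G_def\<close>)
    then show "norm (apply_bcontfun (Bcontfun (G x) - Bcontfun (G y)) k) \<le> L * norm (x - y)" by (simp add: app)
  qed
  from picard_global[where f = "\<lambda>x. Bcontfun (G x)" and ?x0.0 = "Bcontfun (trunc n v0)", OF L this]
  obtain x where x: "x 0 = Bcontfun (trunc n v0)" "\<And>t. t \<ge> 0 \<Longrightarrow> (x has_vector_derivative Bcontfun (G (x t))) (at t within {0..})"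
    by blast
  have "apply_bcontfun (x 0) = trunc n v0"
    unfolding x(1) by (rule Bcontfun_inverse, rule finite_support_bcontfun[of n]) (simp add: trunc_def)
  moreover have "((\<lambda>t. apply_bcontfun (x t) k) has_vector_derivative (if k \<in> band n then ost \<gamma> (cutoff (x t)) k else 0)) (at t within {0..})" if "0 \<le> t" for t k
    using bounded_linear.has_vector_derivative[OF bounded_linear_component x(2)[OF that], of k] unfolding app by (simp add: G_def)
  ultimately show ?thesis by blast
qed

lemma constant_halfline:
  fixes f :: "real \<Rightarrow> 'a::banach"
  assumes "\<And>t. 0 \<le> t \<Longrightarrow> (f has_vector_derivative 0) (at t within {0..})" "0 \<le> t"
  shows "f t = f 0"
proof -
  obtain c where "\<And>x. x \<in> {0..} \<Longrightarrow> f x = c"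
    using has_vector_derivative_zero_constant[of "{0::real..}" f] assms(1) by auto
  then show ?thesis using assms(2) by simp
qed

lemma galerkin_exists:
  assumes v0: "herm v0" "v0 0 = 0"
  shows "\<exists>x. x 0 = trunc n v0 \<and> (\<forall>t\<ge>0. supp n (x t) \<and> herm (x t) \<and> x t 0 = 0 \<and>
    (\<forall>k. ((\<lambda>t. x t k) has_vector_derivative (if k \<in> band n then ost \<gamma> (x t) k else 0)) (at t within {0..})))"
proof -
  define E where "E = en (\<lambda>_. 1) n v0"
  have E: "0 \<le> E" by (simp add: E_def en_def sum_nonneg)
  \<comment> \<open>The conserved quantity \<open>E\<close> bounds every coefficient by
    \<open>sqrt E\<close>, so the solution stays inside radius \<open>R\<close>; the added 1 keeps
    \<open>R\<close> positive.\<close>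
  define R where "R = sqrt E + 1"
  have R: "0 < R" using E by (simp add: R_def add_nonneg_pos)
  define cutoff where "cutoff = (\<lambda>x :: int \<Rightarrow>\<^sub>C complex. trunc n (\<lambda>k. (apply_bcontfun (radial R x) k + cnj (apply_bcontfun (radial R x) (- k))) / 2))"
  have "\<exists>y. apply_bcontfun (y 0) = trunc n v0 \<and>
    (\<forall>t\<ge>0. \<forall>k. ((\<lambda>t. apply_bcontfun (y t) k) has_vector_derivative (if k \<in> band n then ost \<gamma> (cutoff (y t)) k else 0)) (at t within {0..}))"
    unfolding cutoff_def by (rule galerkin_truncated_exists[OF R])
  then obtain y where y0: "apply_bcontfun (y 0) = trunc n v0"
    and y: "\<And>t k. 0 \<le> t \<Longrightarrow> ((\<lambda>t. apply_bcontfun (y t) k) has_vector_derivative (if k \<in> band n then ost \<gamma> (cutoff (y t)) k else 0)) (at t within {0..})"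
    by (elim exE conjE) simp
  define x where "x t = apply_bcontfun (y t)" for t
  have x: "((\<lambda>t. x t k) has_vector_derivative (if k \<in> band n then ost \<gamma> (cutoff (y t)) k else 0)) (at t within {0..})" if "0 \<le> t" for t k
    using y[OF that] by (simp add: x_def)
  have x0: "x 0 = trunc n v0" by (simp add: x_def y0)
  have cutoff_herm: "herm (cutoff z)" for z by (simp add: cutoff_def herm_def trunc_def add.commute)
  have supp: "supp n (x t)" if "0 \<le> t" for t
    unfolding supp_def
  proof safe
    fix k assume "k \<notin> band n"
    then have "x t k = x 0 k" using x[of _ k] that by (intro constant_halfline[of "\<lambda>t. x t k"]) auto
    then show "x t k = 0" using \<open>k \<notin> band n\<close> by (simp add: x0 trunc_def)
  qed
  have zero: "x t 0 = 0" if "0 \<le> t" for t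
  proof -
    have "x t 0 = x 0 0" using x[of _ 0] that by (intro constant_halfline[of "\<lambda>t. x t 0"]) (auto simp: ost_def band_def)
    then show "x t 0 = 0" by (simp add: x0 trunc_def v0)
  qed
  have herm: "herm (x t)" if "0 \<le> t" for t
    unfolding herm_def
  proof
    fix k
    have "x t (- k) - cnj (x t k) = x 0 (- k) - cnj (x 0 k)"
    proof (rule constant_halfline[of "\<lambda>t. x t (- k) - cnj (x t k)", OF _ that])
      fix s :: real assume s: "0 \<le> s"
      show "((\<lambda>t. x t (- k) - cnj (x t k)) has_vector_derivative 0) (at s within {0..})"
        using has_vector_derivative_diff[OF x[OF s, of "- k"] bounded_linear.has_vector_derivative[OF bounded_linear_cnj x[OF s, of k]]]
        by (simp add: herm_ost[OF cutoff_herm] if_distrib cong: if_cong split: if_splits)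
    qed
    also have "\<dots> = 0" using herm_trunc[OF v0(1), of n] by (simp add: x0 herm_def)
    finally show "x t (- k) = cnj (x t k)" by simp
  qed
  have cutoff_eq: "cutoff (y t) = (\<lambda>k. of_real (R / max R (norm (y t))) * x t k)" if "0 \<le> t" for t
  proof
    fix k
    have "cnj (x t (- k)) = x t k" using herm[OF that] by (simp add: herm_def)
    then show "cutoff (y t) k = of_real (R / max R (norm (y t))) * x t k"
      using supp[OF that] by (auto simp: cutoff_def radial_def x_def scaleR_bcontfun.rep_eq trunc_def supp_def scaleR_conv_of_real)
  qed
  have energy: "en (\<lambda>_. 1) n (x t) = en (\<lambda>_. 1) n (x 0)" if "0 \<le> t" for t
  proof (rule constant_halfline[OF _ that])
    fix s :: real assume s: "0 \<le> s"
    define \<theta> where "\<theta> = R / max R (norm (y s))"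
    have \<theta>: "\<theta> > 0" using R by (simp add: \<theta>_def)
    have c: "cutoff (y s) = (\<lambda>k. of_real \<theta> * x s k)" using cutoff_eq[OF s] by (simp add: \<theta>_def)
    have "((\<lambda>t. en (\<lambda>_. 1) n (x t)) has_real_derivative (\<Sum>k\<in>band n. 2 * Re (cnj (x s k) * ost \<gamma> (cutoff (y s)) k))) (at s within {0..})"
      unfolding en_def mult_1
    proof (rule DERIV_sum)
      fix k assume "k \<in> band n"
      then show "((\<lambda>t. (cmod (x t k))\<^sup>2) has_real_derivative 2 * Re (cnj (x s k) * ost \<gamma> (cutoff (y s)) k)) (at s within {0..})"
        using has_real_derivative_cmod_square[OF x[OF s, of k]] by simp
    qed
    moreover have "(\<Sum>k\<in>band n. 2 * Re (cnj (x s k) * ost \<gamma> (cutoff (y s)) k)) = 0"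
    proof -
      have s0: "supp n (\<lambda>_. 0)" "herm (\<lambda>_. 0)" by (auto simp: supp_def herm_def)
      have sc: "supp n (cutoff (y s))" by (simp add: cutoff_def)
      \<comment> \<open>Energy conservation is the difference estimate against the zero state, for
        which \<open>A1\<close> vanishes and the upper bound is 0.\<close>
      have "\<bar>\<Sum>k\<in>band n. Re (cnj (0 - cutoff (y s) k) * (ost \<gamma> (\<lambda>_. 0) k - ost \<gamma> (cutoff (y s)) k))\<bar>
          \<le> pi * A1 n (\<lambda>_. 0) * en (\<lambda>_. 1) n (\<lambda>k. 0 - cutoff (y s) k)"
        by (rule difference_cancellation[OF s0 sc cutoff_herm])
      then have "(\<Sum>k\<in>band n. Re (cnj (cutoff (y s) k) * ost \<gamma> (cutoff (y s)) k)) = 0"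
        by (simp add: A1_def ost_zero)
      moreover have "Re (cnj (cutoff (y s) k) * ost \<gamma> (cutoff (y s)) k) = \<theta> * Re (cnj (x s k) * ost \<gamma> (cutoff (y s)) k)" for k
        by (simp add: fun_cong[OF c, of k] algebra_simps)
      ultimately have "\<theta> * (\<Sum>k\<in>band n. Re (cnj (x s k) * ost \<gamma> (cutoff (y s)) k)) = 0"
        by (simp add: sum_distrib_left)
      then have "(\<Sum>k\<in>band n. Re (cnj (x s k) * ost \<gamma> (cutoff (y s)) k)) = 0" using \<theta> by simp
      then show ?thesis unfolding sum_distrib_left[symmetric] by simp
    qed
    ultimately show "((\<lambda>t. en (\<lambda>_. 1) n (x t)) has_vector_derivative 0) (at s within {0..})"
      by (simp add: has_real_derivative_iff_has_vector_derivative)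
  qed
  have cutoff_id: "cutoff (y t) = x t" if "0 \<le> t" for t
  proof -
    have "norm (y t) \<le> R"
    proof (rule norm_bound)
      fix k
      have "(cmod (x t k))\<^sup>2 \<le> en (\<lambda>_. 1) n (x t)"
        using hb_single[OF supp_hb_en[OF supp[OF that], of "\<lambda>_. 1"], of k] by simp
      also have "\<dots> = E" unfolding energy[OF that] by (simp add: x0 E_def en_def trunc_def)
      finally have "cmod (x t k) \<le> sqrt E" by (rule real_le_rsqrt)
      then show "norm (apply_bcontfun (y t) k) \<le> R" by (simp add: x_def R_def)
    qed
    then show ?thesis using cutoff_eq[OF that] R by (simp add: max_def)
  qed
  show ?thesis
  proof (intro exI conjI allI impI)
    fix t :: real and k assume t: "0 \<le> t"
    show "((\<lambda>t. x t k) has_vector_derivative (if k \<in> band n then ost \<gamma> (x t) k else 0)) (at t within {0..})"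
      using x[OF t, of k] unfolding cutoff_id[OF t] .
  qed (use x0 supp herm zero in auto)
qed

subsection \<open>A priori estimates for approximate solutions\<close>

text \<open>Differentiability is only asked for in the open interval, as in
  \<open>approx_sol\<close>. The shift \<beta> absorbs the consistency errors of approximate
  solutions.\<close>

lemma gronwall:
  fixes f :: "real \<Rightarrow> real"
  assumes t: "0 \<le> t" and c: "continuous_on {0..t} f"
    and d: "\<And>\<tau>. 0 < \<tau> \<Longrightarrow> \<tau> < t \<Longrightarrow> \<exists>f'. (f has_real_derivative f') (at \<tau>) \<and> f' \<le> \<alpha> * (f \<tau> + \<beta>)"
  shows "f t + \<beta> \<le> exp (\<alpha> * t) * (f 0 + \<beta>)"
proof -
  define g where "g \<tau> = exp (- \<alpha> * \<tau>) * (f \<tau> + \<beta>)" for \<tau>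
  have "g t \<le> g 0"
  proof (rule DERIV_nonpos_imp_decreasing_open[OF t])
    show "continuous_on {0..t} g" unfolding g_def by (intro continuous_intros c)
    fix \<tau> assume "0 < \<tau>" "\<tau> < t"
    then obtain f' where f': "(f has_real_derivative f') (at \<tau>)" "f' \<le> \<alpha> * (f \<tau> + \<beta>)" using d by blast
    have "(g has_real_derivative exp (- \<alpha> * \<tau>) * (f' - \<alpha> * (f \<tau> + \<beta>))) (at \<tau>)"
      unfolding g_def using f'(1) by (auto intro!: derivative_eq_intros simp: algebra_simps)
    moreover have "exp (- \<alpha> * \<tau>) * (f' - \<alpha> * (f \<tau> + \<beta>)) \<le> 0" using f'(2) by (simp add: mult_le_0_iff)
    ultimately show "\<exists>y. (g has_real_derivative y) (at \<tau>) \<and> y \<le> 0" by blast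
  qed
  then have "exp (\<alpha> * t) * g t \<le> exp (\<alpha> * t) * g 0" by (intro mult_left_mono) auto
  moreover have "exp (\<alpha> * t) * g t = f t + \<beta>" unfolding g_def by (simp add: mult.assoc[symmetric] flip: exp_add)
  moreover have "g 0 = f 0 + \<beta>" by (simp add: g_def)
  ultimately show ?thesis by simp
qed

text \<open>At the first time where \<open>f\<close> reaches \<open>K\<close>, all earlier values
  are at most \<open>K\<close>, so \<open>step\<close> gives the contradiction \<open>f < K\<close>.
  At time 0 there are no earlier values, so \<open>step\<close> also has to supply the initial
  bound.\<close>

lemma bootstrap:
  fixes f :: "real \<Rightarrow> real"
  assumes c: "continuous_on {0..S} f"
    and step: "\<And>t. t \<in> {0..S} \<Longrightarrow> (\<And>\<tau>. 0 < \<tau> \<Longrightarrow> \<tau> < t \<Longrightarrow> f \<tau> \<le> K) \<Longrightarrow> f t < K"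
    and t: "t \<in> {0..S}"
  shows "f t < K"
proof (rule ccontr)
  assume "\<not> f t < K"
  define Z where "Z = {\<tau> \<in> {0..S}. K \<le> f \<tau>}"
  have "closed Z" unfolding Z_def by (intro continuous_on_closed_Collect_le continuous_intros c)
  have "Z \<noteq> {}" using t \<open>\<not> f t < K\<close> by (auto simp: Z_def)
  moreover have "bdd_below Z" by (rule bdd_belowI[of _ 0]) (auto simp: Z_def)
  ultimately have "Inf Z \<in> Z" using closed_contains_Inf[of Z] \<open>closed Z\<close> by blast
  then have m: "Inf Z \<in> {0..S}" "K \<le> f (Inf Z)" by (auto simp: Z_def)
  have "f (Inf Z) < K"
  proof (rule step[OF m(1)])
    fix \<tau> assume \<tau>: "0 < \<tau>" "\<tau> < Inf Z"
    then have "\<tau> \<notin> Z" using cInf_lower[OF _ \<open>bdd_below Z\<close>] by (meson leD)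
    then show "f \<tau> \<le> K" using \<tau> m(1) by (auto simp: Z_def)
  qed
  with m(2) show False by simp
qed

text \<open>The error \<open>\<epsilon>\<close> allows to compare Galerkin solutions of different levels with each other
  (\<open>approx_sol_gal_up\<close>) and with truncations of exact solutions (\<open>approx_sol_trunc\<close>).\<close>

definition approx_sol :: "real \<Rightarrow> nat \<Rightarrow> real \<Rightarrow> (real \<Rightarrow> int \<Rightarrow> complex) \<Rightarrow> real \<Rightarrow> bool" where
  "approx_sol \<gamma> n S b \<epsilon> \<longleftrightarrow>
     (\<forall>t\<in>{0..S}. supp n (b t) \<and> herm (b t)) \<and> (\<forall>k. continuous_on {0..S} (\<lambda>t. b t k)) \<and>
     (\<exists>r. \<forall>t\<in>{0<..<S}. (\<Sum>k\<in>band n. (cmod (r t k))\<^sup>2) \<le> \<epsilon> \<and>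
        (\<forall>k\<in>band n. ((\<lambda>t. b t k) has_vector_derivative ost \<gamma> (b t) k + r t k) (at t)))"

lemma approx_sol_subset: "approx_sol \<gamma> n S b \<epsilon> \<Longrightarrow> t \<le> S \<Longrightarrow> approx_sol \<gamma> n t b \<epsilon>"
  unfolding approx_sol_def by (fastforce intro: continuous_on_subset)

lemma continuous_on_en:
  assumes "\<And>k. continuous_on S (\<lambda>t. b t k)"
  shows "continuous_on S (\<lambda>t. en W n (b t))"
  unfolding en_def by (intro continuous_intros assms)

lemma continuous_on_A1:
  assumes "\<And>k. continuous_on S (\<lambda>t. b t k)"
  shows "continuous_on S (\<lambda>t. A1 n (b t))"
  unfolding A1_def by (intro continuous_intros assms)

lemma approx_sol_energy:
  assumes b: "approx_sol \<gamma> n t b 0" and W: "weight p W" and t: "0 \<le> t"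
    and K: "\<And>\<tau>. 0 < \<tau> \<Longrightarrow> \<tau> < t \<Longrightarrow> A1 n (b \<tau>) \<le> K"
  shows "en W n (b t) \<le> exp (2 * pi * comm_const p * K * t) * en W n (b 0)"
proof -
  have "en W n (b t) + 0 \<le> exp (2 * pi * comm_const p * K * t) * (en W n (b 0) + 0)"
  proof (rule gronwall[OF t])
    show "continuous_on {0..t} (\<lambda>t. en W n (b t))" using b by (intro continuous_on_en) (auto simp: approx_sol_def)
    fix \<tau> assume \<tau>: "0 < \<tau>" "\<tau> < t"
    obtain r where r: "(\<Sum>k\<in>band n. (cmod (r \<tau> k))\<^sup>2) \<le> 0"
       "\<And>k. k \<in> band n \<Longrightarrow> ((\<lambda>t. b t k) has_vector_derivative ost \<gamma> (b \<tau>) k + r \<tau> k) (at \<tau>)"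
      using b \<tau> unfolding approx_sol_def by force
    \<comment> \<open>Error 0 means that the residual vanishes on the band, that is, the Galerkin
      equation holds exactly.\<close>
    have "r \<tau> k = 0" if "k \<in> band n" for k
    proof -
      have "(\<Sum>k\<in>band n. (cmod (r \<tau> k))\<^sup>2) = 0" using r(1) by (intro antisym sum_nonneg) auto
      then show ?thesis using that by (simp add: sum_nonneg_eq_0_iff)
    qed
    with r(2) have "\<And>k. k \<in> band n \<Longrightarrow> ((\<lambda>t. b t k) has_vector_derivative ost \<gamma> (b \<tau>) k) (at \<tau>)" by fastforce
    then have "((\<lambda>t. en W n (b t)) has_real_derivative (\<Sum>k\<in>band n. W k * (2 * Re (cnj (b \<tau> k) * ost \<gamma> (b \<tau>) k)))) (at \<tau>)"
      unfolding en_def by (intro DERIV_sum DERIV_cmult has_real_derivative_cmod_square)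
    moreover have "(\<Sum>k\<in>band n. W k * (2 * Re (cnj (b \<tau> k) * ost \<gamma> (b \<tau>) k))) \<le> 2 * pi * comm_const p * K * (en W n (b \<tau>) + 0)"
    proof -
      have "(\<Sum>k\<in>band n. W k * (2 * Re (cnj (b \<tau> k) * ost \<gamma> (b \<tau>) k))) = 2 * (\<Sum>k\<in>band n. W k * Re (cnj (b \<tau> k) * ost \<gamma> (b \<tau>) k))"
        unfolding sum_distrib_left by (intro sum.cong refl) simp
      also have "\<dots> \<le> 2 * (pi * comm_const p * A1 n (b \<tau>) * en W n (b \<tau>))"
        using energy_cancellation[OF W, of n "b \<tau>" \<gamma>] b \<tau> unfolding approx_sol_def by force
      also have "\<dots> \<le> 2 * (pi * comm_const p * K * en W n (b \<tau>))"
        using K[OF \<tau>] comm_const_pos[of p] weight_nonneg[OF W]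
        by (intro mult_left_mono mult_right_mono) (auto simp: en_def intro!: sum_nonneg)
      finally show ?thesis by simp
    qed
    ultimately show "\<exists>f'. ((\<lambda>t. en W n (b t)) has_real_derivative f') (at \<tau>) \<and> f' \<le> 2 * pi * comm_const p * K * (en W n (b \<tau>) + 0)"
      by blast
  qed
  then show ?thesis by simp
qed

lemma two_Re_le: "2 * Re (cnj z * w) \<le> (cmod z)\<^sup>2 + (cmod w)\<^sup>2"
proof -
  have "2 * Re (cnj z * w) \<le> 2 * cmod (cnj z * w)" using complex_Re_le_cmod[of "cnj z * w"] by simp
  also have "\<dots> = 2 * cmod z * cmod w" by (simp add: norm_mult)
  also have "\<dots> \<le> (cmod z)\<^sup>2 + (cmod w)\<^sup>2" by (rule sum_squares_bound)
  finally show ?thesis .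
qed

text \<open>Only \<open>b\<close> is assumed bounded in \<open>A1\<close>. The 1 added to the
  exponent comes from \<open>2 * Re (cnj d * r) \<le> |d|^2 + |r|^2\<close>, and the factor 2 of the
  errors from squaring the difference of two residuals.\<close>

lemma approx_sol_diff:
  assumes b: "approx_sol \<gamma> n t b \<epsilon>1" and c: "approx_sol \<gamma> n t c \<epsilon>2" and t: "0 \<le> t" and K0: "0 \<le> K"
    and K: "\<And>\<tau>. 0 < \<tau> \<Longrightarrow> \<tau> < t \<Longrightarrow> A1 n (b \<tau>) \<le> K" and \<epsilon>: "0 \<le> \<epsilon>1" "0 \<le> \<epsilon>2"
  shows "en (\<lambda>_. 1) n (\<lambda>k. b t k - c t k) \<le> exp ((2 * pi * K + 1) * t) * (en (\<lambda>_. 1) n (\<lambda>k. b 0 k - c 0 k) + 2 * (\<epsilon>1 + \<epsilon>2))"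
proof -
  let ?f = "\<lambda>t. en (\<lambda>_. 1) n (\<lambda>k. b t k - c t k)"
  have "?f t + 2 * (\<epsilon>1 + \<epsilon>2) \<le> exp ((2 * pi * K + 1) * t) * (?f 0 + 2 * (\<epsilon>1 + \<epsilon>2))"
  proof (rule gronwall[OF t])
    show "continuous_on {0..t} ?f"
      using b c by (intro continuous_on_en continuous_on_diff) (auto simp: approx_sol_def)
    fix \<tau> assume \<tau>: "0 < \<tau>" "\<tau> < t"
    obtain r where r: "(\<Sum>k\<in>band n. (cmod (r \<tau> k))\<^sup>2) \<le> \<epsilon>1"
       "\<And>k. k \<in> band n \<Longrightarrow> ((\<lambda>t. b t k) has_vector_derivative ost \<gamma> (b \<tau>) k + r \<tau> k) (at \<tau>)"
      using b \<tau> unfolding approx_sol_def by force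
    obtain q where q: "(\<Sum>k\<in>band n. (cmod (q \<tau> k))\<^sup>2) \<le> \<epsilon>2"
       "\<And>k. k \<in> band n \<Longrightarrow> ((\<lambda>t. c t k) has_vector_derivative ost \<gamma> (c \<tau>) k + q \<tau> k) (at \<tau>)"
      using c \<tau> unfolding approx_sol_def by force
    define d where "d k = b \<tau> k - c \<tau> k" for k
    have "(?f has_real_derivative (\<Sum>k\<in>band n. 2 * Re (cnj (d k) * ((ost \<gamma> (b \<tau>) k + r \<tau> k) - (ost \<gamma> (c \<tau>) k + q \<tau> k))))) (at \<tau>)"
      unfolding en_def mult_1 d_def
      by (intro DERIV_sum has_real_derivative_cmod_square has_vector_derivative_diff r q)
    moreover have "(\<Sum>k\<in>band n. 2 * Re (cnj (d k) * ((ost \<gamma> (b \<tau>) k + r \<tau> k) - (ost \<gamma> (c \<tau>) k + q \<tau> k))))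
      \<le> (2 * pi * K + 1) * (?f \<tau> + 2 * (\<epsilon>1 + \<epsilon>2))"
    proof -
      have "(\<Sum>k\<in>band n. 2 * Re (cnj (d k) * ((ost \<gamma> (b \<tau>) k + r \<tau> k) - (ost \<gamma> (c \<tau>) k + q \<tau> k))))
        = 2 * (\<Sum>k\<in>band n. Re (cnj (d k) * (ost \<gamma> (b \<tau>) k - ost \<gamma> (c \<tau>) k))) + (\<Sum>k\<in>band n. 2 * Re (cnj (d k) * (r \<tau> k - q \<tau> k)))"
        unfolding sum_distrib_left sum.distrib[symmetric] by (intro sum.cong refl) (simp add: algebra_simps)
      also have "(\<Sum>k\<in>band n. Re (cnj (d k) * (ost \<gamma> (b \<tau>) k - ost \<gamma> (c \<tau>) k))) \<le> pi * A1 n (b \<tau>) * ?f \<tau>"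
        using difference_cancellation[of n "b \<tau>" "c \<tau>" \<gamma>] b c \<tau> unfolding approx_sol_def d_def by force
      also have "pi * A1 n (b \<tau>) * ?f \<tau> \<le> pi * K * ?f \<tau>"
        using K[OF \<tau>] by (intro mult_right_mono mult_left_mono) (auto simp: en_def intro!: sum_nonneg)
      also have "(\<Sum>k\<in>band n. 2 * Re (cnj (d k) * (r \<tau> k - q \<tau> k))) \<le> (\<Sum>k\<in>band n. (cmod (d k))\<^sup>2 + (2 * (cmod (r \<tau> k))\<^sup>2 + 2 * (cmod (q \<tau> k))\<^sup>2))"
      proof (rule sum_mono)
        fix k
        show "2 * Re (cnj (d k) * (r \<tau> k - q \<tau> k)) \<le> (cmod (d k))\<^sup>2 + (2 * (cmod (r \<tau> k))\<^sup>2 + 2 * (cmod (q \<tau> k))\<^sup>2)"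
          using two_Re_le[of "d k" "r \<tau> k - q \<tau> k"] norm_add_sq_le[of "r \<tau> k" "- q \<tau> k"] by simp
      qed
      also have "\<dots> = ?f \<tau> + (2 * (\<Sum>k\<in>band n. (cmod (r \<tau> k))\<^sup>2) + 2 * (\<Sum>k\<in>band n. (cmod (q \<tau> k))\<^sup>2))"
        by (simp add: sum.distrib sum_distrib_left en_def d_def)
      also have "\<dots> \<le> ?f \<tau> + (2 * \<epsilon>1 + 2 * \<epsilon>2)" using r(1) q(1) by simp
      finally have "(\<Sum>k\<in>band n. 2 * Re (cnj (d k) * ((ost \<gamma> (b \<tau>) k + r \<tau> k) - (ost \<gamma> (c \<tau>) k + q \<tau> k))))
        \<le> 2 * (pi * K * ?f \<tau>) + (?f \<tau> + (2 * \<epsilon>1 + 2 * \<epsilon>2))" by simp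
      also have "\<dots> \<le> (2 * pi * K + 1) * (?f \<tau> + 2 * (\<epsilon>1 + \<epsilon>2))"
        using mult_nonneg_nonneg[OF K0, of "4 * pi * (\<epsilon>1 + \<epsilon>2)"] \<epsilon> by (simp add: algebra_simps)
      finally show ?thesis .
    qed
    ultimately show "\<exists>f'. (?f has_real_derivative f') (at \<tau>) \<and> f' \<le> (2 * pi * K + 1) * (?f \<tau> + 2 * (\<epsilon>1 + \<epsilon>2))"
      by blast
  qed
  then show ?thesis using \<epsilon> by simp
qed

section \<open>Galerkin solutions and consistency errors\<close>

definition gal_spec :: "real \<Rightarrow> (int \<Rightarrow> complex) \<Rightarrow> nat \<Rightarrow> (real \<Rightarrow> int \<Rightarrow> complex) \<Rightarrow> bool" where
  "gal_spec \<gamma> v0 n x \<longleftrightarrow> x 0 = trunc n v0 \<and> (\<forall>t\<ge>0. supp n (x t) \<and> herm (x t) \<and> x t 0 = 0 \<and>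
    (\<forall>k. ((\<lambda>t. x t k) has_vector_derivative (if k \<in> band n then ost \<gamma> (x t) k else 0)) (at t within {0..})))"

definition gal :: "real \<Rightarrow> (int \<Rightarrow> complex) \<Rightarrow> nat \<Rightarrow> real \<Rightarrow> int \<Rightarrow> complex" where
  "gal \<gamma> v0 n = (SOME x. gal_spec \<gamma> v0 n x)"

lemma gal:
  assumes "herm v0" "v0 0 = 0"
  shows gal_0: "gal \<gamma> v0 n 0 = trunc n v0" 
    and gal_supp: "0 \<le> t \<Longrightarrow> supp n (gal \<gamma> v0 n t)"
    and gal_herm: "0 \<le> t \<Longrightarrow> herm (gal \<gamma> v0 n t)"
    and gal_mean: "0 \<le> t \<Longrightarrow> gal \<gamma> v0 n t 0 = 0"
    and gal_deriv: "0 \<le> t \<Longrightarrow> ((\<lambda>t. gal \<gamma> v0 n t k) has_vector_derivative (if k \<in> band n then ost \<gamma> (gal \<gamma> v0 n t) k else 0)) (at t within {0..})"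
proof -
  have "\<exists>x. gal_spec \<gamma> v0 n x" unfolding gal_spec_def by (rule galerkin_exists[OF assms])
  then have *: "gal_spec \<gamma> v0 n (gal \<gamma> v0 n)" unfolding gal_def by (rule someI_ex)
  then show "gal \<gamma> v0 n 0 = trunc n v0" by (simp add: gal_spec_def)
  assume "0 \<le> t"
  then show "supp n (gal \<gamma> v0 n t)" "herm (gal \<gamma> v0 n t)" "gal \<gamma> v0 n t 0 = 0"
    "((\<lambda>t. gal \<gamma> v0 n t k) has_vector_derivative (if k \<in> band n then ost \<gamma> (gal \<gamma> v0 n t) k else 0)) (at t within {0..})"
    using * unfolding gal_spec_def by simp_all
qed

lemma gal_continuous:
  assumes "herm v0" "v0 0 = 0"
  shows "continuous_on {0..S} (\<lambda>t. gal \<gamma> v0 n t k)"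
proof -
  have "continuous_on {0..} (\<lambda>t. gal \<gamma> v0 n t k)"
    by (rule continuous_on_vector_derivative) (use gal_deriv[OF assms] in auto)
  then show ?thesis by (rule continuous_on_subset) auto
qed

lemma gal_deriv_interior:
  assumes "herm v0" "v0 0 = 0" "0 < t"
  shows "((\<lambda>t. gal \<gamma> v0 n t k) has_vector_derivative (if k \<in> band n then ost \<gamma> (gal \<gamma> v0 n t) k else 0)) (at t)"
proof -
  have "at t within {0..} = at t" using assms(3) by (intro at_within_interior) (simp add: interior_Ici[of "t - 1"])
  then show ?thesis using gal_deriv[OF assms(1,2), of t \<gamma> n k] assms(3) by simp
qed

lemma approx_sol_gal:
  assumes "herm v0" "v0 0 = 0"
  shows "approx_sol \<gamma> n S (gal \<gamma> v0 n) 0"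
  unfolding approx_sol_def
  using gal_supp[OF assms] gal_herm[OF assms] gal_continuous[OF assms] gal_deriv_interior[OF assms, where k=k for k]
  by (auto intro!: exI[of _ "\<lambda>_ _. 0"]) (metis (full_types))

text \<open>One expression for both comparisons below: truncating an exact solution costs the part
  with \<open>alg_const 2\<close>, and reading a Galerkin solution at a higher level costs at most
  the part with \<open>alg_const 4\<close>.\<close>

definition err :: "real \<Rightarrow> nat \<Rightarrow> real" where
  "err M n = 4 * pi\<^sup>2 * (alg_const 2 + alg_const 4) * M\<^sup>2 / (real n)\<^sup>2"

lemma err_nonneg: "0 \<le> err M n" by (simp add: err_def alg_const_nonneg add_nonneg_nonneg)

lemma weight_even_power: "weight (2 * q) (\<lambda>k. real_of_int k ^ (2 * q))"
  unfolding weight_def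
proof safe
  fix k :: int show "0 \<le> real_of_int k ^ (2 * q)" by (simp add: power_mult)
next
  fix j k :: int assume le: "\<bar>j\<bar> \<le> \<bar>k\<bar>"
  have "\<bar>real_of_int j\<bar> ^ (2 * q) \<le> \<bar>real_of_int k\<bar> ^ (2 * q)" using le by (intro power_mono) auto
  then show "real_of_int j ^ (2 * q) \<le> real_of_int k ^ (2 * q)" by (simp add: power_even_abs)
  show "real_of_int k ^ (2 * q) * real_of_int \<bar>j\<bar> ^ (2 * q) \<le> real_of_int j ^ (2 * q) * real_of_int \<bar>k\<bar> ^ (2 * q)"
    by (simp add: power_even_abs)
qed

lemma weight_sq: "weight 2 (\<lambda>k. (real_of_int k)\<^sup>2)" using weight_even_power[of 1] by simp
lemma weight_p4: "weight 4 (\<lambda>k. real_of_int k ^ 4)" using weight_even_power[of 2] by simp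
lemma one_le_sq_int: "k \<noteq> 0 \<Longrightarrow> 1 \<le> (real_of_int k)\<^sup>2"
proof -
  assume "k \<noteq> 0"
  then have "1 \<le> \<bar>real_of_int k\<bar>" by linarith
  then have "1\<^sup>2 \<le> \<bar>real_of_int k\<bar>\<^sup>2" by (intro power_mono) auto
  then show ?thesis by simp
qed

lemma sq_le_p4: "(real_of_int k)\<^sup>2 \<le> real_of_int k ^ 4"
proof (cases "k = 0")
  case False
  have "(real_of_int k)\<^sup>2 * 1 \<le> (real_of_int k)\<^sup>2 * (real_of_int k)\<^sup>2"
    using one_le_sq_int[OF False] by (intro mult_left_mono) auto
  then show ?thesis by (simp flip: power_add)
qed simp

lemma hb_sq_p4: "hb (\<lambda>k. real_of_int k ^ 4) a A \<Longrightarrow> hb (\<lambda>k. (real_of_int k)\<^sup>2) a A"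
  by (erule hb_weight_mono) (rule sq_le_p4)

lemma hb_one_sq: "hb (\<lambda>k. (real_of_int k)\<^sup>2) a A \<Longrightarrow> a 0 = 0 \<Longrightarrow> hb (\<lambda>_. 1) a A"
  by (erule hb_mono) (metis (no_types, lifting) mult_right_mono one_le_sq_int norm_zero order_refl power_zero_numeral mult_zero_right zero_le_power2)

lemma hb_one_p4: "hb (\<lambda>k. real_of_int k ^ 4) a A \<Longrightarrow> a 0 = 0 \<Longrightarrow> hb (\<lambda>_. 1) a A"
  by (intro hb_one_sq hb_sq_p4)

lemma outside_band_sq: "k \<notin> band n \<Longrightarrow> (real n)\<^sup>2 \<le> (real_of_int k)\<^sup>2"
proof -
  assume "k \<notin> band n"
  then have "real n \<le> \<bar>real_of_int k\<bar>" by (auto simp: band_iff)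
  then have "(real n)\<^sup>2 \<le> \<bar>real_of_int k\<bar>\<^sup>2" by (intro power_mono) auto
  then show ?thesis by simp
qed

text \<open>Outside the band \<open>k^2 \<ge> n^2\<close>, so giving up two powers of frequency
  gains \<open>1 / n^2\<close>. The rates of convergence below all have this origin.\<close>

lemma hb_tail:
  assumes a: "hb (\<lambda>k. (real_of_int k)\<^sup>2 * V k) a A" and n: "n \<ge> 1" and V: "\<And>k. 0 \<le> V k"
    and b: "\<And>k. k \<in> band n \<Longrightarrow> b k = 0" "\<And>k. k \<notin> band n \<Longrightarrow> b k = a k"
  shows "hb V b (A / (real n)\<^sup>2)"
proof -
  have "hb V b (1 / (real n)\<^sup>2 * A)"
  proof (rule hb_dominate[OF a])
    fix k
    show "V k * (cmod (b k))\<^sup>2 \<le> 1 / (real n)\<^sup>2 * ((real_of_int k)\<^sup>2 * V k * (cmod (a k))\<^sup>2)"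
    proof (cases "k \<in> band n")
      case False
      have "(real n)\<^sup>2 * (V k * (cmod (a k))\<^sup>2) \<le> (real_of_int k)\<^sup>2 * (V k * (cmod (a k))\<^sup>2)"
        using V by (intro mult_right_mono outside_band_sq False) auto
      then show ?thesis using False b n by (simp add: field_simps)
    qed (use b V in auto)
  qed auto
  then show ?thesis by simp
qed

lemma approx_sol_gal_up:
  assumes v0: "herm v0" "v0 0 = 0" and nm: "n \<le> m" "1 \<le> n"
    and M: "\<And>t. t \<in> {0..S} \<Longrightarrow> hb (\<lambda>k. real_of_int k ^ 4) (gal \<gamma> v0 n t) M"
  shows "approx_sol \<gamma> m S (gal \<gamma> v0 n) (err M n)"
  unfolding approx_sol_def
proof (intro conjI ballI allI exI)
  fix t assume t: "t \<in> {0..S}"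
  show "supp m (gal \<gamma> v0 n t)" using gal_supp[OF v0, of t n \<gamma>] t band_mono[OF nm(1)] by (auto simp: supp_def)
  show "herm (gal \<gamma> v0 n t)" using gal_herm[OF v0] t by simp
next
  show "continuous_on {0..S} (\<lambda>t. gal \<gamma> v0 n t k)" for k by (rule gal_continuous[OF v0])
next
  fix t assume t: "t \<in> {0<..<S}"
  let ?a = "gal \<gamma> v0 n t"
  \<comment> \<open>Outside \<open>band n\<close> the coefficients stay zero, so the residual has to
    cancel the field there. As \<open>?a\<close> itself vanishes at these frequencies, only the
    convolution contributes.\<close>
  let ?r = "\<lambda>k. if k \<in> band n then 0 else - ost \<gamma> ?a k"
  show "(\<Sum>k\<in>band m. (cmod (?r k))\<^sup>2) \<le> err M n"
  proof -
    have h: "hb (\<lambda>k. real_of_int k ^ 4) ?a M" and z: "?a 0 = 0" using M t gal_mean[OF v0] by auto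
    have hc: "hb (\<lambda>k. real_of_int k ^ 4) (conv ?a ?a) (alg_const 4 * (M * M))"
      by (rule hb_conv[OF weight_p4 _ h z h z]) (rule sq_le_p4)
    have "hb (\<lambda>k. (real_of_int k)\<^sup>2) (\<lambda>k. if k \<in> band n then 0 else conv ?a ?a k) (alg_const 4 * (M * M) / (real n)\<^sup>2)"
      by (rule hb_tail[of _ "conv ?a ?a"]) (use hc nm in \<open>auto simp flip: power_add\<close>)
    then have "hb (\<lambda>_. 1) ?r (pi\<^sup>2 * (alg_const 4 * (M * M) / (real n)\<^sup>2))"
    proof (rule hb_dominate)
      fix k
      have "?a k = 0" if "k \<notin> band n" using gal_supp[OF v0, of t n \<gamma>] t that by (auto simp: supp_def)
      then show "1 * (cmod (?r k))\<^sup>2 \<le> pi\<^sup>2 * ((real_of_int k)\<^sup>2 * (cmod (if k \<in> band n then 0 else conv ?a ?a k))\<^sup>2)"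
        by (simp add: ost_def norm_mult power_mult_distrib)
    qed auto
    from hbD[OF this finite_band, of m] have "(\<Sum>k\<in>band m. (cmod (?r k))\<^sup>2) \<le> pi\<^sup>2 * alg_const 4 * M\<^sup>2 / (real n)\<^sup>2"
      by (simp add: power2_eq_square)
    also have "\<dots> \<le> err M n"
      unfolding err_def using alg_const_nonneg[of 2] alg_const_nonneg[of 4]
      by (intro divide_right_mono mult_right_mono) (auto simp: algebra_simps intro!: add_nonneg_nonneg)
    finally show ?thesis .
  qed
  fix k assume "k \<in> band m"
  show "((\<lambda>t. gal \<gamma> v0 n t k) has_vector_derivative ost \<gamma> ?a k + ?r k) (at t)"
    using gal_deriv_interior[OF v0, of t \<gamma> n k] t by (auto split: if_splits)
qed

text \<open>The weighted norm is only required to be bounded, and the equation only to hold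
  coefficientwise in the open interval, so that limits of Galerkin solutions qualify at once.
  Continuity in the weighted norm is a consequence, see \<open>hsol_continuous\<close>.\<close>

definition hsol :: "real \<Rightarrow> (int \<Rightarrow> real) \<Rightarrow> real \<Rightarrow> (real \<Rightarrow> int \<Rightarrow> complex) \<Rightarrow> bool" where
  "hsol \<gamma> W S u \<longleftrightarrow> (\<forall>t\<in>{0..S}. herm (u t) \<and> u t 0 = 0) \<and> (\<exists>M. \<forall>t\<in>{0..S}. hb W (u t) M) \<and>
    (\<forall>k. continuous_on {0..S} (\<lambda>t. u t k) \<and> (\<forall>t\<in>{0<..<S}. ((\<lambda>t. u t k) has_vector_derivative ost \<gamma> (u t) k) (at t)))"

lemma ost_diff_conv:
  assumes "a k = b k"
  shows "ost \<gamma> a k - ost \<gamma> b k = - (\<i> * of_real (pi * k)) * (conv a a k - conv b b k)"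
  unfolding ost_def assms by algebra

text \<open>Inside the band the linear terms agree, so the residual is a derivative of
  \<open>conv e a + conv e b\<close>, where \<open>e\<close> is the part of the solution cut away.
  That part is of size \<open>1 / n^2\<close> in the weight \<open>k^2\<close>, and the algebra
  property keeps this rate.\<close>

lemma approx_sol_trunc:
  assumes u: "\<And>t. t \<in> {0..S} \<Longrightarrow> herm (u t) \<and> u t 0 = 0" "\<And>t. t \<in> {0..S} \<Longrightarrow> hb (\<lambda>k. real_of_int k ^ 4) (u t) M"
    "\<And>k. continuous_on {0..S} (\<lambda>t. u t k)"
    "\<And>k t. t \<in> {0<..<S} \<Longrightarrow> ((\<lambda>t. u t k) has_vector_derivative ost \<gamma> (u t) k) (at t)"
    and n: "1 \<le> n"
  shows "approx_sol \<gamma> n S (\<lambda>t. trunc n (u t)) (err M n)"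
  unfolding approx_sol_def
proof (intro conjI ballI allI exI)
  fix t assume t: "t \<in> {0..S}"
  show "supp n (trunc n (u t))" by simp
  show "herm (trunc n (u t))" using u(1)[OF t] by (simp add: herm_trunc)
next
  show "continuous_on {0..S} (\<lambda>t. trunc n (u t) k)" for k by (cases "k \<in> band n") (simp_all add: trunc_def u(3))
next
  fix t assume t: "t \<in> {0<..<S}"
  define a where "a = u t"
  define b where "b = trunc n a"
  define e where "e = (\<lambda>k. a k - b k)"
  let ?r = "\<lambda>k. ost \<gamma> a k - ost \<gamma> b k"
  have a: "hb (\<lambda>k. real_of_int k ^ 4) a M" "a 0 = 0" using u(1,2)[of t] t by (auto simp: a_def)
  have b: "hb (\<lambda>k. real_of_int k ^ 4) b M" "b 0 = 0" using hb_trunc[OF a(1)] a(2) by (auto simp: b_def trunc_def)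
  have e: "hb (\<lambda>k. (real_of_int k)\<^sup>2) e (M / (real n)\<^sup>2)" "e 0 = 0"
    using a b by (auto intro!: hb_tail[of _ a] n simp: e_def b_def trunc_def simp flip: power_add)
  show "(\<Sum>k\<in>band n. (cmod (ost \<gamma> (u t) k - ost \<gamma> (trunc n (u t)) k))\<^sup>2) \<le> err M n"
  proof -
    let ?C = "alg_const 2 * (M / (real n)\<^sup>2 * M)"
    have c: "hb (\<lambda>k. (real_of_int k)\<^sup>2) (conv e a) ?C" "hb (\<lambda>k. (real_of_int k)\<^sup>2) (conv e b) ?C"
      by (rule hb_conv[OF weight_sq order_refl e hb_sq_p4[OF a(1)] a(2)],
          rule hb_conv[OF weight_sq order_refl e hb_sq_p4[OF b(1)] b(2)])
    have "hb (\<lambda>k. (real_of_int k)\<^sup>2) (\<lambda>k. conv e a k + conv e b k) (2 * ?C + 2 * ?C)"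
      by (rule hb_add[OF c]) simp
    then have h: "hb (\<lambda>k. (real_of_int k)\<^sup>2) (\<lambda>k. conv a a k - conv b b k) (4 * ?C)"
      using conv_square_diff[OF hb_one_p4[OF a] hb_one_p4[OF b]] by (simp add: e_def mult_ac)
    have "(\<Sum>k\<in>band n. (cmod (?r k))\<^sup>2) = pi\<^sup>2 * (\<Sum>k\<in>band n. (real_of_int k)\<^sup>2 * (cmod (conv a a k - conv b b k))\<^sup>2)"
      unfolding sum_distrib_left
    proof (rule sum.cong[OF refl])
      fix k assume "k \<in> band n"
      then have "a k = b k" by (simp add: b_def trunc_def)
      then show "(cmod (?r k))\<^sup>2 = pi\<^sup>2 * ((real_of_int k)\<^sup>2 * (cmod (conv a a k - conv b b k))\<^sup>2)"
        by (simp add: ost_diff_conv norm_mult power_mult_distrib)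
    qed
    also have "\<dots> \<le> pi\<^sup>2 * (4 * ?C)" by (intro mult_left_mono hbD[OF h]) auto
    also have "\<dots> = 4 * pi\<^sup>2 * alg_const 2 * M\<^sup>2 / (real n)\<^sup>2" by (simp add: power2_eq_square)
    also have "\<dots> \<le> err M n"
      unfolding err_def using alg_const_nonneg[of 4]
      by (intro divide_right_mono mult_right_mono) auto
    finally show ?thesis by (simp add: a_def b_def)
  qed
  fix k assume "k \<in> band n"
  then show "((\<lambda>t. trunc n (u t) k) has_vector_derivative ost \<gamma> (trunc n (u t)) k + (ost \<gamma> (u t) k - ost \<gamma> (trunc n (u t)) k)) (at t)"
    using u(4)[OF t, of k] by (simp add: trunc_def[of n _ k])
qed

text \<open>At a fixed frequency the field is Lipschitz for the \<open>L^2\<close> distance, since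
  the lost derivative is just a constant there. This yields convergence of the time derivatives
  coefficient by coefficient.\<close>

lemma ost_diff_bound:
  assumes a: "hb (\<lambda>_. 1) a M" and b: "hb (\<lambda>_. 1) b M" and d: "hb (\<lambda>_. 1) (\<lambda>k. a k - b k) \<rho>"
  shows "cmod (ost \<gamma> a k - ost \<gamma> b k) \<le> (2 * pi * \<bar>real_of_int k\<bar> * sqrt M + \<bar>\<gamma> / (2 * pi * k)\<bar>) * sqrt \<rho>"
proof -
  have "cmod (conv a a k - conv b b k) \<le> cmod (conv (\<lambda>k. a k - b k) a k) + cmod (conv (\<lambda>k. a k - b k) b k)"
    unfolding conv_square_diff[OF a b] by (rule norm_triangle_ineq)
  also have "\<dots> \<le> sqrt \<rho> * sqrt M + sqrt \<rho> * sqrt M" by (intro add_mono conv_bound a b d)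
  finally have c: "cmod (conv a a k - conv b b k) \<le> 2 * sqrt M * sqrt \<rho>" by simp
  have e: "cmod (a k - b k) \<le> sqrt \<rho>" using hb_single[OF d, of k] by (simp add: real_le_rsqrt)
  have "ost \<gamma> a k - ost \<gamma> b k = - (\<i> * of_real (pi * k)) * (conv a a k - conv b b k) - \<i> * of_real (\<gamma> / (2 * pi * k)) * (a k - b k)"
    unfolding ost_def by algebra
  also have "cmod \<dots> \<le> pi * \<bar>real_of_int k\<bar> * cmod (conv a a k - conv b b k) + \<bar>\<gamma> / (2 * pi * k)\<bar> * cmod (a k - b k)"
    by (rule order_trans[OF norm_triangle_ineq4]) (simp only: norm_mult norm_minus_cancel norm_of_real norm_ii abs_mult, simp)
  also have "\<dots> \<le> pi * \<bar>real_of_int k\<bar> * (2 * sqrt M * sqrt \<rho>) + \<bar>\<gamma> / (2 * pi * k)\<bar> * sqrt \<rho>"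
    by (intro add_mono mult_left_mono c e) auto
  finally show ?thesis by (simp add: algebra_simps)
qed

subsection \<open>Well-posedness in Fourier variables\<close>

lemma const_over_n_sq: "(\<lambda>n. (c::real) / (real n)\<^sup>2) \<longlonglongrightarrow> 0"
proof -
  have "(\<lambda>n. c / real n * (1 / real n)) \<longlonglongrightarrow> 0 * 0" by (intro tendsto_mult lim_const_over_n)
  then show ?thesis by (simp add: power2_eq_square)
qed

lemma hsolD:
  assumes "hsol \<gamma> W S u"
  shows "t \<in> {0..S} \<Longrightarrow> herm (u t)" and "t \<in> {0..S} \<Longrightarrow> u t 0 = 0"
    and "continuous_on {0..S} (\<lambda>t. u t k)"
    and "t \<in> {0<..<S} \<Longrightarrow> ((\<lambda>t. u t k) has_vector_derivative ost \<gamma> (u t) k) (at t)"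
  using assms by (auto simp: hsol_def)

lemma hsol_subset: "hsol \<gamma> W S u \<Longrightarrow> S' \<le> S \<Longrightarrow> hsol \<gamma> W S' u"
  unfolding hsol_def by (fastforce intro: continuous_on_subset)

lemma en_trunc[simp]: "en W n (trunc n a) = en W n a"
  by (simp add: en_def trunc_def)

lemma A1_trunc[simp]: "A1 n (trunc n a) = A1 n a"
  by (simp add: A1_def trunc_def)

lemma A1_supp_mono: "supp n a \<Longrightarrow> n \<le> m \<Longrightarrow> A1 m a = A1 n a"
  unfolding A1_def using band_mono[of n m] by (intro sum.mono_neutral_right) (auto simp: supp_def)

lemma A1_triangle: "A1 n a \<le> A1 n b + A1 n (\<lambda>k. b k - a k)"
  unfolding A1_def sum.distrib[symmetric]
proof (rule sum_mono)
  fix k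
  have "cmod (a k) \<le> cmod (b k) + cmod (b k - a k)" using norm_triangle_sub[of "a k" "b k"] by (simp add: norm_minus_commute)
  then have "real_of_int \<bar>k\<bar> * cmod (a k) \<le> real_of_int \<bar>k\<bar> * (cmod (b k) + cmod (b k - a k))" by (intro mult_left_mono) auto
  then show "real_of_int \<bar>k\<bar> * cmod (a k) \<le> real_of_int \<bar>k\<bar> * cmod (b k) + real_of_int \<bar>k\<bar> * cmod (b k - a k)"
    by (simp add: distrib_left)
qed

text \<open>The growth exponent does not depend on \<open>N\<close>: this is what makes the tail estimates uniform.\<close>

lemma weight_min:
  assumes W: "weight p W" and N: "1 \<le> (N::nat)"
  shows "weight (p + 1) (\<lambda>k. W k * min 1 (\<bar>real_of_int k\<bar> / N))"
  unfolding weight_def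
proof safe
  fix k :: int show "0 \<le> W k * min 1 (\<bar>real_of_int k\<bar> / N)" using weight_nonneg[OF W] by simp
next
  fix j k :: int assume le: "\<bar>j\<bar> \<le> \<bar>k\<bar>"
  define m where "m i = min 1 (\<bar>real_of_int i\<bar> / N)" for i
  have m0: "0 \<le> m i" for i by (simp add: m_def)
  have mm: "m j \<le> m k" unfolding m_def using le N by (intro min.mono divide_right_mono) auto
  have mg: "m k * \<bar>real_of_int j\<bar> \<le> m j * \<bar>real_of_int k\<bar>"
  proof (cases "\<bar>real_of_int j\<bar> \<le> N")
    case True
    then have "m j = \<bar>real_of_int j\<bar> / N" using N by (simp add: m_def)
    moreover have "m k \<le> \<bar>real_of_int k\<bar> / N" by (simp add: m_def)
    then have "m k * \<bar>real_of_int j\<bar> \<le> \<bar>real_of_int k\<bar> / N * \<bar>real_of_int j\<bar>" by (intro mult_right_mono) auto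
    ultimately show ?thesis by (simp add: mult_ac)
  next
    case False
    then have "m j = 1" using N by (simp add: m_def)
    moreover have "m k * \<bar>real_of_int j\<bar> \<le> 1 * \<bar>real_of_int k\<bar>" using le m0[of k] by (intro mult_mono) (auto simp: m_def)
    ultimately show ?thesis by simp
  qed
  show "W j * min 1 (\<bar>real_of_int j\<bar> / N) \<le> W k * min 1 (\<bar>real_of_int k\<bar> / N)"
    unfolding m_def[symmetric] by (intro mult_mono weight_mono[OF W le] mm m0 weight_nonneg[OF W])
  have "(W k * real_of_int \<bar>j\<bar> ^ p) * (m k * \<bar>real_of_int j\<bar>) \<le> (W j * real_of_int \<bar>k\<bar> ^ p) * (m j * \<bar>real_of_int k\<bar>)"
    by (intro mult_mono weight_growth[OF W le] mg mult_nonneg_nonneg m0 weight_nonneg[OF W]) auto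
  then show "W k * min 1 (\<bar>real_of_int k\<bar> / N) * real_of_int \<bar>j\<bar> ^ (p + 1) \<le> W j * min 1 (\<bar>real_of_int j\<bar> / N) * real_of_int \<bar>k\<bar> ^ (p + 1)"
    unfolding m_def[symmetric] by (simp add: mult_ac)
qed

section \<open>The Fourier-side theory for a general weight, with control of high
  frequencies\<close>

locale sobolev_weight =
  fixes p :: nat and W :: "int \<Rightarrow> real" and \<gamma> :: real
  assumes W: "weight p W" and W4: "\<And>k. real_of_int k ^ 4 \<le> W k"
begin

lemma W_nonneg: "0 \<le> W k" by (rule weight_nonneg[OF W])

lemma hb_p4: "hb W a A \<Longrightarrow> hb (\<lambda>k. real_of_int k ^ 4) a A"
  by (erule hb_weight_mono) (rule W4)

lemma hb_1: "hb W a A \<Longrightarrow> a 0 = 0 \<Longrightarrow> hb (\<lambda>_. 1) a A"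
  by (intro hb_one_p4 hb_p4)

text \<open>The filter rises linearly up to \<open>|k| = N\<close> instead of jumping there: a sharp
  cut-off would violate the growth condition of \<open>weight\<close>, which forbids zeros at
  nonzero frequencies below positive values.\<close>

definition VN :: "nat \<Rightarrow> int \<Rightarrow> real" where "VN N k = W k * min 1 (\<bar>real_of_int k\<bar> / N)"

lemma weight_VN: "1 \<le> N \<Longrightarrow> weight (p + 1) (VN N)"
  using weight_min[OF W, of N] by (simp add: VN_def[abs_def])

lemma VN_nonneg: "0 \<le> VN N k" by (simp add: VN_def W_nonneg)
lemma VN_le: "VN N k \<le> W k" using W_nonneg[of k] by (simp add: VN_def mult_left_le)

lemma hb_VN: "hb W a A \<Longrightarrow> hb (VN N) a A" by (erule hb_weight_mono) (rule VN_le)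

text \<open>A dominated convergence argument: a finite set of frequencies carries all but \<eta>/2
  of the sum, and on this set the filter is of order \<open>1 / N\<close>.\<close>

lemma hb_VN_small:
  assumes a: "hb W a A" and \<eta>: "0 < \<eta>"
  shows "\<exists>N\<ge>1. hb (VN N) a \<eta>"
proof -
  let ?f = "\<lambda>k. W k * (cmod (a k))\<^sup>2"
  have sm: "?f summable_on UNIV"
    by (rule nonneg_bdd_above_summable_on) (auto intro!: bdd_aboveI2[of _ _ A] hbD[OF a] simp: W_nonneg)
  obtain F where F: "finite F" "dist (sum ?f F) (infsum ?f UNIV) \<le> \<eta> / 2"
    using infsum_finite_approximation[OF sm, of "\<eta> / 2"] \<eta> by auto
  have tail: "sum ?f K \<le> \<eta> / 2" if K: "finite K" "K \<inter> F = {}" for K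
  proof -
    have "sum ?f (K \<union> F) \<le> infsum ?f UNIV" by (rule finite_sum_le_infsum[OF sm]) (use K F in \<open>auto simp: W_nonneg\<close>)
    then have "sum ?f K + sum ?f F \<le> infsum ?f UNIV" using K F by (simp add: sum.union_disjoint)
    then show ?thesis using F(2) unfolding dist_real_def abs_le_iff by linarith
  qed
  define C where "C = (\<Sum>k\<in>F. ?f k * \<bar>real_of_int k\<bar>)"
  have C: "0 \<le> C" by (simp add: C_def sum_nonneg W_nonneg)
  obtain N :: nat where N: "2 * C / \<eta> < N" using reals_Archimedean2 by blast
  define N' where "N' = N + 1"
  have "hb (VN N') a \<eta>"
    unfolding hb_def
  proof safe
    fix K :: "int set" assume K: "finite K"
    have "(\<Sum>k\<in>K. VN N' k * (cmod (a k))\<^sup>2) = (\<Sum>k\<in>K \<inter> F. VN N' k * (cmod (a k))\<^sup>2) + (\<Sum>k\<in>K - F. VN N' k * (cmod (a k))\<^sup>2)"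
      by (rule sum.Int_Diff[OF K])
    also have "(\<Sum>k\<in>K - F. VN N' k * (cmod (a k))\<^sup>2) \<le> sum ?f (K - F)"
      by (intro sum_mono mult_right_mono VN_le) auto
    also have "sum ?f (K - F) \<le> \<eta> / 2" using K by (intro tail) auto
    also have "(\<Sum>k\<in>K \<inter> F. VN N' k * (cmod (a k))\<^sup>2) \<le> (\<Sum>k\<in>F. VN N' k * (cmod (a k))\<^sup>2)"
      using F by (intro sum_mono2) (auto simp: VN_nonneg)
    also have "\<dots> \<le> (\<Sum>k\<in>F. ?f k * \<bar>real_of_int k\<bar> / N')"
    proof (rule sum_mono)
      fix k
      have "VN N' k \<le> W k * (\<bar>real_of_int k\<bar> / N')" unfolding VN_def by (intro mult_left_mono W_nonneg) auto
      from mult_right_mono[OF this, of "(cmod (a k))\<^sup>2"] show "VN N' k * (cmod (a k))\<^sup>2 \<le> ?f k * \<bar>real_of_int k\<bar> / N'"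
        by (simp add: mult_ac)
    qed
    also have "\<dots> = C / N'" by (simp add: C_def sum_divide_distrib)
    also have "\<dots> \<le> \<eta> / 2" using N \<eta> C by (simp add: N'_def field_simps)
    finally show "(\<Sum>k\<in>K. VN N' k * (cmod (a k))\<^sup>2) \<le> \<eta>" by simp
  qed
  then show ?thesis by (intro exI[of _ N']) (simp add: N'_def)
qed

text \<open>Beyond the band the filter equals 1 and \<open>VN\<close> is \<open>W\<close>. The two
  parts will be small for different reasons: finitely many coefficients by weak convergence, the
  tail by the energy estimate.\<close>

lemma hb_split:
  assumes N: "1 \<le> N" and d: "hb (VN N) d B"
  shows "hb W d (en W N d + B)"
  unfolding hb_def
proof safe
  fix K :: "int set" assume K: "finite K"
  have "(\<Sum>k\<in>K. W k * (cmod (d k))\<^sup>2) = (\<Sum>k\<in>K \<inter> band N. W k * (cmod (d k))\<^sup>2) + (\<Sum>k\<in>K - band N. W k * (cmod (d k))\<^sup>2)"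
    by (rule sum.Int_Diff[OF K])
  also have "(\<Sum>k\<in>K \<inter> band N. W k * (cmod (d k))\<^sup>2) \<le> en W N d"
    unfolding en_def by (intro sum_mono2) (auto simp: W_nonneg)
  also have "(\<Sum>k\<in>K - band N. W k * (cmod (d k))\<^sup>2) = (\<Sum>k\<in>K - band N. VN N k * (cmod (d k))\<^sup>2)"
  proof (rule sum.cong[OF refl])
    fix k assume "k \<in> K - band N"
    then have "1 \<le> \<bar>real_of_int k\<bar> / N" using N by (auto simp: band_iff)
    then show "W k * (cmod (d k))\<^sup>2 = VN N k * (cmod (d k))\<^sup>2" by (simp add: VN_def)
  qed
  also have "\<dots> \<le> B" using K by (intro hbD[OF d]) auto
  finally show "(\<Sum>k\<in>K. W k * (cmod (d k))\<^sup>2) \<le> en W N d + B" by simp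
qed

lemma en_le_W: "en W N d \<le> W N * en (\<lambda>_. 1) N d"
  unfolding en_def sum_distrib_left mult_1
  by (intro sum_mono mult_right_mono weight_mono[OF W]) (auto simp: band_iff)

section \<open>Stability in \<open>L^2\<close> and convergence of the Galerkin scheme\<close>

lemma hsol_M: "hsol \<gamma> W S u \<Longrightarrow> \<exists>M. \<forall>t\<in>{0..S}. hb W (u t) M"
  by (simp add: hsol_def)

lemma hsol_approx:
  assumes u: "hsol \<gamma> W S u" and M: "\<And>t. t \<in> {0..S} \<Longrightarrow> hb W (u t) M" and n: "1 \<le> n"
  shows "approx_sol \<gamma> n S (\<lambda>t. trunc n (u t)) (err M n)"
  by (rule approx_sol_trunc) (use hsolD[OF u] M n in \<open>auto intro: hb_p4\<close>)

lemma A1_le: "hb W a A \<Longrightarrow> A1 n a \<le> sqrt (zsum * A)"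
  by (intro A1_bound hb_p4)

lemma gal_energy:
  assumes v0: "herm v0" "v0 0 = 0" and V: "weight q V" and B: "hb V v0 B" and t: "0 \<le> t" and K: "0 \<le> K"
    and A: "\<And>\<tau>. 0 < \<tau> \<Longrightarrow> \<tau> < t \<Longrightarrow> A1 n (gal \<gamma> v0 n \<tau>) \<le> K" and tS: "t \<le> S"
  shows "hb V (gal \<gamma> v0 n t) (exp (2 * pi * comm_const q * K * S) * B)"
proof -
  have "en V n (gal \<gamma> v0 n t) \<le> exp (2 * pi * comm_const q * K * t) * en V n (gal \<gamma> v0 n 0)"
    by (rule approx_sol_energy[OF approx_sol_gal[OF v0] V t A])
  also have "en V n (gal \<gamma> v0 n 0) = en V n v0" by (simp add: gal_0[OF v0])
  also have "exp (2 * pi * comm_const q * K * t) * en V n v0 \<le> exp (2 * pi * comm_const q * K * S) * B"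
    using comm_const_pos[of q] tS K weight_nonneg[OF V]
    by (intro mult_mono hb_en[OF B]) (auto simp: en_def intro!: sum_nonneg mult_left_mono)
  finally have "en V n (gal \<gamma> v0 n t) \<le> exp (2 * pi * comm_const q * K * S) * B" .
  then show ?thesis
    by (rule hb_le[OF supp_hb_en[OF gal_supp[OF v0 t] weight_nonneg[OF V]]])
qed

text \<open>Truncations of both solutions are compared at level \<open>n\<close>. The bound for
  \<open>v\<close> only enters its consistency error, which disappears as \<open>n\<close> tends to
  infinity; the exponential rate depends on the bound for \<open>u\<close> alone.\<close>

lemma hsol_uniq_dep:
  assumes u: "hsol \<gamma> W S u" and v: "hsol \<gamma> W S v" and M: "\<And>t. t \<in> {0..S} \<Longrightarrow> hb W (u t) M"
    and D: "hb (\<lambda>_. 1) (\<lambda>k. u 0 k - v 0 k) D" and t: "t \<in> {0..S}"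
  shows "hb (\<lambda>_. 1) (\<lambda>k. u t k - v t k) (exp ((2 * pi * sqrt (zsum * M) + 1) * S) * D)"
proof -
  obtain M' where M': "\<And>t. t \<in> {0..S} \<Longrightarrow> hb W (v t) M'" using hsol_M[OF v] by blast
  have M0: "0 \<le> M" using hb_bound_nonneg[OF M[OF t]] .
  let ?E = "exp ((2 * pi * sqrt (zsum * M) + 1) * S)"
  have en_le: "en (\<lambda>_. 1) n (\<lambda>k. u t k - v t k) \<le> ?E * (D + 2 * (err M n + err M' n))" if n: "1 \<le> n" for n
  proof -
    have "en (\<lambda>_. 1) n (\<lambda>k. trunc n (u t) k - trunc n (v t) k)
      \<le> exp ((2 * pi * sqrt (zsum * M) + 1) * t) * (en (\<lambda>_. 1) n (\<lambda>k. trunc n (u 0) k - trunc n (v 0) k) + 2 * (err M n + err M' n))"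
    proof (rule approx_sol_diff)
      show "approx_sol \<gamma> n t (\<lambda>t. trunc n (u t)) (err M n)" "approx_sol \<gamma> n t (\<lambda>t. trunc n (v t)) (err M' n)"
        using t by (auto intro!: approx_sol_subset[OF hsol_approx[OF u M n]] approx_sol_subset[OF hsol_approx[OF v M' n]])
      show "A1 n (trunc n (u \<tau>)) \<le> sqrt (zsum * M)" if "0 < \<tau>" "\<tau> < t" for \<tau>
        using that t by (simp add: A1_le[OF M])
    qed (use t M0 zsum_nonneg in \<open>auto simp: err_nonneg\<close>)
    also have "en (\<lambda>_. 1) n (\<lambda>k. trunc n (u 0) k - trunc n (v 0) k) \<le> D"
      using hb_en[OF D, of n] by (simp add: en_def trunc_def)
    also have "exp ((2 * pi * sqrt (zsum * M) + 1) * t) * (D + 2 * (err M n + err M' n)) \<le> ?E * (D + 2 * (err M n + err M' n))"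
      using t M0 zsum_nonneg hb_bound_nonneg[OF D]
      by (intro mult_right_mono) (auto simp: err_nonneg intro!: mult_left_mono add_nonneg_nonneg)
    finally show ?thesis by (simp add: en_def trunc_def)
  qed
  have lim: "(\<lambda>n. ?E * (D + 2 * (err M n + err M' n))) \<longlonglongrightarrow> ?E * (D + 2 * (0 + 0))"
    unfolding err_def by (intro tendsto_intros const_over_n_sq)
  show ?thesis
    unfolding hb_def
  proof safe
    fix K :: "int set" assume K: "finite K"
    obtain m where m: "K \<subseteq> band m" using finite_subset_band[OF K] by blast
    have "(\<Sum>k\<in>K. 1 * (cmod (u t k - v t k))\<^sup>2) \<le> ?E * (D + 2 * (0 + 0))"
    proof (rule tendsto_lowerbound[OF lim])
      show "\<forall>\<^sub>F n in sequentially. (\<Sum>k\<in>K. 1 * (cmod (u t k - v t k))\<^sup>2) \<le> ?E * (D + 2 * (err M n + err M' n))"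
      proof (rule eventually_sequentiallyI[of "max 1 m"])
        fix n assume n: "max 1 m \<le> n"
        have "(\<Sum>k\<in>K. 1 * (cmod (u t k - v t k))\<^sup>2) \<le> en (\<lambda>_. 1) n (\<lambda>k. u t k - v t k)"
          unfolding en_def using m band_mono[of m n] n by (intro sum_mono2) auto
        with en_le[of n] n show "(\<Sum>k\<in>K. 1 * (cmod (u t k - v t k))\<^sup>2) \<le> ?E * (D + 2 * (err M n + err M' n))" by simp
      qed
    qed auto
    then show "(\<Sum>k\<in>K. 1 * (cmod (u t k - v t k))\<^sup>2) \<le> ?E * D" by simp
  qed
qed

lemma hsol_unique:
  assumes u: "hsol \<gamma> W S u" and v: "hsol \<gamma> W S v" and 0: "u 0 = v 0" and t: "t \<in> {0..S}"
  shows "u t = v t"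
proof
  fix k
  obtain M where M: "\<And>t. t \<in> {0..S} \<Longrightarrow> hb W (u t) M" using hsol_M[OF u] by blast
  have "hb (\<lambda>_. 1) (\<lambda>k. u 0 k - v 0 k) 0" by (simp add: 0 hb_def)
  from hb_single[OF hsol_uniq_dep[OF u v M this t], of k] show "u t k = v t k" by simp
qed

text \<open>Level \<open>n\<close> is read as an approximate solution at level \<open>m\<close> and
  compared with the exact one there. Initial truncation and consistency error are both of order
  \<open>1 / n^2\<close>.\<close>

lemma galerkin_cauchy:
  assumes v0: "herm v0" "v0 0 = 0" and M: "\<And>n t. n \<ge> n0 \<Longrightarrow> t \<in> {0..S} \<Longrightarrow> hb W (gal \<gamma> v0 n t) M" and A: "hb W v0 A"
    and K: "\<And>n t. n \<ge> n0 \<Longrightarrow> t \<in> {0..S} \<Longrightarrow> A1 n (gal \<gamma> v0 n t) \<le> K" and K0: "0 \<le> K"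
    and nm: "n0 \<le> n" "1 \<le> n" "n \<le> m" and t: "t \<in> {0..S}"
  shows "hb (\<lambda>_. 1) (\<lambda>k. gal \<gamma> v0 n t k - gal \<gamma> v0 m t k)
     (exp ((2 * pi * K + 1) * S) * (A + 8 * pi\<^sup>2 * (alg_const 2 + alg_const 4) * M\<^sup>2) / (real n)\<^sup>2)"
proof -
  let ?E = "exp ((2 * pi * K + 1) * S)"
  have sn: "supp m (gal \<gamma> v0 n \<tau>)" if "0 \<le> \<tau>" for \<tau>
    using gal_supp[OF v0 that, of n \<gamma>] band_mono[OF nm(3)] by (auto simp: supp_def)
  have "en (\<lambda>_. 1) m (\<lambda>k. gal \<gamma> v0 n t k - gal \<gamma> v0 m t k)
    \<le> exp ((2 * pi * K + 1) * t) * (en (\<lambda>_. 1) m (\<lambda>k. gal \<gamma> v0 n 0 k - gal \<gamma> v0 m 0 k) + 2 * (err M n + 0))"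
  proof (rule approx_sol_diff)
    show "approx_sol \<gamma> m t (gal \<gamma> v0 n) (err M n)"
      using t nm by (intro approx_sol_gal_up v0 hb_p4 M) auto
    show "approx_sol \<gamma> m t (gal \<gamma> v0 m) 0" by (rule approx_sol_gal[OF v0])
    show "A1 m (gal \<gamma> v0 n \<tau>) \<le> K" if "0 < \<tau>" "\<tau> < t" for \<tau>
      using K[of n \<tau>] A1_supp_mono[OF gal_supp[OF v0] nm(3), of \<tau> \<gamma>] that t nm by auto
  qed (use t K0 in \<open>auto simp: err_nonneg\<close>)
  also have "en (\<lambda>_. 1) m (\<lambda>k. gal \<gamma> v0 n 0 k - gal \<gamma> v0 m 0 k) \<le> A / (real n)\<^sup>2"
  proof (rule hb_en)
    have a: "hb (\<lambda>k. (real_of_int k)\<^sup>2 * 1) v0 A" using hb_sq_p4[OF hb_p4[OF A]] by simp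
    have "hb (\<lambda>_. 1) (\<lambda>k. if k \<in> band n then 0 else v0 k) (A / (real n)\<^sup>2)"
      by (rule hb_tail[OF a nm(2)]) auto
    then show "hb (\<lambda>_. 1) (\<lambda>k. gal \<gamma> v0 n 0 k - gal \<gamma> v0 m 0 k) (A / (real n)\<^sup>2)"
      by (rule hb_mono) (use nm band_mono[OF nm(3)] in \<open>auto simp: gal_0[OF v0] trunc_def\<close>)
  qed
  also have "exp ((2 * pi * K + 1) * t) * (A / (real n)\<^sup>2 + 2 * (err M n + 0)) \<le> ?E * (A / (real n)\<^sup>2 + 2 * (err M n + 0))"
    using t K0 hb_bound_nonneg[OF A] by (intro mult_right_mono) (auto simp: err_nonneg intro!: mult_left_mono add_nonneg_nonneg)
  also have "\<dots> = ?E * (A + 8 * pi\<^sup>2 * (alg_const 2 + alg_const 4) * M\<^sup>2) / (real n)\<^sup>2"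
    using nm by (simp add: err_def field_simps)
  finally show ?thesis
    by (rule hb_le[OF supp_hb_en, rotated 2])
       (use sn[of t] gal_supp[OF v0, of t m \<gamma>] t in \<open>auto simp: supp_def\<close>)
qed

text \<open>The energy bound is stated for every weight, with the same \<open>K\<close>, because it
  will be applied to all tail weights of the limit. Bounds are only assumed from level
  \<open>n0\<close> on, since \<open>persistence\<close> provides no more.\<close>

lemma galerkin_limit:
  assumes v0: "herm v0" "v0 0 = 0" and A: "hb W v0 A" and S: "0 \<le> S" and K0: "0 \<le> K"
    and K: "\<And>n t. n \<ge> n0 \<Longrightarrow> t \<in> {0..S} \<Longrightarrow> A1 n (gal \<gamma> v0 n t) \<le> K"
  shows "\<exists>v. hsol \<gamma> W S v \<and> v 0 = v0 \<and>
    (\<forall>V q B t. weight q V \<longrightarrow> hb V v0 B \<longrightarrow> t \<in> {0..S} \<longrightarrow> hb V (v t) (exp (2 * pi * comm_const q * K * S) * B))"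
proof -
  define M where "M = exp (2 * pi * comm_const p * K * S) * A"
  have E: "hb V (gal \<gamma> v0 n t) (exp (2 * pi * comm_const q * K * S) * B)"
    if "weight q V" "hb V v0 B" "n0 \<le> n" "t \<in> {0..S}" for q V B n t
    using that K by (intro gal_energy[OF v0 that(1,2) _ K0]) auto
  have M: "hb W (gal \<gamma> v0 n t) M" if "n0 \<le> n" "t \<in> {0..S}" for n t
    unfolding M_def by (rule E[OF W A that])
  define R where "R = exp ((2 * pi * K + 1) * S) * (A + 8 * pi\<^sup>2 * (alg_const 2 + alg_const 4) * M\<^sup>2)"
  have cau: "hb (\<lambda>_. 1) (\<lambda>k. gal \<gamma> v0 n t k - gal \<gamma> v0 m t k) (R / (real n)\<^sup>2)"
    if "n0 \<le> n" "1 \<le> n" "n \<le> m" "t \<in> {0..S}" for n m t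
    unfolding R_def using that by (intro galerkin_cauchy[OF v0 M A K K0]) auto
  have R: "0 \<le> R" using hb_bound_nonneg[OF cau[of "max 1 n0" "max 1 n0" 0]] S
    by (simp add: zero_le_divide_iff)
  have dist: "cmod (gal \<gamma> v0 n t k - gal \<gamma> v0 m t k) \<le> sqrt R / real n"
    if "n0 \<le> n" "1 \<le> n" "n \<le> m" "t \<in> {0..S}" for n m t k
  proof -
    have "(cmod (gal \<gamma> v0 n t k - gal \<gamma> v0 m t k))\<^sup>2 \<le> R / (real n)\<^sup>2"
      using hb_single[OF cau[OF that], of k] by simp
    from real_le_rsqrt[OF this] show ?thesis by (simp add: real_sqrt_divide)
  qed
  have "\<exists>l. (\<lambda>n. gal \<gamma> v0 n t k) \<longlonglongrightarrow> l" if t: "t \<in> {0..S}" for t k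
  proof -
    have "Cauchy (\<lambda>n. gal \<gamma> v0 n t k)"
    proof (rule CauchyI')
      fix e :: real assume "0 < e"
      obtain N :: nat where N: "sqrt R / e < N" using reals_Archimedean2 by blast
      show "\<exists>N. \<forall>m\<ge>N. \<forall>n>m. dist (gal \<gamma> v0 m t k) (gal \<gamma> v0 n t k) < e"
      proof (intro exI allI impI)
        fix m n assume mn: "max (max n0 1) N \<le> m" "m < n"
        have "norm (gal \<gamma> v0 m t k - gal \<gamma> v0 n t k) \<le> sqrt R / real m" using mn t by (intro dist) auto
        also have "\<dots> < e"
        proof -
          have "sqrt R / e < m" using N mn by linarith
          then show ?thesis using \<open>0 < e\<close> mn by (simp add: field_simps)
        qed
        finally show "dist (gal \<gamma> v0 m t k) (gal \<gamma> v0 n t k) < e" unfolding dist_norm .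
      qed
    qed
    then show ?thesis by (simp add: Cauchy_convergent_iff convergent_def)
  qed
  then obtain v where v: "\<And>t k. t \<in> {0..S} \<Longrightarrow> (\<lambda>n. gal \<gamma> v0 n t k) \<longlonglongrightarrow> v t k"
    by metis
  have bnd: "hb V (v t) (exp (2 * pi * comm_const q * K * S) * B)"
    if "weight q V" "hb V v0 B" "t \<in> {0..S}" for q V B t
    by (rule hb_tendsto[OF v[OF that(3)]])
       (auto intro!: eventually_sequentiallyI[of n0] E that(1,2) simp: that(3)[simplified])
  have conv: "hb (\<lambda>_. 1) (\<lambda>k. gal \<gamma> v0 n t k - v t k) (R / (real n)\<^sup>2)"
    if "n0 \<le> n" "1 \<le> n" "t \<in> {0..S}" for n t
    by (rule hb_tendsto[of "\<lambda>m k. gal \<gamma> v0 n t k - gal \<gamma> v0 m t k" _ sequentially])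
       (auto intro!: tendsto_intros v eventually_sequentiallyI[of n] cau that simp: that(3)[simplified])
  have v_0: "v 0 = v0"
  proof
    fix k
    have "(\<lambda>n. gal \<gamma> v0 n 0 k) \<longlonglongrightarrow> v0 k"
      by (rule tendsto_eventually, rule eventually_sequentiallyI[of "nat \<bar>k\<bar>"])
         (auto simp: gal_0[OF v0] trunc_def band_iff)
    moreover have "(\<lambda>n. gal \<gamma> v0 n 0 k) \<longlonglongrightarrow> v 0 k" using S by (intro v) auto
    ultimately show "v 0 k = v0 k" by (metis LIMSEQ_unique)
  qed
  have v_h: "herm (v t)" if t: "t \<in> {0..S}" for t
    unfolding herm_def
  proof
    fix k
    have "(\<lambda>n. cnj (gal \<gamma> v0 n t k)) \<longlonglongrightarrow> v t (- k)"
      using v[OF t, of "- k"] gal_herm[OF v0, of t] t by (simp add: herm_def)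
    moreover have "(\<lambda>n. cnj (gal \<gamma> v0 n t k)) \<longlonglongrightarrow> cnj (v t k)" by (intro tendsto_intros v t)
    ultimately show "v t (- k) = cnj (v t k)" by (rule LIMSEQ_unique)
  qed
  have v_m: "v t 0 = 0" if t: "t \<in> {0..S}" for t
    using v[OF t, of 0] gal_mean[OF v0, of t] t by (simp add: LIMSEQ_const_iff)
  have der: "((\<lambda>t. v t k) has_vector_derivative ost \<gamma> (v t) k) (at t within {0..S})" if t: "t \<in> {0..S}" for t k
  proof -
    \<comment> \<open>From this level on the frequency \<open>k\<close> lies in the band, so that
      its equation is present, and the rate in \<open>conv\<close> is available.\<close>
    define N where "N = max (max n0 1) (nat \<bar>k\<bar>)"
    let ?C = "(2 * pi * \<bar>real_of_int k\<bar> * sqrt M + \<bar>\<gamma> / (2 * pi * k)\<bar>) * sqrt R"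
    \<comment> \<open>For fixed \<open>k\<close> the derivatives converge uniformly in time by
      \<open>ost_diff_bound\<close>, so the limit may be differentiated termwise.\<close>
    have "\<exists>g. \<forall>x\<in>{0..S}. (\<lambda>n. gal \<gamma> v0 (n + N) x k) \<longlonglongrightarrow> g x \<and> (g has_derivative (\<lambda>h. h *\<^sub>R ost \<gamma> (v x) k)) (at x within {0..S})"
    proof (rule has_derivative_sequence[where f = "\<lambda>n x. gal \<gamma> v0 (n + N) x k" and f' = "\<lambda>n x h. h *\<^sub>R ost \<gamma> (gal \<gamma> v0 (n + N) x) k"])
      show "convex {0..S}" by simp
      show "((\<lambda>x. gal \<gamma> v0 (n + N) x k) has_derivative (\<lambda>h. h *\<^sub>R ost \<gamma> (gal \<gamma> v0 (n + N) x) k)) (at x within {0..S})"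
        if "x \<in> {0..S}" for n x
      proof -
        have "k \<in> band (n + N)" by (auto simp: band_iff N_def)
        then have "((\<lambda>x. gal \<gamma> v0 (n + N) x k) has_vector_derivative ost \<gamma> (gal \<gamma> v0 (n + N) x) k) (at x within {0..})"
          using gal_deriv[OF v0, of x \<gamma> "n + N" k] that by simp
        then show ?thesis unfolding has_vector_derivative_def by (rule has_derivative_subset) auto
      qed
      show "\<forall>\<^sub>F n in sequentially. \<forall>x\<in>{0..S}. \<forall>h. norm (h *\<^sub>R ost \<gamma> (gal \<gamma> v0 (n + N) x) k - h *\<^sub>R ost \<gamma> (v x) k) \<le> e * norm h"
        if "0 < e" for e
      proof -
        have "(\<lambda>n. ?C / real (n + N)) \<longlonglongrightarrow> 0" by (rule LIMSEQ_ignore_initial_segment[OF lim_const_over_n])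
        then have "\<forall>\<^sub>F n in sequentially. ?C / real (n + N) < e" using that by (rule order_tendstoD)
        then show ?thesis
        proof eventually_elim
          case (elim n)
          show ?case
          proof (intro ballI allI)
            fix x h assume x: "x \<in> {0..S}"
            have n: "n0 \<le> n + N" "1 \<le> n + N" by (auto simp: N_def)
            have "cmod (ost \<gamma> (gal \<gamma> v0 (n + N) x) k - ost \<gamma> (v x) k)
              \<le> (2 * pi * \<bar>real_of_int k\<bar> * sqrt M + \<bar>\<gamma> / (2 * pi * k)\<bar>) * sqrt (R / (real (n + N))\<^sup>2)"
              using x n gal_mean[OF v0, of x] v_m[OF x] bnd[OF W A x]
              by (intro ost_diff_bound conv hb_1 M) (auto simp: M_def)
            also have "\<dots> = ?C / real (n + N)" by (simp add: real_sqrt_divide)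
            finally have "cmod (ost \<gamma> (gal \<gamma> v0 (n + N) x) k - ost \<gamma> (v x) k) \<le> e" using elim by simp
            from mult_left_mono[OF this abs_ge_zero[of h]]
            show "norm (h *\<^sub>R ost \<gamma> (gal \<gamma> v0 (n + N) x) k - h *\<^sub>R ost \<gamma> (v x) k) \<le> e * norm h"
              by (simp add: scaleR_diff_right[symmetric] mult.commute)
          qed
        qed
      qed
      show "0 \<in> {0..S}" using S by simp
      show "(\<lambda>n. gal \<gamma> v0 (n + N) 0 k) \<longlonglongrightarrow> v 0 k" using S by (intro LIMSEQ_ignore_initial_segment v) auto
    qed
    then obtain g where g: "\<And>x. x \<in> {0..S} \<Longrightarrow> (\<lambda>n. gal \<gamma> v0 (n + N) x k) \<longlonglongrightarrow> g x"
      "\<And>x. x \<in> {0..S} \<Longrightarrow> (g has_derivative (\<lambda>h. h *\<^sub>R ost \<gamma> (v x) k)) (at x within {0..S})" by blast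
    have "g x = v x k" if "x \<in> {0..S}" for x
      using LIMSEQ_unique[OF g(1)[OF that] LIMSEQ_ignore_initial_segment[OF v[OF that]]] .
    then show ?thesis unfolding has_vector_derivative_def
      using g(2)[OF t] has_derivative_transform[OF t, of "\<lambda>t. v t k" g] by simp
  qed
  have "hsol \<gamma> W S v"
    unfolding hsol_def
  proof (intro conjI ballI allI)
    show "herm (v t)" "v t 0 = 0" if "t \<in> {0..S}" for t using that v_h v_m by auto
    show "\<exists>M. \<forall>t\<in>{0..S}. hb W (v t) M" using bnd[OF W A] by blast
    show "continuous_on {0..S} (\<lambda>t. v t k)" for k by (rule continuous_on_vector_derivative[OF der])
    show "((\<lambda>t. v t k) has_vector_derivative ost \<gamma> (v t) k) (at t)" if "t \<in> {0<..<S}" for t k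
    proof -
      have "at t within {0..S} = at t" using that by (intro at_within_interior) auto
      then show ?thesis using der[of t k] that by simp
    qed
  qed
  then show ?thesis using v_0 bnd by blast
qed

section \<open>Local existence, persistence of nearby solutions and continuity in the weighted
  norm\<close>

lemma local_existence:
  assumes v0: "herm v0" "v0 0 = 0" and A: "hb W v0 A"
  shows "\<exists>S>0. \<exists>v. hsol \<gamma> W S v \<and> v 0 = v0"
proof -
  have A0: "0 \<le> A" by (rule hb_bound_nonneg[OF A])
  \<comment> \<open>If the energy grows at most fourfold, \<open>A1\<close> is at most
    \<open>2 * sqrt (zsum * A)\<close>; the added 1 makes the bootstrap strict.\<close>
  define K where "K = 2 * sqrt (zsum * A) + 1"
  have K: "0 < K" using A0 zsum_nonneg by (simp add: K_def add_nonneg_pos)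
  \<comment> \<open>Makes the exponent in the energy estimate equal to 1, and \<open>exp 1\<close>
    is at most 4.\<close>
  define S where "S = 1 / (2 * pi * comm_const p * K)"
  have S: "0 < S" using K comm_const_pos[of p] by (simp add: S_def)
  have ES: "exp (2 * pi * comm_const p * K * S) \<le> 4"
    using K comm_const_pos[of p] exp_le by (simp add: S_def)
  have "A1 n (gal \<gamma> v0 n t) < K" if t: "t \<in> {0..S}" for n t
  proof (rule bootstrap[OF _ _ t, where f = "\<lambda>t. A1 n (gal \<gamma> v0 n t)"])
    show "continuous_on {0..S} (\<lambda>t. A1 n (gal \<gamma> v0 n t))" by (intro continuous_on_A1 gal_continuous v0)
    fix t assume t: "t \<in> {0..S}" and le: "\<And>\<tau>. 0 < \<tau> \<Longrightarrow> \<tau> < t \<Longrightarrow> A1 n (gal \<gamma> v0 n \<tau>) \<le> K"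
    have "hb W (gal \<gamma> v0 n t) (exp (2 * pi * comm_const p * K * S) * A)"
      using t K by (intro gal_energy[OF v0 W A _ _ le]) auto
    then have "hb W (gal \<gamma> v0 n t) (4 * A)" using mult_right_mono[OF ES A0] by (rule hb_le)
    from A1_le[OF this, of n] show "A1 n (gal \<gamma> v0 n t) < K"
      by (simp add: K_def real_sqrt_mult)
  qed
  then have le: "A1 n (gal \<gamma> v0 n t) \<le> K" if "t \<in> {0..S}" for n t using less_imp_le that by blast
  have "\<exists>v. hsol \<gamma> W S v \<and> v 0 = v0 \<and>
    (\<forall>V q B t. weight q V \<longrightarrow> hb V v0 B \<longrightarrow> t \<in> {0..S} \<longrightarrow> hb V (v t) (exp (2 * pi * comm_const q * K * S) * B))"
    by (rule galerkin_limit[OF v0 A, where ?n0.0 = 0]) (use S K le in auto)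
  then obtain v where "hsol \<gamma> W S v" "v 0 = v0" by (elim exE conjE)
  then show ?thesis using S by blast
qed

text \<open>Bootstrap for Galerkin solutions of nearby data on the whole interval of
  \<open>u\<close>. While \<open>A1\<close> is below \<open>K\<close>, the energy stays bounded by
  \<open>M2\<close>; the \<open>L^2\<close> distance to \<open>u\<close> is small by stability, and
  \<open>A1_small\<close> turns both into an improved bound for \<open>A1\<close>.\<close>

lemma persistence:
  assumes u: "hsol \<gamma> W S u" and S: "0 \<le> S"
  shows "\<exists>\<delta>>0. \<exists>K\<ge>0. \<forall>v0. herm v0 \<and> v0 0 = 0 \<and> hb W (\<lambda>k. v0 k - u 0 k) \<delta> \<longrightarrow>
    (\<exists>n0. \<forall>n\<ge>n0. \<forall>t\<in>{0..S}. A1 n (gal \<gamma> v0 n t) \<le> K)"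
proof -
  obtain M where M: "\<And>t. t \<in> {0..S} \<Longrightarrow> hb W (u t) M" using hsol_M[OF u] by blast
  have M0: "0 \<le> M" using hb_bound_nonneg[OF M[of 0]] S by simp
  define K0 where "K0 = sqrt (zsum * M)"
  have K0: "0 \<le> K0" using M0 zsum_nonneg by (simp add: K0_def)
  \<comment> \<open>The allowance 1 above the bound \<open>K0\<close> for \<open>u\<close> exceeds
    the deviation 1/2 that is actually proved.\<close>
  define K where "K = K0 + 1"
  have K: "0 \<le> K" using K0 by (simp add: K_def)
  \<comment> \<open>Data within \<delta> \<le> 1 of \<open>u 0\<close> have squared norm at most
    \<open>2 * 1 + 2 * M\<close>, and the exponential is the growth allowed while \<open>A1\<close>
    is below \<open>K\<close>.\<close>
  define M2 where "M2 = exp (2 * pi * comm_const p * K * S) * (2 * 1 + 2 * M)"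
  have M2: "0 \<le> M2" using M0 by (simp add: M2_def)
  obtain \<eta> where \<eta>: "0 < \<eta>" "\<And>n d. hb (\<lambda>k. (real_of_int k) ^ 4) d (2 * M + 2 * M2) \<Longrightarrow> hb (\<lambda>_. 1) d \<eta> \<Longrightarrow> A1 n d \<le> 1 / 2"
    using A1_small[of "1 / 2" "2 * M + 2 * M2"] M0 M2 by auto
  define E where "E = exp ((2 * pi * K0 + 1) * S)"
  have E: "0 < E" by (simp add: E_def)
  define \<delta> where "\<delta> = min 1 (\<eta> / (2 * E))"
  have \<delta>: "0 < \<delta>" "\<delta> \<le> 1" "E * \<delta> \<le> \<eta> / 2"
  proof -
    show "0 < \<delta>" "\<delta> \<le> 1" using \<eta>(1) E by (auto simp: \<delta>_def)
    have "E * \<delta> \<le> E * (\<eta> / (2 * E))" using E by (intro mult_left_mono) (auto simp: \<delta>_def)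
    then show "E * \<delta> \<le> \<eta> / 2" using E by simp
  qed
  have "(\<lambda>n. E * (2 * err M n)) \<longlonglongrightarrow> E * (2 * 0)"
    unfolding err_def by (intro tendsto_intros const_over_n_sq)
  then have "\<forall>\<^sub>F n in sequentially. E * (2 * err M n) < \<eta> / 2" using \<eta>(1) by (intro order_tendstoD) auto
  then obtain n0 where n0: "\<And>n. n0 \<le> n \<Longrightarrow> E * (2 * err M n) < \<eta> / 2" by (auto simp: eventually_sequentially)
  have "A1 n (gal \<gamma> v0 n t) < K"
    if v0: "herm v0" "v0 0 = 0" and d: "hb W (\<lambda>k. v0 k - u 0 k) \<delta>" and n: "max n0 1 \<le> n" and t: "t \<in> {0..S}" for v0 n t
  proof (rule bootstrap[OF _ _ t, where f = "\<lambda>t. A1 n (gal \<gamma> v0 n t)"])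
    show "continuous_on {0..S} (\<lambda>t. A1 n (gal \<gamma> v0 n t))" by (intro continuous_on_A1 gal_continuous v0)
    fix t assume t: "t \<in> {0..S}" and le: "\<And>\<tau>. 0 < \<tau> \<Longrightarrow> \<tau> < t \<Longrightarrow> A1 n (gal \<gamma> v0 n \<tau>) \<le> K"
    have u0: "u 0 0 = 0" using hsolD(2)[OF u, of 0] S by simp
    have "hb W (\<lambda>k. (v0 k - u 0 k) + u 0 k) (2 * \<delta> + 2 * M)" by (rule hb_add[OF d M W_nonneg]) (use S in auto)
    then have "hb W v0 (2 * \<delta> + 2 * M)" by simp
    then have "hb W v0 (2 * 1 + 2 * M)" by (rule hb_le) (use \<delta>(2) in simp)
    then have h: "hb W (gal \<gamma> v0 n t) M2"
      unfolding M2_def using t K by (intro gal_energy[OF v0 W _ _ _ le]) auto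
    let ?d = "\<lambda>k. trunc n (u t) k - gal \<gamma> v0 n t k"
    have "hb W ?d (2 * M + 2 * M2)" using M[OF t] h by (intro hb_diff hb_trunc W_nonneg)
    moreover have "hb (\<lambda>_. 1) ?d \<eta>"
    proof (rule hb_le[OF supp_hb_en])
      show "supp n ?d" using gal_supp[OF v0, of t n \<gamma>] t by (auto simp: supp_def trunc_def)
      \<comment> \<open>The rate involves \<open>K0\<close>, the bound for \<open>u\<close>, rather
        than the bound that is being bootstrapped, so \<delta> could be fixed in advance.\<close>
      have "en (\<lambda>_. 1) n ?d \<le> exp ((2 * pi * K0 + 1) * t) * (en (\<lambda>_. 1) n (\<lambda>k. trunc n (u 0) k - gal \<gamma> v0 n 0 k) + 2 * (err M n + 0))"
      proof (rule approx_sol_diff)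
        show "approx_sol \<gamma> n t (\<lambda>t. trunc n (u t)) (err M n)"
          using t n by (intro approx_sol_subset[OF hsol_approx[OF u M]]) auto
        show "approx_sol \<gamma> n t (gal \<gamma> v0 n) 0" by (rule approx_sol_gal[OF v0])
        show "A1 n (trunc n (u \<tau>)) \<le> K0" if "0 < \<tau>" "\<tau> < t" for \<tau>
          using that t by (simp add: K0_def A1_le[OF M])
      qed (use t K0 in \<open>auto simp: err_nonneg\<close>)
      also have "\<dots> \<le> E * (\<delta> + 2 * (err M n + 0))"
      proof -
        have "hb (\<lambda>_. 1) (\<lambda>k. v0 k - u 0 k) \<delta>" using u0 v0 by (intro hb_1[OF d]) auto
        from hb_en[OF this, of n] have "en (\<lambda>_. 1) n (\<lambda>k. trunc n (u 0) k - gal \<gamma> v0 n 0 k) \<le> \<delta>"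
          by (simp add: gal_0[OF v0] en_def trunc_def norm_minus_commute)
        then show ?thesis
          unfolding E_def using t K0 \<delta>
          by (intro mult_mono add_mono order_refl) (auto simp: err_nonneg en_def intro!: mult_left_mono add_nonneg_nonneg sum_nonneg)
      qed
      also have "\<dots> = E * \<delta> + E * (2 * err M n)" by (simp add: algebra_simps)
      also have "\<dots> \<le> \<eta>" using \<delta>(3) n0[of n] n by simp
      finally show "en (\<lambda>_. 1) n ?d \<le> \<eta>" .
    qed simp
    ultimately have "A1 n ?d \<le> 1 / 2" by (intro \<eta>(2) hb_p4)
    moreover have "A1 n (trunc n (u t)) \<le> K0" by (simp add: K0_def A1_le[OF M[OF t]])
    ultimately show "A1 n (gal \<gamma> v0 n t) < K" using A1_triangle[of n "gal \<gamma> v0 n t" "trunc n (u t)"] by (simp add: K_def)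
  qed
  then show ?thesis
    by (intro exI[of _ \<delta>] exI[of _ K] conjI \<delta>(1) K allI impI) (auto intro!: exI[of _ "max n0 1"] less_imp_le)
qed

text \<open>The constant is the same for all \<open>N\<close> and all nearby \<open>v0\<close>,
  because every \<open>VN N\<close> has growth exponent \<open>p + 1\<close> and \<open>K\<close>
  comes from \<open>persistence\<close>.\<close>

lemma dependence_bounds:
  assumes u: "hsol \<gamma> W S u" and S: "0 \<le> S"
  shows "\<exists>\<delta>>0. \<exists>C\<ge>0. \<forall>v0. herm v0 \<and> v0 0 = 0 \<and> hb W (\<lambda>k. v0 k - u 0 k) \<delta> \<longrightarrow>
    (\<exists>v. hsol \<gamma> W S v \<and> v 0 = v0 \<and> (\<forall>N B. 1 \<le> N \<longrightarrow> hb (VN N) v0 B \<longrightarrow> (\<forall>t\<in>{0..S}. hb (VN N) (v t) (C * B))))"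
proof -
  obtain \<delta> K where dK: "0 < \<delta>" "0 \<le> K" and
    P: "\<forall>v0. herm v0 \<and> v0 0 = 0 \<and> hb W (\<lambda>k. v0 k - u 0 k) \<delta> \<longrightarrow>
      (\<exists>n0. \<forall>n\<ge>n0. \<forall>t\<in>{0..S}. A1 n (gal \<gamma> v0 n t) \<le> K)"
    using persistence[OF u S] by (elim exE conjE) (rule that; assumption)
  obtain M where M: "\<And>t. t \<in> {0..S} \<Longrightarrow> hb W (u t) M" using hsol_M[OF u] by blast
  show ?thesis
  proof (rule exI[of _ \<delta>], intro conjI dK(1), rule exI[of _ "exp (2 * pi * comm_const (p + 1) * K * S)"], intro conjI allI impI)
    fix v0 assume v0: "herm v0 \<and> v0 0 = 0 \<and> hb W (\<lambda>k. v0 k - u 0 k) \<delta>"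
    from mp[OF spec[OF P] this] obtain n0 where "\<forall>n\<ge>n0. \<forall>t\<in>{0..S}. A1 n (gal \<gamma> v0 n t) \<le> K" by (elim exE)
    then have n0: "\<And>n t. n \<ge> n0 \<Longrightarrow> t \<in> {0..S} \<Longrightarrow> A1 n (gal \<gamma> v0 n t) \<le> K" by blast
    have "hb W (\<lambda>k. (v0 k - u 0 k) + u 0 k) (2 * \<delta> + 2 * M)"
      by (rule hb_add[OF _ M W_nonneg]) (use v0 S in auto)
    then have A: "hb W v0 (2 * \<delta> + 2 * M)" by simp
    have "\<exists>v. hsol \<gamma> W S v \<and> v 0 = v0 \<and>
      (\<forall>V q B t. weight q V \<longrightarrow> hb V v0 B \<longrightarrow> t \<in> {0..S} \<longrightarrow> hb V (v t) (exp (2 * pi * comm_const q * K * S) * B))"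
      by (rule galerkin_limit[OF _ _ A S dK(2) n0]) (use v0 in auto)
    then obtain v where v: "hsol \<gamma> W S v" "v 0 = v0"
      "\<forall>V q B t. weight q V \<longrightarrow> hb V v0 B \<longrightarrow> t \<in> {0..S} \<longrightarrow> hb V (v t) (exp (2 * pi * comm_const q * K * S) * B)"
      by (elim exE conjE)
    show "\<exists>v. hsol \<gamma> W S v \<and> v 0 = v0 \<and> (\<forall>N B. 1 \<le> N \<longrightarrow> hb (VN N) v0 B \<longrightarrow>
      (\<forall>t\<in>{0..S}. hb (VN N) (v t) (exp (2 * pi * comm_const (p + 1) * K * S) * B)))"
      by (intro exI[of _ v] conjI v(1,2) allI impI ballI v(3)[rule_format] weight_VN)
  qed simp
qed

text \<open>Tail estimates are known for Galerkin limits only. Applying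
  \<open>dependence_bounds\<close> to the datum of \<open>u\<close> itself produces such a limit,
  and uniqueness identifies it with \<open>u\<close>.\<close>

lemma hsol_tail_bound:
  assumes u: "hsol \<gamma> W S u" and S: "0 \<le> S"
  shows "\<exists>C\<ge>0. \<forall>N B t. 1 \<le> N \<longrightarrow> hb (VN N) (u 0) B \<longrightarrow> t \<in> {0..S} \<longrightarrow> hb (VN N) (u t) (C * B)"
proof -
  obtain \<delta> C where dC: "0 < \<delta>" "0 \<le> C" and
    P: "\<forall>v0. herm v0 \<and> v0 0 = 0 \<and> hb W (\<lambda>k. v0 k - u 0 k) \<delta> \<longrightarrow>
      (\<exists>v. hsol \<gamma> W S v \<and> v 0 = v0 \<and> (\<forall>N B. 1 \<le> N \<longrightarrow> hb (VN N) v0 B \<longrightarrow> (\<forall>t\<in>{0..S}. hb (VN N) (v t) (C * B))))"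
    using dependence_bounds[OF u S] by (elim exE conjE) (rule that; assumption)
  have "herm (u 0) \<and> u 0 0 = 0 \<and> hb W (\<lambda>k. u 0 k - u 0 k) \<delta>" using dC hsolD[OF u] S by (simp add: hb_def)
  from mp[OF spec[OF P] this] obtain v where v: "hsol \<gamma> W S v" "v 0 = u 0"
    "\<forall>N B. 1 \<le> N \<longrightarrow> hb (VN N) (u 0) B \<longrightarrow> (\<forall>t\<in>{0..S}. hb (VN N) (v t) (C * B))" by (elim exE conjE)
  have "v t = u t" if "t \<in> {0..S}" for t by (rule hsol_unique[OF v(1) u v(2) that])
  then have "hb (VN N) (u t) (C * B)" if "1 \<le> N" "hb (VN N) (u 0) B" "t \<in> {0..S}" for N B t using v(3) that by metis
  then show ?thesis using dC(2) by blast
qed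

text \<open>The order of choices matters: first the tail size \<eta>, then \<open>N\<close> from the
  datum of \<open>u\<close>, and only then \<delta>, which has to beat the factor \<open>W N\<close>
  lost in passing from \<open>L^2\<close> to the weighted norm on the low frequencies.\<close>

lemma continuous_dependence:
  assumes u: "hsol \<gamma> W S u" and S: "0 \<le> S" and \<epsilon>: "0 < \<epsilon>"
  shows "\<exists>\<delta>>0. \<forall>v0. herm v0 \<and> v0 0 = 0 \<and> hb W (\<lambda>k. v0 k - u 0 k) \<delta> \<longrightarrow>
    (\<exists>v. hsol \<gamma> W S v \<and> v 0 = v0 \<and> (\<forall>t\<in>{0..S}. hb W (\<lambda>k. v t k - u t k) \<epsilon>))"
proof -
  obtain \<delta>0 C where dC: "0 < \<delta>0" "0 \<le> C" and
    P: "\<forall>v0. herm v0 \<and> v0 0 = 0 \<and> hb W (\<lambda>k. v0 k - u 0 k) \<delta>0 \<longrightarrow>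
      (\<exists>v. hsol \<gamma> W S v \<and> v 0 = v0 \<and> (\<forall>N B. 1 \<le> N \<longrightarrow> hb (VN N) v0 B \<longrightarrow> (\<forall>t\<in>{0..S}. hb (VN N) (v t) (C * B))))"
    using dependence_bounds[OF u S] by (elim exE conjE) (rule that; assumption)
  obtain M where M: "\<And>t. t \<in> {0..S} \<Longrightarrow> hb W (u t) M" using hsol_M[OF u] by blast
  have u0: "u 0 0 = 0" using hsolD(2)[OF u, of 0] S by simp
  obtain C' where C': "0 \<le> C'" and ub: "\<And>N B t. 1 \<le> N \<Longrightarrow> hb (VN N) (u 0) B \<Longrightarrow> t \<in> {0..S} \<Longrightarrow> hb (VN N) (u t) (C' * B)"
    using hsol_tail_bound[OF u S] by metis
  define E where "E = exp ((2 * pi * sqrt (zsum * M) + 1) * S)"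
  have E: "0 < E" by (simp add: E_def)
  \<comment> \<open>The tails of both solutions will add up to at most
    \<open>10 * (C + C' + 1) * \<eta>\<close>, that is 10/24 of \<epsilon>.\<close>
  define \<eta> where "\<eta> = \<epsilon> / (24 * (C + C' + 1))"
  have \<eta>: "0 < \<eta>" using \<epsilon> dC C' by (simp add: \<eta>_def)
  obtain N where N: "1 \<le> N" "hb (VN N) (u 0) \<eta>" using hb_VN_small[OF M[of 0] \<eta>] S by auto
  define \<delta> where "\<delta> = min (min \<delta>0 \<eta>) (\<epsilon> / (2 * E * (W N + 1)))"
  have WN: "0 \<le> W N" by (rule W_nonneg)
  have \<delta>: "0 < \<delta>" "\<delta> \<le> \<delta>0" "\<delta> \<le> \<eta>" "W N * (E * \<delta>) \<le> \<epsilon> / 2"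
  proof -
    have pos: "0 < 2 * E * (W N + 1)" using E WN by simp
    show "0 < \<delta>" "\<delta> \<le> \<delta>0" "\<delta> \<le> \<eta>" using dC \<eta> \<epsilon> pos by (auto simp: \<delta>_def)
    have "W N * (E * \<delta>) \<le> (W N + 1) * (E * (\<epsilon> / (2 * E * (W N + 1))))"
      using E WN \<open>0 < \<delta>\<close> by (intro mult_mono mult_left_mono) (auto simp: \<delta>_def)
    also have "\<dots> = \<epsilon> / 2"
    proof -
      have "x * (E * (\<epsilon> / (2 * E * x))) = \<epsilon> / 2" if "0 < x" for x using that E by simp
      then show ?thesis using WN by simp
    qed
    finally show "W N * (E * \<delta>) \<le> \<epsilon> / 2" .
  qed
  show ?thesis
  proof (rule exI[of _ \<delta>], intro conjI \<delta>(1) allI impI)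
    fix v0 assume v0: "herm v0 \<and> v0 0 = 0 \<and> hb W (\<lambda>k. v0 k - u 0 k) \<delta>"
    then have "herm v0 \<and> v0 0 = 0 \<and> hb W (\<lambda>k. v0 k - u 0 k) \<delta>0" using hb_le[OF _ \<delta>(2)] by simp
    from mp[OF spec[OF P] this] obtain v where v: "hsol \<gamma> W S v" "v 0 = v0"
      "\<forall>N B. 1 \<le> N \<longrightarrow> hb (VN N) v0 B \<longrightarrow> (\<forall>t\<in>{0..S}. hb (VN N) (v t) (C * B))"
      by (elim exE conjE)
    \<comment> \<open>The filtered norm of nearby data is small for the same \<open>N\<close>,
      because their distance to \<open>u 0\<close> is controlled in the full norm.\<close>
    have "hb (VN N) (\<lambda>k. (v0 k - u 0 k) + u 0 k) (2 * \<delta> + 2 * \<eta>)"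
      by (rule hb_add[OF hb_VN N(2) VN_nonneg]) (use v0 in simp)
    then have "hb (VN N) v0 (2 * \<delta> + 2 * \<eta>)" by simp
    then have "hb (VN N) v0 (4 * \<eta>)" by (rule hb_le) (use \<delta>(3) in simp)
    then have vb: "hb (VN N) (v t) (C * (4 * \<eta>))" if "t \<in> {0..S}" for t using v(3) N(1) that by blast
    have "hb W (\<lambda>k. v t k - u t k) \<epsilon>" if t: "t \<in> {0..S}" for t
    proof -
      let ?d = "\<lambda>k. v t k - u t k"
      have "hb (VN N) ?d (2 * (C * (4 * \<eta>)) + 2 * (C' * \<eta>))"
        by (intro hb_diff VN_nonneg vb t ub N)
      then have 1: "hb W ?d (en W N ?d + (2 * (C * (4 * \<eta>)) + 2 * (C' * \<eta>)))" by (rule hb_split[OF N(1)])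
      have "hb (\<lambda>_. 1) (\<lambda>k. u 0 k - v 0 k) \<delta>"
      proof -
        have "hb (\<lambda>_. 1) (\<lambda>k. v0 k - u 0 k) \<delta>" using v0 u0 by (intro hb_1) auto
        then show ?thesis by (simp add: hb_def v(2) norm_minus_commute)
      qed
      from hsol_uniq_dep[OF u v(1) M this t] have "hb (\<lambda>_. 1) (\<lambda>k. u t k - v t k) (E * \<delta>)" by (simp add: E_def)
      then have "hb (\<lambda>_. 1) ?d (E * \<delta>)" by (simp add: hb_def norm_minus_commute)
      then have "en W N ?d \<le> W N * (E * \<delta>)" using en_le_W[of N ?d] mult_left_mono[OF hb_en WN] by (meson order_trans)
      moreover have "2 * (C * (4 * \<eta>)) + 2 * (C' * \<eta>) \<le> \<epsilon> / 2"
      proof -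
        have "2 * (C * (4 * \<eta>)) + 2 * (C' * \<eta>) = 8 * (C * \<eta>) + 2 * (C' * \<eta>)" by simp
        also have "\<dots> \<le> 8 * ((C + C' + 1) * \<eta>) + 2 * ((C + C' + 1) * \<eta>)"
          using \<eta> dC C' by (intro add_mono mult_left_mono mult_right_mono) auto
        also have "\<dots> = 10 / 24 * \<epsilon>"
        proof -
          have "x * (\<epsilon> / (24 * x)) = \<epsilon> / 24" if "0 < x" for x using that by simp
          from this[of "C + C' + 1"] have "(C + C' + 1) * \<eta> = \<epsilon> / 24" using dC C' unfolding \<eta>_def by linarith
          then show ?thesis by (simp only:)
        qed
        also have "\<dots> \<le> \<epsilon> / 2" using \<epsilon> by simp
        finally show ?thesis by simp
      qed
      ultimately show ?thesis using \<delta>(4) by (intro hb_le[OF 1]) simp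
    qed
    then show "\<exists>v. hsol \<gamma> W S v \<and> v 0 = v0 \<and> (\<forall>t\<in>{0..S}. hb W (\<lambda>k. v t k - u t k) \<epsilon>)" using v by blast
  qed
qed

text \<open>Each coefficient is continuous in time and the tails are uniformly small in time;
  together this upgrades coefficientwise continuity to continuity in norm.\<close>

lemma hsol_continuous:
  assumes u: "hsol \<gamma> W S u" and t: "t \<in> {0..S}" and \<epsilon>: "0 < \<epsilon>"
  shows "\<forall>\<^sub>F \<tau> in at t within {0..S}. hb W (\<lambda>k. u \<tau> k - u t k) \<epsilon>"
proof -
  have S: "0 \<le> S" using t by simp
  obtain C where C: "0 \<le> C" and ub: "\<And>N B t. 1 \<le> N \<Longrightarrow> hb (VN N) (u 0) B \<Longrightarrow> t \<in> {0..S} \<Longrightarrow> hb (VN N) (u t) (C * B)"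
    using hsol_tail_bound[OF u S] by metis
  obtain M where M: "\<And>t. t \<in> {0..S} \<Longrightarrow> hb W (u t) M" using hsol_M[OF u] by blast
  \<comment> \<open>The tail of a difference of two times is at most
    \<open>4 * (C * \<eta>)\<close>, hence at most \<epsilon>/2.\<close>
  define \<eta> where "\<eta> = \<epsilon> / (8 * (C + 1))"
  have \<eta>: "0 < \<eta>" using \<epsilon> C by (simp add: \<eta>_def)
  obtain N where N: "1 \<le> N" "hb (VN N) (u 0) \<eta>" using hb_VN_small[OF M[of 0] \<eta>] S by auto
  have "continuous_on {0..S} (\<lambda>\<tau>. en W N (\<lambda>k. u \<tau> k - u t k))"
    by (intro continuous_on_en continuous_intros hsolD(3)[OF u])
  then have "((\<lambda>\<tau>. en W N (\<lambda>k. u \<tau> k - u t k)) \<longlongrightarrow> en W N (\<lambda>k. u t k - u t k)) (at t within {0..S})"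
    using t unfolding continuous_on_def by blast
  then have "\<forall>\<^sub>F \<tau> in at t within {0..S}. en W N (\<lambda>k. u \<tau> k - u t k) < \<epsilon> / 2"
    using \<epsilon> by (intro order_tendstoD) (auto simp: en_def)
  moreover have "\<forall>\<^sub>F \<tau> in at t within {0..S}. \<tau> \<in> {0..S}" by (simp add: eventually_at_filter)
  ultimately show ?thesis
  proof eventually_elim
    case (elim \<tau>)
    have "hb (VN N) (\<lambda>k. u \<tau> k - u t k) (2 * (C * \<eta>) + 2 * (C * \<eta>))"
      by (intro hb_diff VN_nonneg ub N t elim)
    then have 1: "hb W (\<lambda>k. u \<tau> k - u t k) (en W N (\<lambda>k. u \<tau> k - u t k) + (2 * (C * \<eta>) + 2 * (C * \<eta>)))" by (rule hb_split[OF N(1)])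
    have "2 * (C * \<eta>) + 2 * (C * \<eta>) = 4 * (C * \<eta>)" by simp
    also have "C * \<eta> \<le> (C + 1) * \<eta>" using \<eta> by simp
    also have "4 * ((C + 1) * \<eta>) = \<epsilon> / 2"
    proof -
      have "x * (\<epsilon> / (8 * x)) = \<epsilon> / 8" if "0 < x" for x using that by simp
      from this[of "C + 1"] have "(C + 1) * \<eta> = \<epsilon> / 8" using C unfolding \<eta>_def by linarith
      then show ?thesis by (simp only:)
    qed
    finally show ?case using elim by (intro hb_le[OF 1]) simp
  qed
qed

text \<open>Truncations conserve the \<open>L^2\<close> norm up to their residual, whose size
  \<open>sqrt (err M n)\<close> tends to zero.\<close>

lemma hsol_conservation:
  assumes u: "hsol \<gamma> W S u" and t: "t \<in> {0..S}"
  shows "(\<lambda>n. en (\<lambda>_. 1) n (u t) - en (\<lambda>_. 1) n (u 0)) \<longlonglongrightarrow> 0"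
proof -
  obtain M where M: "\<And>t. t \<in> {0..S} \<Longrightarrow> hb W (u t) M" using hsol_M[OF u] by blast
  have M0: "0 \<le> M" using hb_bound_nonneg[OF M[OF t]] .
  have bound: "\<bar>en (\<lambda>_. 1) n (u t) - en (\<lambda>_. 1) n (u 0)\<bar> \<le> S * (2 * (sqrt M * sqrt (err M n)))" if n: "1 \<le> n" for n
  proof (cases "t = 0")
    case True then show ?thesis using t M0 err_nonneg[of M n] by simp
  next
    case False
    then have t0: "0 < t" using t by simp
    let ?f = "\<lambda>t. en (\<lambda>_. 1) n (trunc n (u t))"
    have ap: "approx_sol \<gamma> n t (\<lambda>t. trunc n (u t)) (err M n)"
      using t by (intro approx_sol_subset[OF hsol_approx[OF u M n]]) auto
    obtain r where r: "\<And>\<tau>. \<tau> \<in> {0<..<t} \<Longrightarrow> (\<Sum>k\<in>band n. (cmod (r \<tau> k))\<^sup>2) \<le> err M n"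
       "\<And>\<tau> k. \<tau> \<in> {0<..<t} \<Longrightarrow> k \<in> band n \<Longrightarrow> ((\<lambda>t. trunc n (u t) k) has_vector_derivative ost \<gamma> (trunc n (u \<tau>)) k + r \<tau> k) (at \<tau>)"
      using ap unfolding approx_sol_def by blast
    have der: "(?f has_real_derivative (\<Sum>k\<in>band n. 2 * Re (cnj (trunc n (u \<tau>) k) * (ost \<gamma> (trunc n (u \<tau>)) k + r \<tau> k)))) (at \<tau>)"
      if "\<tau> \<in> {0<..<t}" for \<tau>
      unfolding en_def mult_1 by (intro DERIV_sum has_real_derivative_cmod_square r(2) that)
    have "continuous_on {0..t} ?f" using ap by (intro continuous_on_en) (auto simp: approx_sol_def)
    \<comment> \<open>The residual is only known pointwise in time, without any measurability, so
      the mean value theorem takes the place of integration.\<close>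
    then obtain l \<xi> where \<xi>: "0 < \<xi>" "\<xi> < t" "(?f has_real_derivative l) (at \<xi>)" "?f t - ?f 0 = (t - 0) * l"
      using MVT[OF t0, of ?f] der by (auto simp: real_differentiable_def)
    define b where "b = trunc n (u \<xi>)"
    have \<xi>S: "\<xi> \<in> {0..S}" using \<xi> t by auto
    have b: "supp n b" "herm b" "hb (\<lambda>_. 1) b M"
      unfolding b_def
      by (rule supp_trunc, rule herm_trunc[OF hsolD(1)[OF u \<xi>S]],
          rule hb_trunc[OF hb_1[OF M[OF \<xi>S] hsolD(2)[OF u \<xi>S]]]) simp
    have "l = (\<Sum>k\<in>band n. 2 * Re (cnj (b k) * (ost \<gamma> b k + r \<xi> k)))"
      using DERIV_unique[OF \<xi>(3) der[of \<xi>]] \<xi> by (simp add: b_def)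
    also have "\<dots> = 2 * (\<Sum>k\<in>band n. Re (cnj (b k) * ost \<gamma> b k)) + 2 * (\<Sum>k\<in>band n. Re (cnj (b k) * r \<xi> k))"
      unfolding sum_distrib_left sum.distrib[symmetric] by (intro sum.cong refl) (simp add: algebra_simps)
    also have "(\<Sum>k\<in>band n. Re (cnj (b k) * ost \<gamma> b k)) = 0"
    proof -
      have s0: "supp n (\<lambda>_. 0)" "herm (\<lambda>_. 0)" by (auto simp: supp_def herm_def)
      show ?thesis using difference_cancellation[OF s0 b(1,2), of \<gamma>] by (simp add: A1_def ost_zero)
    qed
    finally have l: "l = 2 * (\<Sum>k\<in>band n. Re (cnj (b k) * r \<xi> k))" by simp
    have "\<bar>\<Sum>k\<in>band n. Re (cnj (b k) * r \<xi> k)\<bar> \<le> (\<Sum>k\<in>band n. cmod (b k) * cmod (r \<xi> k))"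
      by (rule order_trans[OF sum_abs sum_mono]) (metis abs_Re_le_cmod complex_mod_cnj norm_mult)
    also have "\<dots> \<le> sqrt M * sqrt (err M n)"
    proof -
      have "(\<Sum>k\<in>band n. cmod (b k) * cmod (r \<xi> k))\<^sup>2 \<le> (\<Sum>k\<in>band n. (cmod (b k))\<^sup>2) * (\<Sum>k\<in>band n. (cmod (r \<xi> k))\<^sup>2)"
        by (rule Cauchy_Schwarz_ineq_sum)
      also have "\<dots> \<le> M * err M n"
        using hbD[OF b(3) finite_band, of n] r(1)[of \<xi>] \<xi> M0 by (intro mult_mono) (auto intro: sum_nonneg)
      finally show ?thesis unfolding real_sqrt_mult[symmetric] by (rule real_le_rsqrt)
    qed
    finally have "\<bar>l\<bar> \<le> 2 * (sqrt M * sqrt (err M n))" unfolding l by simp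
    then have "t * \<bar>l\<bar> \<le> S * (2 * (sqrt M * sqrt (err M n)))" using t by (intro mult_mono) auto
    then show ?thesis using \<xi>(4) t0 by (simp add: abs_mult)
  qed
  show ?thesis
  proof (rule Lim_null_comparison)
    show "\<forall>\<^sub>F n in sequentially. norm (en (\<lambda>_. 1) n (u t) - en (\<lambda>_. 1) n (u 0)) \<le> S * (2 * (sqrt M * sqrt (err M n)))"
      using bound by (auto intro!: eventually_sequentiallyI[of 1])
    have "(\<lambda>n. S * (2 * (sqrt M * sqrt (err M n)))) \<longlonglongrightarrow> S * (2 * (sqrt M * sqrt 0))"
      unfolding err_def by (intro tendsto_intros const_over_n_sq)
    then show "(\<lambda>n. S * (2 * (sqrt M * sqrt (err M n)))) \<longlonglongrightarrow> 0" by simp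
  qed
qed

end

subsection \<open>Fourier series on the circle\<close>

lemma band_filterlim: "filterlim band (finite_subsets_at_top UNIV) sequentially"
  unfolding filterlim_finite_subsets_at_top
proof safe
  fix X :: "int set" assume "finite X"
  then obtain m where m: "X \<subseteq> band m" using finite_subset_band by blast
  show "\<forall>\<^sub>F n in sequentially. finite (band n) \<and> X \<subseteq> band n \<and> band n \<subseteq> UNIV"
    by (rule eventually_sequentiallyI[of m]) (use m band_mono in blast)
qed

lemma integrable_mult_bounded:
  fixes f h :: "real \<Rightarrow> 'a::{real_normed_algebra, banach, second_countable_topology}"
  assumes f: "integrable M f" and h: "h \<in> borel_measurable M" and B: "\<And>x. x \<in> space M \<Longrightarrow> norm (h x) \<le> B"
  shows "integrable M (\<lambda>x. f x * h x)"
proof (rule Bochner_Integration.integrable_bound)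
  show "integrable M (\<lambda>x. B *\<^sub>R f x)" using f by simp
  show "(\<lambda>x. f x * h x) \<in> borel_measurable M"
    using borel_measurable_integrable[OF f] h by (rule borel_measurable_times)
  show "AE x in M. norm (f x * h x) \<le> norm (B *\<^sub>R f x)"
  proof (rule AE_I2)
    fix x assume x: "x \<in> space M"
    have "norm (f x * h x) \<le> norm (f x) * norm (h x)" by (rule norm_mult_ineq)
    also have "\<dots> \<le> norm (f x) * B" by (intro mult_left_mono B x) auto
    also have "\<dots> \<le> \<bar>B\<bar> * norm (f x)" by (simp add: mult.commute mult_right_mono)
    finally show "norm (f x * h x) \<le> norm (B *\<^sub>R f x)" by simp
  qed
qed

lemma continuous_measurable_circle:
  fixes f :: "real \<Rightarrow> 'a::euclidean_space"
  shows "continuous_on {0..1} f \<Longrightarrow> f \<in> borel_measurable circle_measure"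
  by (rule continuous_imp_measurable_on_sets_lebesgue) auto

lemma integrable_mult_continuous:
  fixes f h :: "real \<Rightarrow> 'a::{real_normed_algebra, euclidean_space}"
  assumes f: "integrable circle_measure f" and h: "continuous_on {0..1} h"
  shows "integrable circle_measure (\<lambda>x. f x * h x)"
proof -
  have "compact (h ` {0..1})" by (intro compact_continuous_image h) auto
  then have "bounded (h ` {0..1})" by (rule compact_imp_bounded)
  then obtain B where "\<forall>y\<in>h ` {0..1}. norm y \<le> B" unfolding bounded_iff by (elim exE)
  then have "\<And>x. x \<in> {0..1} \<Longrightarrow> norm (h x) \<le> B" by blast
  then show ?thesis by (intro integrable_mult_bounded[OF f continuous_measurable_circle[OF h], of B]) simp
qed

definition ee :: "int \<Rightarrow> real \<Rightarrow> complex" where "ee k x = cis (2 * pi * real_of_int k * x)"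

lemma ee_add: "ee (j + k) x = ee j x * ee k x" by (simp add: ee_def cis_mult algebra_simps)
lemma cmod_ee[simp]: "cmod (ee k x) = 1" by (simp add: ee_def)
lemma ee_0[simp]: "ee 0 x = 1" by (simp add: ee_def)
lemma cnj_ee: "cnj (ee k x) = ee (- k) x" by (simp add: ee_def cis_cnj)
lemma ee_periodic: "ee k (x + 1) = ee k x"
  using cis_multiple_2pi[of "real_of_int k"] by (simp add: ee_def distrib_left cis_mult[symmetric])
lemma continuous_on_ee[continuous_intros]: "continuous_on S (ee k)"
  unfolding ee_def[abs_def] cis_conv_exp by (intro continuous_intros)
lemma has_vector_derivative_ee: "(ee k has_vector_derivative 2 * pi * \<i> * of_int k * ee k x) (at x within S)"
proof -
  have "((\<lambda>z. exp (2 * pi * \<i> * of_int k * z)) has_field_derivative 2 * pi * \<i> * of_int k * exp (2 * pi * \<i> * of_int k * of_real x)) (at (of_real x))"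
    by (auto intro!: derivative_eq_intros)
  from has_vector_derivative_real_field[OF this] show ?thesis
    unfolding ee_def[abs_def] cis_conv_exp by (simp add: mult_ac)
qed

lemma fourier_coeff_ee: "fourier_coeff f k = (LINT x|circle_measure. complex_of_real (f x) * ee (- k) x)"
  by (simp add: fourier_coeff_def ee_def)

lemma integral_ee: "(LINT x|circle_measure. ee k x) = (if k = 0 then 1 else 0)"
proof (cases "k = 0")
  case True
  have "measure lebesgue {0..1::real} = 1" by simp
  then show ?thesis using True by (simp add: ee_def measure_restrict_space)
next
  case False
  have "integrable circle_measure (ee k)" by (intro continuous_imp_integrable_real continuous_intros)
  then have "(LINT x|circle_measure. ee k x) = integral {0..1} (ee k)"
    by (rule lebesgue_integral_eq_integral) auto
  also have "((\<lambda>x. ee k x) has_integral (ee k 1 / (2 * pi * \<i> * of_int k) - ee k 0 / (2 * pi * \<i> * of_int k))) {0..1}"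
  proof (rule fundamental_theorem_of_calculus)
    fix x :: real
    have "((\<lambda>x. ee k x * (1 / (2 * pi * \<i> * of_int k))) has_vector_derivative (2 * pi * \<i> * of_int k * ee k x) * (1 / (2 * pi * \<i> * of_int k))) (at x within {0..1})"
      by (intro has_vector_derivative_mult_left has_vector_derivative_ee)
    then show "((\<lambda>x. ee k x / (2 * pi * \<i> * of_int k)) has_vector_derivative ee k x) (at x within {0..1})"
      using False by simp
  qed simp
  then have "integral {0..1} (ee k) = 0"
    using ee_periodic[of k 0] by (simp add: integral_unique)
  finally show ?thesis using False by simp
qed

lemma integrable_fourier:
  assumes "integrable circle_measure f"
  shows "integrable circle_measure (\<lambda>x. complex_of_real (f x) * ee k x)"
  by (intro integrable_mult_continuous integrable_of_real assms continuous_intros)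

lemma circle_L1_integrable: "f \<in> circle_L1 \<Longrightarrow> integrable circle_measure f" by (simp add: circle_L1_def)

lemma circle_fun_measurable: "circle_fun f \<Longrightarrow> f \<in> borel_measurable circle_measure"
  by (simp add: circle_fun_def measurable_restrict_space1)

lemma finite_measure_circle: "finite_measure circle_measure"
  by (rule finite_measureI) (simp add: emeasure_restrict_space)

lemma circle_L2_L1:
  assumes "f \<in> circle_L2"
  shows "f \<in> circle_L1"
proof -
  have f: "circle_fun f" "integrable circle_measure (\<lambda>x. (f x)\<^sup>2)" using assms by (auto simp: circle_L2_def)
  have "integrable circle_measure f"
  proof (rule Bochner_Integration.integrable_bound)
    show "integrable circle_measure (\<lambda>x. 1 + (f x)\<^sup>2)"
      using f finite_measure.integrable_const[OF finite_measure_circle, of "1::real"] by (intro Bochner_Integration.integrable_add)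
    show "f \<in> borel_measurable circle_measure" by (rule circle_fun_measurable[OF f(1)])
    have "\<bar>y\<bar> \<le> 1 + y\<^sup>2" for y :: real using sum_squares_bound[of 1 "\<bar>y\<bar>"] by (simp add: abs_le_iff) (smt (verit) zero_le_power2)
    then show "AE x in circle_measure. norm (f x) \<le> norm (1 + (f x)\<^sup>2)" by (intro AE_I2) (simp add: abs_of_nonneg)
  qed
  then show ?thesis using f by (simp add: circle_L1_def)
qed

lemma fourier_coeff_diff:
  assumes "integrable circle_measure f" "integrable circle_measure g"
  shows "fourier_coeff (\<lambda>x. f x - g x) k = fourier_coeff f k - fourier_coeff g k"
  unfolding fourier_coeff_ee using integrable_fourier[OF assms(1)] integrable_fourier[OF assms(2)]
  by (simp add: left_diff_distrib)

lemma fourier_coeff_add: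
  assumes "integrable circle_measure f" "integrable circle_measure g"
  shows "fourier_coeff (\<lambda>x. f x + g x) k = fourier_coeff f k + fourier_coeff g k"
  unfolding fourier_coeff_ee using integrable_fourier[OF assms(1)] integrable_fourier[OF assms(2)]
  by (simp add: distrib_right)

lemma fourier_coeff_cmult: "fourier_coeff (\<lambda>x. c * f x) k = of_real c * fourier_coeff f k"
  unfolding fourier_coeff_ee by (simp add: mult.assoc)

lemma fourier_coeff_divide: "fourier_coeff (\<lambda>x. f x / c) k = fourier_coeff f k / of_real c"
  using fourier_coeff_cmult[of "1 / c" f k] by simp

lemma fourier_coeff_cong_AE:
  assumes "f \<in> borel_measurable circle_measure" "g \<in> borel_measurable circle_measure" "AE x in circle_measure. f x = g x"
  shows "fourier_coeff f k = fourier_coeff g k"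
  unfolding fourier_coeff_ee
proof (rule integral_cong_AE)
  have e: "ee (- k) \<in> borel_measurable circle_measure" by (intro continuous_measurable_circle continuous_intros)
  show "(\<lambda>x. complex_of_real (f x) * ee (- k) x) \<in> borel_measurable circle_measure"
    "(\<lambda>x. complex_of_real (g x) * ee (- k) x) \<in> borel_measurable circle_measure"
    using assms(1,2) e by (auto intro!: borel_measurable_times borel_measurable_of_real)
  show "AE x in circle_measure. complex_of_real (f x) * ee (- k) x = complex_of_real (g x) * ee (- k) x"
    using assms(3) by eventually_elim simp
qed

lemma herm_fourier_coeff: "integrable circle_measure f \<Longrightarrow> herm (fourier_coeff f)"
  unfolding herm_def fourier_coeff_ee
  using integral_bounded_linear[OF bounded_linear_cnj integrable_fourier[of f]]
  by (simp add: cnj_ee)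

lemma fourier_coeff_0: "fourier_coeff f 0 = of_real (circle_integral f)"
  by (simp add: fourier_coeff_ee circle_integral_def)

lemma fourier_coeff_cos_sin:
  assumes "integrable circle_measure f"
  shows "fourier_coeff f k = Complex (circle_integral (\<lambda>x. f x * cos (2 * pi * k * x))) (- circle_integral (\<lambda>x. f x * sin (2 * pi * k * x)))"
proof (rule complex_eqI)
  note i = integrable_fourier[OF assms, of "- k"]
  show "Re (fourier_coeff f k) = Re (Complex (circle_integral (\<lambda>x. f x * cos (2 * pi * k * x))) (- circle_integral (\<lambda>x. f x * sin (2 * pi * k * x))))"
    unfolding fourier_coeff_ee using integral_Re[OF i] by (simp add: circle_integral_def ee_def)
  show "Im (fourier_coeff f k) = Im (Complex (circle_integral (\<lambda>x. f x * cos (2 * pi * k * x))) (- circle_integral (\<lambda>x. f x * sin (2 * pi * k * x))))"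
    unfolding fourier_coeff_ee using integral_Im[OF i] by (simp add: circle_integral_def ee_def)
qed

section \<open>Absolutely convergent Fourier series\<close>

definition l1 :: "(int \<Rightarrow> complex) \<Rightarrow> bool" where "l1 a \<longleftrightarrow> (\<lambda>k. cmod (a k)) summable_on UNIV"

text \<open>For summable coefficients the series converges uniformly and has a continuous sum. The
  functions in question have weight at least \<open>k^2\<close> and zero mean, so this suffices and
  convergence in \<open>L^2\<close> does not have to be discussed.\<close>

definition fsc :: "(int \<Rightarrow> complex) \<Rightarrow> real \<Rightarrow> complex" where "fsc a x = (\<Sum>\<^sub>\<infinity>k. a k * ee k x)"
definition fs :: "(int \<Rightarrow> complex) \<Rightarrow> real \<Rightarrow> real" where "fs a x = Re (fsc a x)"

lemma fsc_uniform: "l1 a \<Longrightarrow> uniform_limit UNIV (\<lambda>F x. \<Sum>k\<in>F. a k * ee k x) (fsc a) (finite_subsets_at_top UNIV)"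
  unfolding fsc_def[abs_def] by (rule Weierstrass_m_test_general[of UNIV UNIV _ "\<lambda>k. cmod (a k)"]) (auto simp: norm_mult l1_def)

lemma continuous_on_fsc: "l1 a \<Longrightarrow> continuous_on S (fsc a)"
  by (rule continuous_on_subset[of UNIV], rule uniform_limit_theorem[OF _ fsc_uniform])
     (auto intro!: always_eventually continuous_intros)

lemma continuous_on_fs: "l1 a \<Longrightarrow> continuous_on S (fs a)"
  unfolding fs_def[abs_def] by (intro continuous_intros continuous_on_fsc)

lemma fsc_real: "herm a \<Longrightarrow> fsc a x = of_real (fs a x)"
proof -
  assume a: "herm a"
  have "cnj (fsc a x) = fsc a x"
    unfolding fsc_def infsum_cnj[symmetric]
    by (rule infsum_reindex_bij_witness[of _ uminus uminus]) (use a in \<open>auto simp: herm_def cnj_ee\<close>)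
  then show ?thesis unfolding fs_def by (metis Reals_cnj_iff of_real_Re)
qed

lemma circle_fun_fs: "l1 a \<Longrightarrow> circle_fun (fs a)"
  unfolding circle_fun_def
  by (auto simp: fs_def[of _ "_ + 1"] fs_def[symmetric] fsc_def ee_periodic fs_def intro!: measurable_lebesgue_cong continuous_imp_measurable_on_sets_lebesgue[of UNIV, unfolded lebesgue_on_UNIV_eq] continuous_on_fs)

lemma integrable_fs: "l1 a \<Longrightarrow> integrable circle_measure (fs a)"
  by (intro continuous_imp_integrable_real continuous_on_fs)

lemma fs_L2: "l1 a \<Longrightarrow> fs a \<in> circle_L2"
  unfolding circle_L2_def by (auto intro!: circle_fun_fs continuous_imp_integrable_real continuous_intros continuous_on_fs)

lemma fs_L1: "l1 a \<Longrightarrow> fs a \<in> circle_L1" by (intro circle_L2_L1 fs_L2)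

lemma has_sum_fsc_integral:
  assumes a: "l1 a" and h: "integrable circle_measure h"
  shows "((\<lambda>j. a j * (LINT x|circle_measure. ee j x * h x)) has_sum (LINT x|circle_measure. fsc a x * h x)) UNIV"
  unfolding has_sum_def
proof (rule tendstoI)
  fix e :: real assume e: "0 < e"
  define H where "H = (LINT x|circle_measure. norm (h x))"
  have H: "0 \<le> H" by (simp add: H_def)
  have e': "0 < e / (H + 1)" using e H by simp
  have ih: "integrable circle_measure (\<lambda>x. g x * h x)" if "continuous_on {0..1} g" for g
    using integrable_mult_continuous[OF h that] by (simp add: mult.commute)
  from uniform_limitD[OF fsc_uniform[OF a] e']
  show "\<forall>\<^sub>F F in finite_subsets_at_top UNIV. dist (\<Sum>j\<in>F. a j * (LINT x|circle_measure. ee j x * h x)) (LINT x|circle_measure. fsc a x * h x) < e"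
  proof eventually_elim
    case (elim F)
    let ?S = "\<lambda>x. \<Sum>k\<in>F. a k * ee k x"
    have c: "continuous_on {0..1} ?S" by (intro continuous_intros)
    have "(\<Sum>j\<in>F. a j * (LINT x|circle_measure. ee j x * h x)) = (LINT x|circle_measure. ?S x * h x)"
      by (simp add: sum_distrib_right mult.assoc Bochner_Integration.integral_sum ih continuous_on_ee)
    then have "dist (\<Sum>j\<in>F. a j * (LINT x|circle_measure. ee j x * h x)) (LINT x|circle_measure. fsc a x * h x)
        = norm (LINT x|circle_measure. (?S x - fsc a x) * h x)"
      unfolding dist_norm left_diff_distrib
      by (subst Bochner_Integration.integral_diff) (auto intro!: ih c continuous_on_fsc a)
    also have "\<dots> \<le> (LINT x|circle_measure. e / (H + 1) * norm (h x))"
    proof (rule Bochner_Integration.integral_norm_bound_integral)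
      show "integrable circle_measure (\<lambda>x. (?S x - fsc a x) * h x)" by (intro ih continuous_intros c continuous_on_fsc a)
      show "integrable circle_measure (\<lambda>x. e / (H + 1) * norm (h x))" using h by simp
      show "norm ((?S x - fsc a x) * h x) \<le> e / (H + 1) * norm (h x)" for x
        using elim unfolding norm_mult by (intro mult_right_mono) (auto simp: dist_norm less_imp_le)
    qed
    also have "\<dots> = e * (H / (H + 1))" by (simp add: H_def)
    also have "\<dots> < e * 1" using e H by (intro mult_strict_left_mono) auto
    finally show ?case by simp
  qed
qed

text \<open>Coefficients of a product are a convolution as soon as one factor has an absolutely
  convergent series; the other may be merely integrable, like the weak derivative \<open>ux\<close>
  of an arbitrary solution.\<close>

lemma fourier_coeff_fs_mult:
  assumes a: "l1 a" "herm a" and g: "integrable circle_measure g"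
  shows "((\<lambda>j. a j * fourier_coeff g (k - j)) has_sum fourier_coeff (\<lambda>x. fs a x * g x) k) UNIV"
proof -
  have "((\<lambda>j. a j * (LINT x|circle_measure. ee j x * (of_real (g x) * ee (- k) x))) has_sum
     (LINT x|circle_measure. fsc a x * (of_real (g x) * ee (- k) x))) UNIV"
    by (rule has_sum_fsc_integral[OF a(1) integrable_fourier[OF g]])
  moreover have "ee j x * (of_real (g x) * ee (- k) x) = of_real (g x) * ee (- (k - j)) x" for j x
    using ee_add[of j "- k" x] by (simp add: mult_ac)
  ultimately show ?thesis by (simp add: fourier_coeff_ee fsc_real[OF a(2)] mult.assoc)
qed

lemma fourier_coeff_fs:
  assumes a: "l1 a" "herm a"
  shows "fourier_coeff (fs a) k = a k"
proof -
  have i: "integrable circle_measure (\<lambda>x. 1 :: real)" by (intro continuous_imp_integrable_real continuous_intros)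
  have "((\<lambda>j. a j * fourier_coeff (\<lambda>x. 1) (k - j)) has_sum fourier_coeff (\<lambda>x. fs a x * 1) k) UNIV"
    by (rule fourier_coeff_fs_mult[OF a i])
  moreover have "fourier_coeff (\<lambda>x. 1) (k - j) = (if j = k then 1 else 0)" for j
    using integral_ee[of "- (k - j)"] by (simp add: fourier_coeff_ee)
  ultimately have "((\<lambda>j. if j = k then a k else 0) has_sum fourier_coeff (fs a) k) UNIV"
    by (simp add: if_distrib cong: if_cong)
  moreover have "((\<lambda>j. if j = k then a k else 0) has_sum a k) UNIV"
    by (rule has_sum_finite_neutralI[of "{k}"]) auto
  ultimately show ?thesis by (rule has_sum_unique)
qed

text \<open>This class is closed under multiplication by \<open>cos (2 \<pi> x)\<close> and \<open>sin (2 \<pi> x)\<close>, hence by polynomials in \<open>cis (2 \<pi> x)\<close>,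
  so that the Stone--Weierstrass theorem on the unit circle gives uniqueness of Fourier coefficients in \<open>L\<^sup>1\<close>.\<close>

definition null_coeffs :: "(real \<Rightarrow> real) \<Rightarrow> bool" where
  "null_coeffs f \<longleftrightarrow> integrable circle_measure f \<and> (\<forall>k. fourier_coeff f k = 0)"

lemma null_coeffs_cos_sin:
  assumes "null_coeffs f"
  shows "null_coeffs (\<lambda>x. f x * cos (2 * pi * x))" and "null_coeffs (\<lambda>x. f x * sin (2 * pi * x))"
proof -
  have f: "integrable circle_measure f" "\<And>k. fourier_coeff f k = 0" using assms by (auto simp: null_coeffs_def)
  have c: "complex_of_real (cos (2 * pi * x)) = (ee 1 x + ee (- 1) x) / 2" "complex_of_real (sin (2 * pi * x)) = (ee 1 x - ee (- 1) x) / (2 * \<i>)" for x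
    by (auto simp: ee_def complex_eq_iff)
  have i: "integrable circle_measure (\<lambda>x. f x * cos (2 * pi * x))" "integrable circle_measure (\<lambda>x. f x * sin (2 * pi * x))"
    by (auto intro!: integrable_mult_continuous f continuous_intros)
  have z: "(LINT x|circle_measure. complex_of_real (f x) * ee m x) = 0" for m
    using f(2)[of "- m"] by (simp add: fourier_coeff_ee)
  have "fourier_coeff (\<lambda>x. f x * cos (2 * pi * x)) k = (LINT x|circle_measure. (complex_of_real (f x) * ee (1 - k) x + complex_of_real (f x) * ee (- 1 - k) x) / 2)" for k
    unfolding fourier_coeff_ee of_real_mult c
    by (intro Bochner_Integration.integral_cong refl) (simp add: ee_add[of _ "- k", simplified] algebra_simps)
  moreover have "fourier_coeff (\<lambda>x. f x * sin (2 * pi * x)) k = (LINT x|circle_measure. (complex_of_real (f x) * ee (1 - k) x - complex_of_real (f x) * ee (- 1 - k) x) / (2 * \<i>))" for k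
    unfolding fourier_coeff_ee of_real_mult c
    by (intro Bochner_Integration.integral_cong refl) (simp add: ee_add[of _ "- k", simplified] algebra_simps)
  ultimately show "null_coeffs (\<lambda>x. f x * cos (2 * pi * x))" "null_coeffs (\<lambda>x. f x * sin (2 * pi * x))"
    using i by (simp_all add: null_coeffs_def z integrable_fourier[OF f(1)])
qed

lemma null_coeffs_add: "null_coeffs f \<Longrightarrow> null_coeffs g \<Longrightarrow> null_coeffs (\<lambda>x. f x + g x)"
  by (simp add: null_coeffs_def fourier_coeff_add)

lemma null_coeffs_cmult: "null_coeffs f \<Longrightarrow> null_coeffs (\<lambda>x. c * f x)"
  by (simp add: null_coeffs_def fourier_coeff_cmult)

lemma null_coeffs_polynomial:
  assumes "real_polynomial_function (g :: complex \<Rightarrow> real)" "null_coeffs f"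
  shows "null_coeffs (\<lambda>x. f x * g (cis (2 * pi * x)))"
  using assms
proof (induction arbitrary: f rule: real_polynomial_function.induct)
  case (linear g)
  have "g (cis y) = cos y * g 1 + sin y * g \<i>" for y
  proof -
    have "cis y = cos y *\<^sub>R 1 + sin y *\<^sub>R \<i>" by (simp add: complex_eq_iff)
    then show ?thesis using linear.hyps by (simp add: linear_simps)
  qed
  then have "(\<lambda>x. f x * g (cis (2 * pi * x))) = (\<lambda>x. g 1 * (f x * cos (2 * pi * x)) + g \<i> * (f x * sin (2 * pi * x)))"
    by (simp add: algebra_simps)
  then show ?case using linear.prems by (auto intro!: null_coeffs_add null_coeffs_cmult null_coeffs_cos_sin)
next
  case (const c)
  then show ?case using null_coeffs_cmult[of f c] by (simp add: mult.commute)
next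
  case (add g h)
  then show ?case using null_coeffs_add by (simp add: distrib_left)
next
  case (mult g h)
  then show ?case using mult.IH(2)[OF mult.IH(1)] by (simp add: mult.assoc)
qed

lemma null_coeffs_continuous:
  assumes f: "null_coeffs f" and \<Phi>: "continuous_on UNIV (\<Phi> :: complex \<Rightarrow> real)"
  shows "(LINT x|circle_measure. f x * \<Phi> (cis (2 * pi * x))) = 0"
proof -
  have fi: "integrable circle_measure f" using f by (simp add: null_coeffs_def)
  define H where "H = (LINT x|circle_measure. \<bar>f x\<bar>)"
  have H: "0 \<le> H" by (simp add: H_def)
  have cc: "continuous_on {0..1} (\<lambda>x. g (cis (2 * pi * x)))" if "continuous_on UNIV g" for g :: "complex \<Rightarrow> real"
    by (rule continuous_on_compose2[OF that]) (auto simp: cis_conv_exp intro!: continuous_intros)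
  have "\<bar>LINT x|circle_measure. f x * \<Phi> (cis (2 * pi * x))\<bar> \<le> e * H" if e: "0 < e" for e
  proof -
    have "continuous_on (sphere 0 1) \<Phi>" using \<Phi> continuous_on_subset by blast
    then obtain g where "polynomial_function g" and g0: "\<forall>z\<in>sphere 0 1. norm (\<Phi> z - g z) < e"
      using Stone_Weierstrass_polynomial_function[OF compact_sphere _ e] by blast
    then have g: "real_polynomial_function g" "\<And>z. z \<in> sphere 0 1 \<Longrightarrow> \<bar>\<Phi> z - g z\<bar> < e"
      by (simp_all add: real_polynomial_function_eq)
    have gc: "continuous_on UNIV g" using g(1) by (simp add: continuous_on_polymonial_function real_polynomial_function_eq)
    have i: "integrable circle_measure (\<lambda>x. f x * \<Phi> (cis (2 * pi * x)))" "integrable circle_measure (\<lambda>x. f x * g (cis (2 * pi * x)))"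
      by (intro integrable_mult_continuous fi cc \<Phi> gc)+
    have "(LINT x|circle_measure. f x * g (cis (2 * pi * x))) = 0"
      using null_coeffs_polynomial[OF g(1) f] fourier_coeff_0[of "\<lambda>x. f x * g (cis (2 * pi * x))"]
      by (simp add: null_coeffs_def circle_integral_def)
    then have "(LINT x|circle_measure. f x * \<Phi> (cis (2 * pi * x))) = (LINT x|circle_measure. f x * (\<Phi> (cis (2 * pi * x)) - g (cis (2 * pi * x))))"
      using i by (simp add: right_diff_distrib)
    also have "\<bar>\<dots>\<bar> \<le> (LINT x|circle_measure. e * \<bar>f x\<bar>)"
      unfolding real_norm_def[symmetric]
    proof (rule Bochner_Integration.integral_norm_bound_integral)
      show "integrable circle_measure (\<lambda>x. f x * (\<Phi> (cis (2 * pi * x)) - g (cis (2 * pi * x))))"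
        using i by (simp add: right_diff_distrib)
      show "integrable circle_measure (\<lambda>x. e * norm (f x))" using fi by simp
      show "norm (f x * (\<Phi> (cis (2 * pi * x)) - g (cis (2 * pi * x)))) \<le> e * norm (f x)" for x
        using mult_left_mono[OF less_imp_le[OF g(2)[of "cis (2 * pi * x)"]], of "\<bar>f x\<bar>"] by (simp add: abs_mult mult.commute)
    qed
    also have "\<dots> = e * H" by (simp add: H_def)
    finally show ?thesis .
  qed
  then have "\<bar>LINT x|circle_measure. f x * \<Phi> (cis (2 * pi * x))\<bar> \<le> 0 + e" if "0 < e" for e
    using that H by (intro order_trans[OF \<open>\<And>e. 0 < e \<Longrightarrow> _ \<le> e * H\<close>[of "e / (H + 1)"]]) (auto simp: field_simps)
  then have "\<bar>LINT x|circle_measure. f x * \<Phi> (cis (2 * pi * x))\<bar> \<le> 0" by (rule field_le_epsilon)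
  then show ?thesis by simp
qed

lemma cis_2pi_eq:
  assumes "cis (2 * pi * x) = cis (2 * pi * y)" "0 < y" "y < 1" "0 \<le> x" "x \<le> 1"
  shows "x = y"
proof -
  have "cis (2 * pi * (x - y)) = 1"
    using assms(1) by (simp add: right_diff_distrib cis_divide[symmetric])
  then have "cos (2 * pi * (x - y)) = 1" by (simp add: complex_eq_iff)
  then obtain n :: int where "2 * pi * (x - y) = of_int n * 2 * pi" by (auto simp: cos_one_2pi_int)
  then have "x - y = of_int n" by simp
  then have "- 1 < real_of_int n" "real_of_int n < 1" using assms by linarith+
  then have "n = 0" by linarith
  then show ?thesis using \<open>x - y = of_int n\<close> by simp
qed

text \<open>The indicator of the image of \<open>C\<close> on the unit circle is the decreasing
  limit of the continuous functions \<open>max 0 (1 - n * infdist z A)\<close>, and dominated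
  convergence applies. Keeping \<open>C\<close> inside the open interval avoids the endpoints 0 and
  1, which have the same image.\<close>

lemma null_coeffs_closed:
  assumes f: "null_coeffs f" and C: "closed C" "C \<subseteq> {0<..<1}"
  shows "(LINT x|circle_measure. f x * indicator C x) = 0"
proof (cases "C = {}")
  case False
  have fi: "integrable circle_measure f" using f by (simp add: null_coeffs_def)
  define A where "A = (\<lambda>x. cis (2 * pi * x)) ` C"
  have "bounded C" using C(2) by (intro bounded_subset[OF bounded_closed_interval[of 0 1]]) auto
  then have "compact A"
    unfolding A_def using C by (intro compact_continuous_image) (auto simp: cis_conv_exp compact_eq_bounded_closed intro!: continuous_intros)
  then have A: "closed A" "A \<noteq> {}" using False by (auto simp: compact_imp_closed A_def)
  define \<Phi> where "\<Phi> n z = max 0 (1 - real n * infdist z A)" for n z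
  have \<Phi>c: "continuous_on UNIV (\<Phi> n)" for n unfolding \<Phi>_def[abs_def] by (intro continuous_intros)
  have lim: "(\<lambda>n. f x * \<Phi> n (cis (2 * pi * x))) \<longlonglongrightarrow> f x * indicator C x" if x: "x \<in> {0..1}" for x
  proof (cases "x \<in> C")
    case True
    then have "\<Phi> n (cis (2 * pi * x)) = 1" for n by (simp add: \<Phi>_def A_def)
    then show ?thesis using True by simp
  next
    case F: False
    have "cis (2 * pi * x) \<notin> A"
    proof
      assume "cis (2 * pi * x) \<in> A"
      then obtain y where y: "y \<in> C" "cis (2 * pi * x) = cis (2 * pi * y)" by (auto simp: A_def)
      from cis_2pi_eq[OF y(2)] y(1) C(2) x have "x = y" by auto
      then show False using y F by simp
    qed
    then have p: "0 < infdist (cis (2 * pi * x)) A" using A by (simp add: infdist_pos_not_in_closed)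
    obtain N :: nat where N: "1 / infdist (cis (2 * pi * x)) A < N" using reals_Archimedean2 by blast
    have "\<Phi> n (cis (2 * pi * x)) = 0" if "N \<le> n" for n
    proof -
      have "1 / infdist (cis (2 * pi * x)) A \<le> n" using N that by linarith
      then show ?thesis using p by (simp add: \<Phi>_def field_simps)
    qed
    then have "\<forall>\<^sub>F n in sequentially. f x * \<Phi> n (cis (2 * pi * x)) = f x * indicator C x"
      using F by (auto intro!: eventually_sequentiallyI[of N])
    then show ?thesis by (rule tendsto_eventually)
  qed
  have "(\<lambda>n. LINT x|circle_measure. f x * \<Phi> n (cis (2 * pi * x))) \<longlonglongrightarrow> (LINT x|circle_measure. f x * indicator C x)"
  proof (rule integral_dominated_convergence[where w = "\<lambda>x. \<bar>f x\<bar>"])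
    have fm: "f \<in> borel_measurable circle_measure" using fi by auto
    show "AE x in circle_measure. norm (f x * \<Phi> n (cis (2 * pi * x))) \<le> \<bar>f x\<bar>" for n
      by (rule AE_I2) (auto simp: abs_mult \<Phi>_def max_def infdist_nonneg intro!: mult_left_le)
    show "integrable circle_measure (\<lambda>x. \<bar>f x\<bar>)" using fi by simp
    show "AE x in circle_measure. (\<lambda>n. f x * \<Phi> n (cis (2 * pi * x))) \<longlonglongrightarrow> f x * indicator C x"
      using lim by (intro AE_I2) simp
    show m: "(\<lambda>x. f x * \<Phi> n (cis (2 * pi * x))) \<in> borel_measurable circle_measure" for n
      by (intro borel_measurable_times fm continuous_measurable_circle continuous_on_compose2[OF \<Phi>c])
         (auto simp: cis_conv_exp intro!: continuous_intros)
    show "(\<lambda>x. f x * indicator C x) \<in> borel_measurable circle_measure"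
      by (rule borel_measurable_LIMSEQ_metric[OF m]) (use lim in simp)
  qed
  then show ?thesis by (simp add: null_coeffs_continuous[OF f \<Phi>c] LIMSEQ_const_iff)
qed simp

lemma null_coeffs_uminus: "null_coeffs f \<Longrightarrow> null_coeffs (\<lambda>x. - f x)"
  using null_coeffs_cmult[of f "- 1"] by simp

text \<open>On a closed subset of the set where \<open>f\<close> is positive the integral of
  \<open>f\<close> vanishes, so this subset is null. By inner regularity the whole positivity set is
  null; the two endpoints are negligible.\<close>

lemma null_coeffs_nonpos:
  assumes f: "null_coeffs f"
  shows "AE x in circle_measure. f x \<le> 0"
proof -
  have fi: "integrable circle_measure f" using f by (simp add: null_coeffs_def)
  have fm: "f \<in> borel_measurable circle_measure" using fi by auto
  have "{x \<in> space circle_measure. 0 < f x} \<in> sets circle_measure" using fm by measurable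
  then have P: "{x \<in> {0..1}. 0 < f x} \<in> sets lebesgue" by (simp add: sets_restrict_space_iff)
  define A where "A = {x \<in> {0<..<1}. 0 < f x}"
  have "A = {x \<in> {0..1}. 0 < f x} \<inter> {0<..<1}" by (auto simp: A_def)
  then have A: "A \<in> sets lebesgue" using P by auto
  have T0: "emeasure lebesgue T = 0" if T: "closed T" "T \<subseteq> A" for T
  proof -
    have T': "T \<subseteq> {0<..<1}" using T(2) by (auto simp: A_def)
    have Ts: "T \<in> sets circle_measure" using T(1) T' by (auto simp: sets_restrict_space_iff)
    have i: "integrable circle_measure (\<lambda>x. f x * indicator T x)"
      using integrable_real_mult_indicator[OF Ts fi] .
    have "AE x in circle_measure. f x * indicator T x = 0"
    proof (subst integral_nonneg_eq_0_iff_AE[OF i, symmetric])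
      show "AE x in circle_measure. 0 \<le> f x * indicator T x"
        using T(2) by (intro AE_I2) (auto simp: indicator_def A_def less_imp_le)
      show "(LINT x|circle_measure. f x * indicator T x) = 0" by (rule null_coeffs_closed[OF f T(1) T'])
    qed
    then have "AE x in circle_measure. x \<notin> T"
      by (rule eventually_mono) (use T(2) in \<open>auto simp: indicator_def A_def split: if_splits\<close>)
    then have "emeasure circle_measure T = 0"
      using Ts T' by (subst AE_iff_measurable[symmetric, of _ _ "\<lambda>x. x \<notin> T"]) auto
    then show ?thesis using T' by (subst (asm) emeasure_restrict_space) auto
  qed
  have "emeasure lebesgue A \<le> 0 + ennreal e" if e: "0 < e" for e
  proof -
    obtain T where T: "closed T" "T \<subseteq> A" "A - T \<in> lmeasurable" "emeasure lebesgue (A - T) < ennreal e"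
      using sets_lebesgue_inner_closed[OF A e] by blast
    have "emeasure lebesgue A \<le> emeasure lebesgue T + emeasure lebesgue (A - T)"
    proof -
      have Ts: "T \<in> sets lebesgue" using T(1) by auto
      have "T \<union> (A - T) = A" using T(2) by auto
      moreover have "emeasure lebesgue (T \<union> (A - T)) \<le> emeasure lebesgue T + emeasure lebesgue (A - T)"
        by (rule emeasure_subadditive[OF Ts sets.Diff[OF A Ts]])
      ultimately show ?thesis by simp
    qed
    also have "\<dots> \<le> 0 + ennreal e" unfolding T0[OF T(1,2)] by (intro add_mono order_refl less_imp_le T(4))
    finally show ?thesis .
  qed
  then have "emeasure lebesgue A \<le> 0" by (rule ennreal_le_epsilon) auto
  then have "A \<in> null_sets lebesgue" using A by auto
  moreover have "{0, 1::real} \<in> null_sets lebesgue"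
    using negligible_finite[of "{0, 1::real}"] by (simp add: negligible_iff_null_sets)
  ultimately have "A \<union> {0, 1} \<in> null_sets lebesgue" by (rule null_sets.Un)
  moreover have "A \<union> {0, 1} \<subseteq> {0..1}" by (auto simp: A_def)
  ultimately have "A \<union> {0, 1} \<in> null_sets circle_measure" by (subst null_sets_restrict_space) auto
  then show ?thesis by (rule AE_I') (auto simp: A_def)
qed

lemma null_coeffs_AE: "null_coeffs f \<Longrightarrow> AE x in circle_measure. f x = 0"
  using null_coeffs_nonpos[of f] null_coeffs_nonpos[OF null_coeffs_uminus, of f] by (auto elim: AE_mp)

lemma ae_eq_fs:
  assumes f: "integrable circle_measure f" and l: "l1 (fourier_coeff f)"
  shows "circle_ae_eq f (fs (fourier_coeff f))"
proof -
  note h = herm_fourier_coeff[OF f]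
  have "null_coeffs (\<lambda>x. f x - fs (fourier_coeff f) x)"
    using f integrable_fs[OF l] by (simp add: null_coeffs_def fourier_coeff_diff fourier_coeff_fs[OF l h])
  from null_coeffs_AE[OF this] show ?thesis by (simp add: circle_ae_eq_def)
qed

lemma circle_ae_eq_coeffs:
  "f \<in> circle_L1 \<Longrightarrow> g \<in> circle_L1 \<Longrightarrow> circle_ae_eq f g \<Longrightarrow> fourier_coeff f k = fourier_coeff g k"
  by (intro fourier_coeff_cong_AE) (auto simp: circle_ae_eq_def circle_L1_def intro: circle_fun_measurable)

text \<open>The product formula for \<open>fs a * fs a\<close> at frequency 0.\<close>

lemma parseval_fs:
  assumes a: "l1 a" "herm a"
  shows "((\<lambda>k. (cmod (a k))\<^sup>2) has_sum circle_integral (\<lambda>x. (fs a x)\<^sup>2)) UNIV"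
proof -
  have "((\<lambda>j. a j * fourier_coeff (fs a) (0 - j)) has_sum fourier_coeff (\<lambda>x. fs a x * fs a x) 0) UNIV"
    by (rule fourier_coeff_fs_mult[OF a integrable_fs[OF a(1)]])
  moreover have "a j * fourier_coeff (fs a) (0 - j) = of_real ((cmod (a j))\<^sup>2)" for j
    using a(2) complex_norm_square[of "a j"] by (simp add: fourier_coeff_fs[OF a] herm_def)
  ultimately have "((\<lambda>j. complex_of_real ((cmod (a j))\<^sup>2)) has_sum complex_of_real (circle_integral (\<lambda>x. (fs a x)\<^sup>2))) UNIV"
    by (simp add: fourier_coeff_0 power2_eq_square)
  then show ?thesis by (simp only: has_sum_of_real_iff)
qed

subsection \<open>Weak derivatives and Sobolev spaces\<close>

lemma DERIV_trig:
  "((\<lambda>x. A * cos (c * x) + B * sin (c * x)) has_real_derivative (B * c) * cos (c * x) + (- A * c) * sin (c * x)) (at x)" for A B c x :: real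
  by (auto intro!: derivative_eq_intros)

lemma deriv_trig:
  fixes A B c :: real
  shows "deriv (\<lambda>x. A * cos (c * x) + B * sin (c * x)) = (\<lambda>x. (B * c) * cos (c * x) + (- A * c) * sin (c * x))"
  by (intro ext DERIV_imp_deriv DERIV_trig)

text \<open>The family with arbitrary coefficients \<open>A\<close> and \<open>B\<close> is closed
  under differentiation, so the induction on the order of derivatives generalises over them.\<close>

lemma circle_test_trig:
  fixes A B :: real and k :: int
  shows "circle_test_fun (\<lambda>x. A * cos (2 * pi * k * x) + B * sin (2 * pi * k * x))"
  unfolding circle_test_fun_def
proof (intro conjI allI)
  fix x :: real
  have "cis (2 * pi * k * (x + 1)) = cis (2 * pi * k * x)" using ee_periodic[of k x] by (simp add: ee_def)
  then show "A * cos (2 * pi * k * (x + 1)) + B * sin (2 * pi * k * (x + 1)) = A * cos (2 * pi * k * x) + B * sin (2 * pi * k * x)"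
    by (simp add: complex_eq_iff)
next
  fix n :: nat and x :: real
  show "(deriv ^^ n) (\<lambda>x. A * cos (2 * pi * k * x) + B * sin (2 * pi * k * x)) field_differentiable at x"
  proof (induction n arbitrary: A B)
    case 0
    show ?case using DERIV_trig[of A "2 * pi * k" B x] by (auto simp: field_differentiable_def)
  next
    case (Suc n)
    show ?case unfolding funpow_Suc_right o_def deriv_trig by (rule Suc)
  qed
qed

lemma circle_test_deriv:
  assumes "circle_test_fun \<phi>"
  shows "(\<phi> has_real_derivative deriv \<phi> x) (at x)" and "circle_test_fun (deriv \<phi>)"
proof -
  have d: "(deriv ^^ n) \<phi> field_differentiable at x" for n x using assms by (auto simp: circle_test_fun_def)
  show D: "(\<phi> has_real_derivative deriv \<phi> x) (at x)" for x
    using d[of 0 x] by (simp add: DERIV_deriv_iff_field_differentiable)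
  have "deriv \<phi> (x + 1) = deriv \<phi> x" for x
  proof -
    have "((\<lambda>x. \<phi> (x + 1)) has_real_derivative deriv \<phi> (x + 1)) (at x)" using D[of "x + 1"] by (simp add: DERIV_shift)
    moreover have "(\<lambda>x. \<phi> (x + 1)) = \<phi>" using assms by (auto simp: circle_test_fun_def)
    ultimately show ?thesis using D[of x] by (metis DERIV_unique)
  qed
  moreover have "(deriv ^^ n) (deriv \<phi>) field_differentiable at x" for n x
    using d[of "Suc n" x] unfolding funpow_Suc_right by simp
  ultimately show "circle_test_fun (deriv \<phi>)" by (simp add: circle_test_fun_def)
qed

lemma circle_test_continuous: "circle_test_fun \<phi> \<Longrightarrow> continuous_on S \<phi>"
  by (intro continuous_at_imp_continuous_on ballI DERIV_isCont[OF circle_test_deriv(1)])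

lemma circle_test_integrable: "circle_test_fun \<phi> \<Longrightarrow> integrable circle_measure \<phi>"
  by (intro continuous_imp_integrable_real circle_test_continuous)

lemma fourier_coeff_deriv:
  assumes \<phi>: "circle_test_fun \<phi>"
  shows "fourier_coeff (deriv \<phi>) k = 2 * pi * \<i> * of_int k * fourier_coeff \<phi> k"
proof -
  note \<phi>' = circle_test_deriv(2)[OF \<phi>]
  let ?c = "2 * pi * \<i> * of_int (- k)"
  let ?G = "\<lambda>x. complex_of_real (\<phi> x) * ee (- k) x"
  let ?g = "\<lambda>x. complex_of_real (\<phi> x) * (?c * ee (- k) x) + complex_of_real (deriv \<phi> x) * ee (- k) x"
  have "(?g has_integral (?G 1 - ?G 0)) {0..1}"
  proof (rule fundamental_theorem_of_calculus)
    fix x :: real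
    have "((\<lambda>x. complex_of_real (\<phi> x)) has_vector_derivative complex_of_real (deriv \<phi> x)) (at x within {0..1})"
      using circle_test_deriv(1)[OF \<phi>, of x]
      by (intro has_vector_derivative_of_real has_vector_derivative_at_within) (simp add: has_real_derivative_iff_has_vector_derivative)
    then show "(?G has_vector_derivative ?g x) (at x within {0..1})"
      by (rule has_vector_derivative_mult[OF _ has_vector_derivative_ee])
  qed simp
  moreover have "?G 1 = ?G 0" using \<phi> ee_periodic[of "- k" 0] unfolding circle_test_fun_def by (metis add_0)
  ultimately have 0: "integral {0..1} ?g = 0" by (simp add: integral_unique)
  have ig: "integrable circle_measure ?g"
    by (intro continuous_imp_integrable_real continuous_intros circle_test_continuous \<phi> \<phi>')
  have "0 = (LINT x|circle_measure. ?g x)" using 0 lebesgue_integral_eq_integral[OF ig] by simp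
  also have "\<dots> = (LINT x|circle_measure. ?c * (complex_of_real (\<phi> x) * ee (- k) x)) + (LINT x|circle_measure. complex_of_real (deriv \<phi> x) * ee (- k) x)"
    using integrable_fourier[OF circle_test_integrable[OF \<phi>], of "- k"] integrable_fourier[OF circle_test_integrable[OF \<phi>'], of "- k"]
    by (subst Bochner_Integration.integral_add[symmetric]) (auto simp: mult_ac)
  also have "\<dots> = ?c * fourier_coeff \<phi> k + fourier_coeff (deriv \<phi>) k" by (simp add: fourier_coeff_ee)
  finally show ?thesis by (simp add: eq_neg_iff_add_eq_0 add.commute)
qed

text \<open>Two integrations by parts give decay \<open>1 / k^2\<close>.\<close>

lemma l1_circle_test:
  assumes \<phi>: "circle_test_fun \<phi>"
  shows "l1 (fourier_coeff \<phi>)"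
proof -
  note \<phi>' = circle_test_deriv(2)[OF \<phi>]
  note \<phi>'' = circle_test_deriv(2)[OF \<phi>']
  define B where "B = (LINT x|circle_measure. \<bar>deriv (deriv \<phi>) x\<bar>)"
  have B: "cmod (fourier_coeff (deriv (deriv \<phi>)) k) \<le> B" for k
    unfolding fourier_coeff_ee B_def by (rule order_trans[OF integral_norm_bound]) (simp add: norm_mult)
  \<comment> \<open>The separate term is for \<open>k = 0\<close>, where \<open>1 / k^2\<close>
    evaluates to 0 and the decay estimate says nothing.\<close>
  have le: "cmod (fourier_coeff \<phi> k) \<le> B * (1 / (real_of_int k)\<^sup>2) + (if k = 0 then cmod (fourier_coeff \<phi> 0) else 0)" for k
  proof (cases "k = 0")
    case False
    have "(2 * pi)\<^sup>2 * (real_of_int k)\<^sup>2 * cmod (fourier_coeff \<phi> k) = cmod (fourier_coeff (deriv (deriv \<phi>)) k)"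
      by (simp add: fourier_coeff_deriv[OF \<phi>'] fourier_coeff_deriv[OF \<phi>] norm_mult power2_eq_square mult_ac)
    also have "\<dots> \<le> B" by (rule B)
    finally have 1: "(2 * pi)\<^sup>2 * ((real_of_int k)\<^sup>2 * cmod (fourier_coeff \<phi> k)) \<le> B" by (simp add: mult.assoc)
    have "1\<^sup>2 \<le> (2 * pi)\<^sup>2" using pi_gt3 by (intro power_mono) auto
    then have "1 * ((real_of_int k)\<^sup>2 * cmod (fourier_coeff \<phi> k)) \<le> (2 * pi)\<^sup>2 * ((real_of_int k)\<^sup>2 * cmod (fourier_coeff \<phi> k))"
      by (intro mult_right_mono) auto
    with 1 have "(real_of_int k)\<^sup>2 * cmod (fourier_coeff \<phi> k) \<le> B" by linarith
    then show ?thesis using False by (simp add: field_simps)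
  qed simp
  have "(\<lambda>k::int. B * (1 / (real_of_int k)\<^sup>2) + (if k = 0 then cmod (fourier_coeff \<phi> 0) else 0)) summable_on UNIV"
    by (intro summable_on_add summable_on_cmult_right summable_inverse_squares_int finite_nonzero_values_imp_summable_on) simp
  then show ?thesis unfolding l1_def by (rule summable_on_comparison_test) (use le in auto)
qed

text \<open>Testing with cosine and sine of frequency \<open>k\<close> yields the real and imaginary
  parts.\<close>

lemma has_weak_deriv_coeff:
  assumes "has_weak_deriv f g"
  shows "fourier_coeff g k = 2 * pi * \<i> * of_int k * fourier_coeff f k"
proof -
  have fg: "integrable circle_measure f" "integrable circle_measure g"
    using assms by (auto simp: has_weak_deriv_def circle_L1_def)
  define C where "C = 2 * pi * real_of_int k"
  have w: "circle_integral (\<lambda>x. f x * deriv (\<lambda>x. A * cos (C * x) + B * sin (C * x)) x) = - circle_integral (\<lambda>x. g x * (A * cos (C * x) + B * sin (C * x)))" for A B :: real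
    using assms circle_test_trig[of A k B] unfolding has_weak_deriv_def C_def by blast
  have 1: "(\<lambda>x. f x * ((0 * C) * cos (C * x) + (- 1 * C) * sin (C * x))) = (\<lambda>x. - C * (f x * sin (C * x)))"
    "(\<lambda>x. f x * ((1 * C) * cos (C * x) + (- 0 * C) * sin (C * x))) = (\<lambda>x. C * (f x * cos (C * x)))"
    by auto
  have c: "circle_integral (\<lambda>x. g x * cos (C * x)) = C * circle_integral (\<lambda>x. f x * sin (C * x))"
    using w[of 1 0] unfolding deriv_trig 1 circle_integral_def by simp
  have s: "circle_integral (\<lambda>x. g x * sin (C * x)) = - (C * circle_integral (\<lambda>x. f x * cos (C * x)))"
    using w[of 0 1] unfolding deriv_trig 1 circle_integral_def by simp
  show ?thesis
    unfolding fourier_coeff_cos_sin[OF fg(1)] fourier_coeff_cos_sin[OF fg(2)] C_def[symmetric] c s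
    by (simp add: complex_eq_iff C_def)
qed

lemma circle_integral_mult_test:
  assumes f: "f \<in> circle_L1" and \<phi>: "circle_test_fun \<phi>"
  shows "((\<lambda>j. fourier_coeff \<phi> j * fourier_coeff f (- j)) has_sum of_real (circle_integral (\<lambda>x. f x * \<phi> x))) UNIV"
proof -
  have fi: "integrable circle_measure f" using f by (simp add: circle_L1_def)
  note l = l1_circle_test[OF \<phi>] and h = herm_fourier_coeff[OF circle_test_integrable[OF \<phi>]]
  have "((\<lambda>j. fourier_coeff \<phi> j * fourier_coeff f (0 - j)) has_sum fourier_coeff (\<lambda>x. fs (fourier_coeff \<phi>) x * f x) 0) UNIV"
    by (rule fourier_coeff_fs_mult[OF l h fi])
  moreover have "fourier_coeff (\<lambda>x. fs (fourier_coeff \<phi>) x * f x) 0 = fourier_coeff (\<lambda>x. f x * \<phi> x) 0"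
  proof (rule fourier_coeff_cong_AE)
    have fm: "f \<in> borel_measurable circle_measure" using fi by auto
    show "(\<lambda>x. fs (fourier_coeff \<phi>) x * f x) \<in> borel_measurable circle_measure" "(\<lambda>x. f x * \<phi> x) \<in> borel_measurable circle_measure"
      using fm continuous_measurable_circle[OF continuous_on_fs[OF l]] continuous_measurable_circle[OF circle_test_continuous[OF \<phi>]]
      by (auto intro: borel_measurable_times)
    show "AE x in circle_measure. fs (fourier_coeff \<phi>) x * f x = f x * \<phi> x"
      using ae_eq_fs[OF circle_test_integrable[OF \<phi>] l] unfolding circle_ae_eq_def by eventually_elim simp
  qed
  ultimately show ?thesis by (simp add: fourier_coeff_0)
qed

text \<open>Converse of \<open>has_weak_deriv_coeff\<close>: the Parseval pairing of an integrable
  function with a test function moves the factor \<open>2 * pi * \<i> * k\<close> from one to the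
  other. Weak differentiation thus becomes a statement about coefficients.\<close>

lemma has_weak_derivI:
  assumes f: "f \<in> circle_L1" and g: "g \<in> circle_L1"
    and c: "\<And>k. fourier_coeff g k = 2 * pi * \<i> * of_int k * fourier_coeff f k"
  shows "has_weak_deriv f g"
  unfolding has_weak_deriv_def
proof (intro conjI f g allI impI)
  fix \<phi> assume \<phi>: "circle_test_fun \<phi>"
  have "fourier_coeff (deriv \<phi>) j * fourier_coeff f (- j) = - (fourier_coeff \<phi> j * fourier_coeff g (- j))" for j
    by (simp add: fourier_coeff_deriv[OF \<phi>] c)
  then have "((\<lambda>j. - (fourier_coeff \<phi> j * fourier_coeff g (- j))) has_sum of_real (circle_integral (\<lambda>x. f x * deriv \<phi> x))) UNIV"
    using circle_integral_mult_test[OF f circle_test_deriv(2)[OF \<phi>]] by simp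
  moreover have "((\<lambda>j. - (fourier_coeff \<phi> j * fourier_coeff g (- j))) has_sum - of_real (circle_integral (\<lambda>x. g x * \<phi> x))) UNIV"
    by (intro has_sum_uminusI circle_integral_mult_test[OF g \<phi>])
  ultimately have "complex_of_real (circle_integral (\<lambda>x. f x * deriv \<phi> x)) = - complex_of_real (circle_integral (\<lambda>x. g x * \<phi> x))"
    by (rule has_sum_unique)
  then show "circle_integral (\<lambda>x. f x * deriv \<phi> x) = - circle_integral (\<lambda>x. g x * \<phi> x)"
    by (metis of_real_eq_iff of_real_minus)
qed

section \<open>The Sobolev weight and its relation to the norms\<close>

definition ws :: "real \<Rightarrow> int \<Rightarrow> real" where "ws s k = (1 + (2 * pi * real_of_int k)\<^sup>2) powr s"

lemma ws_nonneg: "0 \<le> ws s k" by (simp add: ws_def)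
lemma ws_ge_1: "0 \<le> s \<Longrightarrow> 1 \<le> ws s k" by (simp add: ws_def ge_one_powr_ge_zero)
lemma ws_mono: "s \<le> s' \<Longrightarrow> ws s k \<le> ws s' k" by (simp add: ws_def powr_mono)

lemma int_sq_le: "(real_of_int k)\<^sup>2 \<le> 1 + (2 * pi * real_of_int k)\<^sup>2"
proof -
  have "1\<^sup>2 \<le> (2 * pi)\<^sup>2" using pi_gt3 by (intro power_mono) auto
  then have "1 * (real_of_int k)\<^sup>2 \<le> (2 * pi)\<^sup>2 * (real_of_int k)\<^sup>2" by (intro mult_right_mono) auto
  then show ?thesis by (simp add: power_mult_distrib)
qed

lemma ws_shift: "(real_of_int k)\<^sup>2 * ws (s - 1) k \<le> ws s k"
proof -
  have "(real_of_int k)\<^sup>2 * ws (s - 1) k \<le> (1 + (2 * pi * real_of_int k)\<^sup>2) * ws (s - 1) k"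
    by (intro mult_right_mono int_sq_le ws_nonneg)
  also have "\<dots> = ws s k" unfolding ws_def by (subst powr_mult_base) auto
  finally show ?thesis .
qed

lemma ws_p4: "2 \<le> s \<Longrightarrow> real_of_int k ^ 4 \<le> ws s k"
proof -
  assume s: "2 \<le> s"
  have "real_of_int k ^ 4 = ((real_of_int k)\<^sup>2)\<^sup>2" by simp
  also have "\<dots> \<le> (1 + (2 * pi * real_of_int k)\<^sup>2)\<^sup>2" by (intro power_mono int_sq_le) auto
  also have "\<dots> = ws 2 k" unfolding ws_def by (subst powr_numeral) (auto simp: add_pos_nonneg)
  also have "\<dots> \<le> ws s k" by (rule ws_mono[OF s])
  finally show ?thesis .
qed

text \<open>The weight grows like \<open>|k|\<close> to the power \<open>2 * s\<close>: with
  \<open>q = |k| / |j|\<close> one has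
  \<open>1 + (2 * pi * k)^2 \<le> (1 + (2 * pi * j)^2) * q^2\<close>. Rounding up gives an integer
  exponent, and the added 1 keeps it positive, so that the left side of the growth condition is 0 at
  \<open>j = 0\<close>.\<close>

lemma weight_ws:
  assumes s: "0 \<le> s"
  shows "weight (nat \<lceil>2 * s\<rceil> + 1) (ws s)"
  unfolding weight_def
proof (intro conjI allI impI)
  show "0 \<le> ws s k" for k by (rule ws_nonneg)
  fix j k :: int assume le: "\<bar>j\<bar> \<le> \<bar>k\<bar>"
  let ?x = "\<bar>real_of_int j\<bar>" and ?y = "\<bar>real_of_int k\<bar>"
  have xy: "?x \<le> ?y" using le by linarith
  then have sq: "(real_of_int j)\<^sup>2 \<le> (real_of_int k)\<^sup>2" by (simp add: abs_le_square_iff)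
  show "ws s j \<le> ws s k"
    unfolding ws_def using s sq by (intro powr_mono2) (auto simp: power_mult_distrib intro!: mult_left_mono add_nonneg_nonneg)
  show "ws s k * real_of_int \<bar>j\<bar> ^ (nat \<lceil>2 * s\<rceil> + 1) \<le> ws s j * real_of_int \<bar>k\<bar> ^ (nat \<lceil>2 * s\<rceil> + 1)"
  proof (cases "j = 0")
    case False
    let ?p = "nat \<lceil>2 * s\<rceil> + 1"
    define q where "q = ?y / ?x"
    have x0: "0 < ?x" using False by simp
    have q1: "1 \<le> q" using xy x0 by (simp add: q_def)
    have "1 + (2 * pi * real_of_int k)\<^sup>2 \<le> (1 + (2 * pi * real_of_int j)\<^sup>2) * q\<^sup>2"
    proof -
      have "(2 * pi * real_of_int j)\<^sup>2 * q\<^sup>2 = (2 * pi * real_of_int k)\<^sup>2"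
        using False by (simp add: q_def power_mult_distrib power_divide)
      moreover have "1\<^sup>2 \<le> q\<^sup>2" using q1 by (intro power_mono) auto
      ultimately show ?thesis by (simp add: distrib_right)
    qed
    then have "ws s k \<le> ((1 + (2 * pi * real_of_int j)\<^sup>2) * q\<^sup>2) powr s"
      unfolding ws_def using s by (intro powr_mono2) (auto intro: add_nonneg_nonneg)
    also have "\<dots> = ws s j * (q powr (2 * s))"
      unfolding ws_def using q1 by (subst powr_mult) (auto simp: powr_powr simp flip: powr_numeral)
    also have "q powr (2 * s) \<le> q powr (real ?p)" using q1 s by (intro powr_mono) (auto, linarith)
    also have "q powr (real ?p) = q ^ ?p" using q1 by (subst powr_realpow) auto
    finally have "ws s k \<le> ws s j * q ^ ?p" using ws_nonneg by (simp add: mult_left_mono)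
    then have "ws s k * ?x ^ ?p \<le> ws s j * q ^ ?p * ?x ^ ?p" by (intro mult_right_mono) auto
    also have "\<dots> = ws s j * (q * ?x) ^ ?p" by (simp add: power_mult_distrib mult.assoc)
    also have "q * ?x = ?y" using x0 by (simp add: q_def)
    finally show ?thesis by simp
  qed (simp add: ws_nonneg)
qed

lemma sobolev_term_ws: "sobolev_term s f k = ws s k * (cmod (fourier_coeff f k))\<^sup>2"
  by (simp add: sobolev_term_def ws_def)

lemma hb_summable:
  assumes "hb V a A" "\<And>k. 0 \<le> V k"
  shows "(\<lambda>k. V k * (cmod (a k))\<^sup>2) summable_on UNIV" and "(\<Sum>\<^sub>\<infinity>k. V k * (cmod (a k))\<^sup>2) \<le> A"
proof -
  show s: "(\<lambda>k. V k * (cmod (a k))\<^sup>2) summable_on UNIV"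
    by (rule nonneg_bdd_above_summable_on) (auto intro!: bdd_aboveI2[of _ _ A] hbD[OF assms(1)] simp: assms(2))
  show "(\<Sum>\<^sub>\<infinity>k. V k * (cmod (a k))\<^sup>2) \<le> A"
    by (rule infsum_le_finite_sums[OF s]) (rule hbD[OF assms(1)])
qed

lemma sobolev_hb: "f \<in> sobolev s \<Longrightarrow> hb (ws s) (fourier_coeff f) ((sobolev_norm s f)\<^sup>2)"
  unfolding hb_def
proof safe
  fix K :: "int set" assume f: "f \<in> sobolev s" and K: "finite K"
  have sm: "sobolev_term s f summable_on UNIV" using f by (simp add: sobolev_def)
  have nn: "0 \<le> sobolev_term s f k" for k by (simp add: sobolev_term_ws ws_nonneg)
  have "(\<Sum>k\<in>K. ws s k * (cmod (fourier_coeff f k))\<^sup>2) = sum (sobolev_term s f) K" by (simp add: sobolev_term_ws)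
  also have "\<dots> \<le> (\<Sum>\<^sub>\<infinity>k. sobolev_term s f k)" by (rule finite_sum_le_infsum[OF sm K]) (auto simp: nn)
  also have "\<dots> = (sobolev_norm s f)\<^sup>2" unfolding sobolev_norm_def by (simp add: infsum_nonneg nn)
  finally show "(\<Sum>k\<in>K. ws s k * (cmod (fourier_coeff f k))\<^sup>2) \<le> (sobolev_norm s f)\<^sup>2" .
qed

lemma sobolevI: "f \<in> circle_L2 \<Longrightarrow> hb (ws s) (fourier_coeff f) A \<Longrightarrow> f \<in> sobolev s"
  unfolding sobolev_def using hb_summable(1)[OF _ ws_nonneg] by (simp add: sobolev_term_ws[abs_def])

lemma sobolev_norm_le: "hb (ws s) (fourier_coeff f) A \<Longrightarrow> sobolev_norm s f \<le> sqrt A"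
  unfolding sobolev_norm_def using hb_summable(2)[OF _ ws_nonneg] by (simp add: sobolev_term_ws[abs_def])

lemma sobolev_L1: "f \<in> sobolev s \<Longrightarrow> f \<in> circle_L1" by (simp add: sobolev_def circle_L2_L1)

lemma sobolev_integrable: "f \<in> sobolev s \<Longrightarrow> integrable circle_measure f"
  using sobolev_L1 circle_L1_integrable by blast

lemma sobolev_norm_nonneg: "0 \<le> sobolev_norm s f"
  unfolding sobolev_norm_def by (simp add: infsum_nonneg sobolev_term_ws ws_nonneg)

lemma hb_l1:
  assumes "hb (\<lambda>k. (real_of_int k)\<^sup>2) a A" "a 0 = 0"
  shows "l1 a"
  unfolding l1_def
  by (rule nonneg_bdd_above_summable_on) (auto intro!: bdd_aboveI2[of _ _ "sqrt (zsum * A)"] l1_bound[OF assms])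

subsection \<open>The solution map\<close>

lemma circle_fun_comb:
  assumes "circle_fun f" "circle_fun g"
  shows "circle_fun (\<lambda>x. f x - g x)" and "circle_fun (\<lambda>x. f x + g x)" and "circle_fun (\<lambda>x. f x * g x)"
    and "circle_fun (\<lambda>x. f x / c)" and "circle_fun (\<lambda>x. c * f x)"
  using assms by (auto simp: circle_fun_def)

lemma circle_L2_diff:
  assumes "f \<in> circle_L2" "g \<in> circle_L2"
  shows "(\<lambda>x. f x - g x) \<in> circle_L2"
proof -
  have fg: "circle_fun f" "circle_fun g" "integrable circle_measure (\<lambda>x. (f x)\<^sup>2)" "integrable circle_measure (\<lambda>x. (g x)\<^sup>2)"
    using assms by (auto simp: circle_L2_def)
  have "integrable circle_measure (\<lambda>x. (f x - g x)\<^sup>2)"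
  proof (rule Bochner_Integration.integrable_bound)
    show "integrable circle_measure (\<lambda>x. 2 * (f x)\<^sup>2 + 2 * (g x)\<^sup>2)" using fg by simp
    show "(\<lambda>x. (f x - g x)\<^sup>2) \<in> borel_measurable circle_measure"
      using circle_fun_measurable[OF circle_fun_comb(1)[OF fg(1,2)]] by simp
    have "(a - b)\<^sup>2 \<le> 2 * a\<^sup>2 + 2 * b\<^sup>2" for a b :: real
      using zero_le_power2[of "a + b"] by (simp add: power2_sum power2_diff)
    then show "AE x in circle_measure. norm ((f x - g x)\<^sup>2) \<le> norm (2 * (f x)\<^sup>2 + 2 * (g x)\<^sup>2)" by (intro AE_I2) simp
  qed
  then show ?thesis using circle_fun_comb(1)[OF fg(1,2)] by (simp add: circle_L2_def)
qed

lemma circle_L2_divide: "f \<in> circle_L2 \<Longrightarrow> (\<lambda>x. f x / c) \<in> circle_L2"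
  by (auto simp: circle_L2_def power_divide intro: circle_fun_comb)

lemma fourier_coeff_sobolev_diff:
  "f \<in> sobolev s \<Longrightarrow> g \<in> sobolev s' \<Longrightarrow> fourier_coeff (\<lambda>x. f x - g x) = (\<lambda>k. fourier_coeff f k - fourier_coeff g k)"
  by (intro ext fourier_coeff_diff sobolev_integrable)

lemma sobolev_diff:
  assumes "f \<in> sobolev s" "g \<in> sobolev s"
  shows "(\<lambda>x. f x - g x) \<in> sobolev s"
proof (rule sobolevI)
  show "(\<lambda>x. f x - g x) \<in> circle_L2" using assms by (intro circle_L2_diff) (auto simp: sobolev_def)
  show "hb (ws s) (fourier_coeff (\<lambda>x. f x - g x)) (2 * (sobolev_norm s f)\<^sup>2 + 2 * (sobolev_norm s g)\<^sup>2)"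
    unfolding fourier_coeff_sobolev_diff[OF assms] by (intro hb_diff sobolev_hb assms ws_nonneg)
qed

lemma hb_sobolev_diff:
  assumes "f \<in> sobolev s" "g \<in> sobolev s"
  shows "hb (ws s) (\<lambda>k. fourier_coeff f k - fourier_coeff g k) ((sobolev_norm s (\<lambda>x. f x - g x))\<^sup>2)"
  using sobolev_hb[OF sobolev_diff[OF assms]] by (simp add: fourier_coeff_sobolev_diff[OF assms])

lemma sobolev_norm_coeff_le:
  assumes "0 \<le> s" "f \<in> sobolev s"
  shows "cmod (fourier_coeff f k) \<le> sobolev_norm s f"
proof -
  have "1 * (cmod (fourier_coeff f k))\<^sup>2 \<le> ws s k * (cmod (fourier_coeff f k))\<^sup>2"
    by (intro mult_right_mono ws_ge_1 assms) auto
  also have "\<dots> \<le> (sobolev_norm s f)\<^sup>2" by (rule hb_single[OF sobolev_hb[OF assms(2)]])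
  finally have "(cmod (fourier_coeff f k))\<^sup>2 \<le> (sobolev_norm s f)\<^sup>2" by simp
  then show ?thesis by (rule power2_le_imp_le[OF _ sobolev_norm_nonneg])
qed

text \<open>Fourier form of \<open>u * u_x = (u^2)_x / 2\<close>: exchanging the factors replaces
  the frequency \<open>k - j\<close> by \<open>j\<close>, and the two add up to
  \<open>k\<close>.\<close>

lemma conv_times_freq:
  assumes a: "hb (\<lambda>_. 1) a A" and b: "hb (\<lambda>_. 1) (\<lambda>k. of_int k * a k) B"
  shows "conv a (\<lambda>k. of_int k * a k) k = of_int k / 2 * conv a a k"
proof -
  have "conv a (\<lambda>k. of_int k * a k) k + conv (\<lambda>k. of_int k * a k) a k = (\<Sum>\<^sub>\<infinity>j. a j * (of_int (k - j) * a (k - j)) + of_int j * a j * a (k - j))"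
    unfolding conv_def by (rule infsum_add[symmetric, OF conv_summable[OF a b] conv_summable[OF b a]])
  also have "\<dots> = (\<Sum>\<^sub>\<infinity>j. of_int k * (a j * a (k - j)))" by (intro infsum_cong) (simp add: algebra_simps)
  also have "\<dots> = of_int k * conv a a k" unfolding conv_def by (rule infsum_cmult_right')
  finally show ?thesis using conv_commute[of a "\<lambda>k. of_int k * a k" k] by (simp add: mult.commute)
qed

lemma hsol_cong:
  assumes a: "hsol \<gamma> W S a" and eq: "\<And>t. t \<in> {0..S} \<Longrightarrow> b t = a t"
  shows "hsol \<gamma> W S b"
  unfolding hsol_def
proof (intro conjI ballI allI)
  show "herm (b t)" "b t 0 = 0" if "t \<in> {0..S}" for t using hsolD[OF a] eq that by auto
  show "\<exists>M. \<forall>t\<in>{0..S}. hb W (b t) M" using a eq by (auto simp: hsol_def)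
  show "continuous_on {0..S} (\<lambda>t. b t k)" for k
    using hsolD(3)[OF a, of k] by (rule continuous_on_eq) (simp add: eq)
  show "((\<lambda>t. b t k) has_vector_derivative ost \<gamma> (b t) k) (at t)" if t: "t \<in> {0<..<S}" for t k
  proof -
    have "((\<lambda>t. b t k) has_vector_derivative ost \<gamma> (a t) k) (at t)"
      by (rule has_vector_derivative_transform_within_open[OF hsolD(4)[OF a t], of "{0<..<S}"]) (use t eq in auto)
    then show ?thesis using eq[of t] t by simp
  qed
qed

text \<open>The scalar mean value theorem is applied to the inner product with the difference quotient itself.\<close>

lemma mean_value_hb:
  assumes a: "hsol \<gamma> W S a" and t: "t \<in> {0..S}" "\<tau> \<in> {0..S}" "\<tau> \<noteq> t" and V: "\<And>k. 0 \<le> V k"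
    and le: "\<And>\<xi>. min t \<tau> < \<xi> \<Longrightarrow> \<xi> < max t \<tau> \<Longrightarrow> hb V (\<lambda>k. ost \<gamma> (a \<xi>) k - ost \<gamma> (a t) k) \<epsilon>"
  shows "hb V (\<lambda>k. (a \<tau> k - a t k) / of_real (\<tau> - t) - ost \<gamma> (a t) k) \<epsilon>"
  unfolding hb_def
proof safe
  fix K :: "int set" assume K: "finite K"
  define z where "z k = (a \<tau> k - a t k) / of_real (\<tau> - t) - ost \<gamma> (a t) k" for k
  define \<Psi> where "\<Psi> \<sigma> = (\<Sum>k\<in>K. V k * Re (cnj (z k) * (a \<sigma> k - of_real \<sigma> * ost \<gamma> (a t) k)))" for \<sigma>
  have lohi: "min t \<tau> < max t \<tau>" "0 \<le> min t \<tau>" "max t \<tau> \<le> S" using t by auto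
  have der: "(\<Psi> has_real_derivative (\<Sum>k\<in>K. V k * Re (cnj (z k) * (ost \<gamma> (a \<xi>) k - ost \<gamma> (a t) k)))) (at \<xi>)"
    if "min t \<tau> < \<xi>" "\<xi> < max t \<tau>" for \<xi>
    unfolding \<Psi>_def
  proof (intro DERIV_sum DERIV_cmult)
    fix k
    have "\<xi> \<in> {0<..<S}" using that lohi by auto
    from hsolD(4)[OF a this, of k]
    have "((\<lambda>\<sigma>. a \<sigma> k - of_real \<sigma> * ost \<gamma> (a t) k) has_vector_derivative ost \<gamma> (a \<xi>) k - 1 * ost \<gamma> (a t) k) (at \<xi>)"
      by (intro has_vector_derivative_diff has_vector_derivative_mult_left) (auto intro!: derivative_eq_intros)
    from bounded_linear.has_vector_derivative[OF bounded_linear_compose[OF bounded_linear_Re bounded_linear_mult_right] this, of "cnj (z k)"]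
    show "((\<lambda>\<sigma>. Re (cnj (z k) * (a \<sigma> k - of_real \<sigma> * ost \<gamma> (a t) k))) has_real_derivative Re (cnj (z k) * (ost \<gamma> (a \<xi>) k - ost \<gamma> (a t) k))) (at \<xi>)"
      by (simp only: has_real_derivative_iff_has_vector_derivative mult_1)
  qed
  have cont: "continuous_on {min t \<tau>..max t \<tau>} \<Psi>"
    unfolding \<Psi>_def using lohi by (intro continuous_intros continuous_on_subset[OF hsolD(3)[OF a]]) auto
  obtain l \<xi> where \<xi>: "min t \<tau> < \<xi>" "\<xi> < max t \<tau>" "(\<Psi> has_real_derivative l) (at \<xi>)"
    "\<Psi> (max t \<tau>) - \<Psi> (min t \<tau>) = (max t \<tau> - min t \<tau>) * l"
    using MVT[OF lohi(1) cont] der by (auto simp: real_differentiable_def)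
  define d where "d k = ost \<gamma> (a \<xi>) k - ost \<gamma> (a t) k" for k
  have l: "l = (\<Sum>k\<in>K. V k * Re (cnj (z k) * d k))" using DERIV_unique[OF \<xi>(3) der[OF \<xi>(1,2)]] by (simp add: d_def)
  have "\<Psi> \<tau> - \<Psi> t = (\<tau> - t) * (\<Sum>k\<in>K. V k * (cmod (z k))\<^sup>2)"
    unfolding \<Psi>_def sum_subtractf[symmetric] sum_distrib_left
  proof (rule sum.cong[OF refl])
    fix k
    have "a \<tau> k - a t k = of_real (\<tau> - t) * (z k + ost \<gamma> (a t) k)" using t by (simp add: z_def)
    then have AB: "a \<tau> k = a t k + of_real (\<tau> - t) * (z k + ost \<gamma> (a t) k)" by (simp add: diff_eq_eq add.commute)
    have "cnj (z k) * (a \<tau> k - of_real \<tau> * ost \<gamma> (a t) k) - cnj (z k) * (a t k - of_real t * ost \<gamma> (a t) k) = of_real (\<tau> - t) * (cnj (z k) * z k)"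
      unfolding AB of_real_diff by algebra
    then have "Re (cnj (z k) * (a \<tau> k - of_real \<tau> * ost \<gamma> (a t) k)) - Re (cnj (z k) * (a t k - of_real t * ost \<gamma> (a t) k)) = Re (of_real (\<tau> - t) * (cnj (z k) * z k))"
      by (metis minus_complex.sel(1))
    also have "cnj (z k) * z k = of_real ((cmod (z k))\<^sup>2)" using complex_norm_square[of "z k"] by (simp add: mult.commute)
    also have "Re (of_real (\<tau> - t) * of_real ((cmod (z k))\<^sup>2)) = (\<tau> - t) * (cmod (z k))\<^sup>2" by (simp only: of_real_mult[symmetric] Re_complex_of_real)
    finally show "V k * Re (cnj (z k) * (a \<tau> k - of_real \<tau> * ost \<gamma> (a t) k)) - V k * Re (cnj (z k) * (a t k - of_real t * ost \<gamma> (a t) k)) = (\<tau> - t) * (V k * (cmod (z k))\<^sup>2)"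
      by (simp only: right_diff_distrib[symmetric] mult.left_commute)
  qed
  moreover have "\<Psi> \<tau> - \<Psi> t = (\<tau> - t) * l" using \<xi>(4) by (cases "t \<le> \<tau>") (auto simp: min_def max_def algebra_simps)
  ultimately have zl: "(\<Sum>k\<in>K. V k * (cmod (z k))\<^sup>2) = l" using t(3) by simp
  have "2 * l \<le> (\<Sum>k\<in>K. V k * (cmod (z k))\<^sup>2) + (\<Sum>k\<in>K. V k * (cmod (d k))\<^sup>2)"
    unfolding l sum.distrib[symmetric] sum_distrib_left
  proof (rule sum_mono)
    fix k
    show "2 * (V k * Re (cnj (z k) * d k)) \<le> V k * (cmod (z k))\<^sup>2 + V k * (cmod (d k))\<^sup>2"
      using mult_left_mono[OF two_Re_le[of "z k" "d k"] V[of k]] by (simp add: algebra_simps)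
  qed
  then have "(\<Sum>k\<in>K. V k * (cmod (z k))\<^sup>2) \<le> (\<Sum>k\<in>K. V k * (cmod (d k))\<^sup>2)" using zl by simp
  also have "\<dots> \<le> \<epsilon>" unfolding d_def by (rule hbD[OF le[OF \<xi>(1,2)] K])
  finally show "(\<Sum>k\<in>K. V k * (cmod ((a \<tau> k - a t k) / of_real (\<tau> - t) - ost \<gamma> (a t) k))\<^sup>2) \<le> \<epsilon>" by (simp add: z_def)
qed

text \<open>The life span is half-open and possibly infinite, whereas the estimates live on compact
  intervals; a limit at \<open>t\<close> only sees times below \<open>S\<close>.\<close>

lemma at_within_life_span:
  assumes "0 \<le> t" "t < S" "ereal S < T"
  shows "at t within life_span T = at t within {0..S}"
proof (rule at_within_nhd[of _ "{..<S}"])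
  have "\<tau> \<in> life_span T" if "0 \<le> \<tau>" "\<tau> < S" for \<tau>
    using that assms(3) unfolding life_span_def by (simp, meson ereal_less_le less_ereal.simps(1) less_imp_le order_less_trans)
  then show "life_span T \<inter> {..<S} - {t} = {0..S} \<inter> {..<S} - {t}" by (auto simp: life_span_def)
qed (use assms in auto)

lemma life_span_dense: "t \<in> life_span T \<Longrightarrow> \<exists>S>t. ereal S < T"
  unfolding life_span_def using ereal_dense2[of "ereal t" T] by auto

section \<open>From solutions in Fourier variables to weak solutions\<close>

locale ostrovsky =
  fixes \<gamma> s :: real
  assumes \<gamma>: "\<gamma> > 0" and s: "s \<ge> 2"

sublocale ostrovsky \<subseteq> sobolev_weight "nat \<lceil>2 * s\<rceil> + 1" "ws s" \<gamma>
  using s by unfold_locales (auto intro: weight_ws ws_p4 simp del: One_nat_def)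

context ostrovsky
begin

abbreviation "hs \<equiv> hsol \<gamma> (ws s)"

lemma hb_sq: "hb (ws s) a A \<Longrightarrow> hb (\<lambda>k. (real_of_int k)\<^sup>2) a A"
  by (intro hb_sq_p4 hb_p4)

lemma l1_ws: "hb (ws s) a A \<Longrightarrow> a 0 = 0 \<Longrightarrow> l1 a"
  by (rule hb_l1[OF hb_sq])

lemma hb_ws_pred: "hb (ws s) a A \<Longrightarrow> hb (ws (s - 1)) a A"
  by (erule hb_weight_mono) (rule ws_mono, simp)

lemma hb_sq_pred: "hb (ws (s - 1)) a A \<Longrightarrow> hb (\<lambda>k. (real_of_int k)\<^sup>2) a A"
proof (erule hb_weight_mono)
  fix k
  have "(real_of_int k)\<^sup>2 \<le> ws 1 k" using int_sq_le[of k] by (simp add: ws_def add_nonneg_nonneg)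
  also have "\<dots> \<le> ws (s - 1) k" using s by (intro ws_mono) auto
  finally show "(real_of_int k)\<^sup>2 \<le> ws (s - 1) k" .
qed

lemma ost_0: "ost \<gamma> a 0 = 0" by (simp add: ost_def)

text \<open>The factor \<open>pi^2\<close> belongs to the derivative in the nonlinearity; the 4
  arises from two applications of the inequality for the square of a sum.\<close>

definition ost_const :: real where "ost_const = 4 * pi\<^sup>2 * alg_const (nat \<lceil>2 * s\<rceil> + 1)"

lemma ost_const_nonneg: "0 \<le> ost_const" by (simp add: ost_const_def alg_const_nonneg)

text \<open>The field is locally Lipschitz from \<open>H^s\<close> to \<open>H^(s-1)\<close>: the
  difference of squares factors into products estimated by the algebra property, and the frequency
  factor is paid by \<open>ws_shift\<close>.\<close>

lemma hb_ost_diff: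
  assumes a: "hb (ws s) a A" "a 0 = 0" and b: "hb (ws s) b B" "b 0 = 0" and d: "hb (ws s) (\<lambda>k. a k - b k) D"
  shows "hb (ws (s - 1)) (\<lambda>k. ost \<gamma> a k - ost \<gamma> b k) ((ost_const * (A + B) + 2 * \<gamma>\<^sup>2) * D)"
proof -
  let ?d = "\<lambda>k. a k - b k" and ?C = "alg_const (nat \<lceil>2 * s\<rceil> + 1)"
  have d0: "?d 0 = 0" using a b by simp
  have wsq: "(real_of_int k)\<^sup>2 \<le> ws s k" for k using order_trans[OF sq_le_p4 W4] .
  have "hb (ws s) (\<lambda>k. conv ?d a k + conv ?d b k) (2 * (?C * (D * A)) + 2 * (?C * (D * B)))"
    by (intro hb_add W_nonneg hb_conv[OF W wsq d d0 a] hb_conv[OF W wsq d d0 b])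
  then have "hb (ws (s - 1)) (\<lambda>k. - (\<i> * of_real (pi * k)) * (conv ?d a k + conv ?d b k)) (pi\<^sup>2 * (2 * (?C * (D * A)) + 2 * (?C * (D * B))))"
  proof (rule hb_dominate)
    fix k :: int
    have "ws (s - 1) k * (cmod (- (\<i> * of_real (pi * k)) * (conv ?d a k + conv ?d b k)))\<^sup>2
      = pi\<^sup>2 * (((real_of_int k)\<^sup>2 * ws (s - 1) k) * (cmod (conv ?d a k + conv ?d b k))\<^sup>2)"
      by (simp add: norm_mult power_mult_distrib mult_ac)
    also have "\<dots> \<le> pi\<^sup>2 * (ws s k * (cmod (conv ?d a k + conv ?d b k))\<^sup>2)"
      by (intro mult_left_mono mult_right_mono ws_shift) auto
    finally show "ws (s - 1) k * (cmod (- (\<i> * of_real (pi * k)) * (conv ?d a k + conv ?d b k)))\<^sup>2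
       \<le> pi\<^sup>2 * (ws s k * (cmod (conv ?d a k + conv ?d b k))\<^sup>2)" .
  qed simp
  moreover have "hb (ws (s - 1)) (\<lambda>k. \<i> * of_real (\<gamma> / (2 * pi * k)) * ?d k) (\<gamma>\<^sup>2 * D)"
  proof (rule hb_dominate[OF d])
    fix k :: int
    have "\<bar>\<gamma> / (2 * pi * k)\<bar> \<le> \<bar>\<gamma>\<bar>" by (rule abs_divide_freq_le)
    then have "\<bar>\<gamma> / (2 * pi * k)\<bar>\<^sup>2 \<le> \<bar>\<gamma>\<bar>\<^sup>2" by (intro power_mono) auto
    then have g: "(\<gamma> / (2 * pi * k))\<^sup>2 \<le> \<gamma>\<^sup>2" by (simp only: power2_abs)
    have "ws (s - 1) k * (cmod (\<i> * of_real (\<gamma> / (2 * pi * k)) * ?d k))\<^sup>2 = (\<gamma> / (2 * pi * k))\<^sup>2 * (ws (s - 1) k * (cmod (?d k))\<^sup>2)"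
      by (simp only: norm_mult norm_of_real norm_ii power_mult_distrib power2_abs mult_1 mult_ac power_one)
    also have "\<dots> \<le> \<gamma>\<^sup>2 * (ws s k * (cmod (?d k))\<^sup>2)"
      by (intro mult_mono mult_right_mono g ws_mono) (auto simp: ws_nonneg)
    finally show "ws (s - 1) k * (cmod (\<i> * of_real (\<gamma> / (2 * pi * k)) * ?d k))\<^sup>2 \<le> \<gamma>\<^sup>2 * (ws s k * (cmod (?d k))\<^sup>2)" .
  qed simp
  ultimately have "hb (ws (s - 1)) (\<lambda>k. - (\<i> * of_real (pi * k)) * (conv ?d a k + conv ?d b k) - \<i> * of_real (\<gamma> / (2 * pi * k)) * ?d k)
     (2 * (pi\<^sup>2 * (2 * (?C * (D * A)) + 2 * (?C * (D * B)))) + 2 * (\<gamma>\<^sup>2 * D))"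
    by (rule hb_diff) (rule ws_nonneg)
  moreover have "- (\<i> * of_real (pi * k)) * (conv ?d a k + conv ?d b k) - \<i> * of_real (\<gamma> / (2 * pi * k)) * ?d k = ost \<gamma> a k - ost \<gamma> b k" for k
    unfolding conv_square_diff[OF hb_1[OF a] hb_1[OF b], symmetric] ost_def by algebra
  moreover have "2 * (pi\<^sup>2 * (2 * (?C * (D * A)) + 2 * (?C * (D * B)))) + 2 * (\<gamma>\<^sup>2 * D) = (ost_const * (A + B) + 2 * \<gamma>\<^sup>2) * D"
    by (simp add: ost_const_def algebra_simps)
  ultimately show ?thesis by simp
qed

lemma hb_ost:
  assumes a: "hb (ws s) a A" "a 0 = 0"
  shows "hb (ws (s - 1)) (ost \<gamma> a) ((ost_const * A + 2 * \<gamma>\<^sup>2) * A)"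
proof -
  have "hb (ws s) (\<lambda>_. 0) 0" by (simp add: hb_def)
  from hb_ost_diff[OF a this] a show ?thesis by (simp add: ost_zero)
qed

lemma l1_ost: "hb (ws s) a A \<Longrightarrow> a 0 = 0 \<Longrightarrow> l1 (ost \<gamma> a)"
  using hb_l1[OF hb_sq_pred[OF hb_ost]] ost_0 by blast

lemma herm_ost': "herm a \<Longrightarrow> herm (ost \<gamma> a)"
  using herm_ost by (simp add: herm_def[of "ost \<gamma> a"])

lemma data_coeffs:
  assumes "u0 \<in> sobolev_mean_zero s"
  shows "herm (fourier_coeff u0)" "fourier_coeff u0 0 = 0" "hb (ws s) (fourier_coeff u0) ((sobolev_norm s u0)\<^sup>2)" "u0 \<in> sobolev s"
  using assms by (auto simp: sobolev_mean_zero_def fourier_coeff_0 intro: herm_fourier_coeff sobolev_integrable sobolev_hb)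

lemma fs_sobolev:
  assumes "hb (ws r) a A" "herm a" "l1 a"
  shows "fs a \<in> sobolev r"
proof (rule sobolevI)
  have "fourier_coeff (fs a) = a" using fourier_coeff_fs[OF assms(3,2)] by auto
  then show "hb (ws r) (fourier_coeff (fs a)) A" using assms by simp
  show "fs a \<in> circle_L2" by (rule fs_L2[OF assms(3)])
qed

lemma sobolev_tendstoI:
  fixes f :: "real \<Rightarrow> real \<Rightarrow> real"
  assumes "\<And>\<epsilon>. 0 < \<epsilon> \<Longrightarrow> \<forall>\<^sub>F \<tau> in F. hb (ws r) (fourier_coeff (f \<tau>)) \<epsilon>"
  shows "((\<lambda>\<tau>. sobolev_norm r (f \<tau>)) \<longlongrightarrow> 0) F"
proof (rule tendstoI)
  fix e :: real assume e: "0 < e"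
  then have "0 < (e / 2)\<^sup>2" by simp
  from assms[OF this] show "\<forall>\<^sub>F \<tau> in F. dist (sobolev_norm r (f \<tau>)) 0 < e"
  proof eventually_elim
    case (elim \<tau>)
    have "sobolev_norm r (f \<tau>) \<le> e / 2" using sobolev_norm_le[OF elim] e by simp
    then show ?case using e sobolev_norm_nonneg[of r "f \<tau>"] by simp
  qed
qed

lemma hs_ost_continuous:
  assumes a: "hs S a" and t: "t \<in> {0..S}" and \<epsilon>: "0 < \<epsilon>"
  shows "\<forall>\<^sub>F \<tau> in at t within {0..S}. hb (ws (s - 1)) (\<lambda>k. ost \<gamma> (a \<tau>) k - ost \<gamma> (a t) k) \<epsilon>"
proof -
  obtain M where M: "\<And>t. t \<in> {0..S} \<Longrightarrow> hb (ws s) (a t) M" using hsol_M[OF a] by blast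
  define C where "C = ost_const * (M + M) + 2 * \<gamma>\<^sup>2 + 1"
  have M0: "0 \<le> M" using hb_bound_nonneg[OF M[OF t]] .
  have C: "0 < C" using M0 ost_const_nonneg by (simp add: C_def add_nonneg_pos)
  have "\<forall>\<^sub>F \<tau> in at t within {0..S}. hb (ws s) (\<lambda>k. a \<tau> k - a t k) (\<epsilon> / C)"
    using \<epsilon> C by (intro hsol_continuous[OF a t]) auto
  moreover have "\<forall>\<^sub>F \<tau> in at t within {0..S}. \<tau> \<in> {0..S}" by (simp add: eventually_at_filter)
  ultimately show ?thesis
  proof eventually_elim
    case (elim \<tau>)
    have "hb (ws (s - 1)) (\<lambda>k. ost \<gamma> (a \<tau>) k - ost \<gamma> (a t) k) ((ost_const * (M + M) + 2 * \<gamma>\<^sup>2) * (\<epsilon> / C))"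
      using elim t hsolD(2)[OF a] by (intro hb_ost_diff M) auto
    then show ?case
    proof (rule hb_le)
      have "(ost_const * (M + M) + 2 * \<gamma>\<^sup>2) * (\<epsilon> / C) \<le> C * (\<epsilon> / C)" using \<epsilon> C by (intro mult_right_mono) (auto simp: C_def)
      then show "(ost_const * (M + M) + 2 * \<gamma>\<^sup>2) * (\<epsilon> / C) \<le> \<epsilon>" using C by simp
    qed
  qed
qed

text \<open>By \<open>mean_value_hb\<close> the difference quotient is as close to the field at time
  \<open>t\<close> as the field at intermediate times, which \<open>hs_ost_continuous\<close>
  controls.\<close>

lemma hs_C1:
  assumes a: "hs S a" and t: "t \<in> {0..S}" and \<epsilon>: "0 < \<epsilon>"
  shows "\<forall>\<^sub>F \<tau> in at t within {0..S}. hb (ws (s - 1)) (\<lambda>k. (a \<tau> k - a t k) / of_real (\<tau> - t) - ost \<gamma> (a t) k) \<epsilon>"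
proof -
  obtain d where d: "0 < d" "\<And>\<tau>. \<tau> \<in> {0..S} \<Longrightarrow> \<tau> \<noteq> t \<Longrightarrow> dist \<tau> t < d \<Longrightarrow> hb (ws (s - 1)) (\<lambda>k. ost \<gamma> (a \<tau>) k - ost \<gamma> (a t) k) \<epsilon>"
    using hs_ost_continuous[OF a t \<epsilon>] unfolding eventually_at by blast
  show ?thesis
    unfolding eventually_at
  proof (intro exI[of _ d] conjI d(1) ballI impI)
    fix \<tau> assume \<tau>: "\<tau> \<in> {0..S}" "\<tau> \<noteq> t \<and> dist \<tau> t < d"
    show "hb (ws (s - 1)) (\<lambda>k. (a \<tau> k - a t k) / of_real (\<tau> - t) - ost \<gamma> (a t) k) \<epsilon>"
    proof (rule mean_value_hb[OF a t \<tau>(1)])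
      fix \<xi> assume "min t \<tau> < \<xi>" "\<xi> < max t \<tau>"
      then show "hb (ws (s - 1)) (\<lambda>k. ost \<gamma> (a \<xi>) k - ost \<gamma> (a t) k) \<epsilon>"
        using \<tau> t by (intro d(2)) (auto simp: dist_real_def min_def max_def split: if_splits)
    qed (use \<tau> ws_nonneg in auto)
  qed
qed

text \<open>The product \<open>u * u_x\<close> cancels the convolution term of \<open>ost\<close>,
  leaving only the dispersive term, whose weak derivative is \<open>\<gamma> * u\<close>. At
  frequency 0, where \<open>ost\<close> contains \<open>\<gamma> / 0 = 0\<close>, the equation holds
  because of zero mean.\<close>

lemma fs_weak_deriv:
  assumes a: "hb (ws s) a A" "herm a" "a 0 = 0"
  shows "\<exists>ux. has_weak_deriv (fs a) ux \<and> has_weak_deriv (\<lambda>x. fs (ost \<gamma> a) x + fs a x * ux x) (\<lambda>x. \<gamma> * fs a x)"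
proof -
  define b where "b k = 2 * pi * \<i> * of_int k * a k" for k
  have ka: "hb (\<lambda>k. (real_of_int k)\<^sup>2) (\<lambda>k. of_int k * a k) A" by (rule hb_times_freq[OF hb_p4[OF a(1)]])
  have "hb (\<lambda>k. (real_of_int k)\<^sup>2) b ((2 * pi)\<^sup>2 * A)"
    by (rule hb_dominate[OF ka]) (auto simp: b_def norm_mult power_mult_distrib mult_ac)
  then have lb: "l1 b" by (rule hb_l1) (simp add: b_def)
  have hbm: "herm b" using a(2) by (simp add: b_def herm_def)
  have la: "l1 a" by (rule l1_ws[OF a(1,3)])
  have lo: "l1 (ost \<gamma> a)" and ho: "herm (ost \<gamma> a)" using l1_ost[OF a(1,3)] herm_ost'[OF a(2)] by auto
  have 1: "has_weak_deriv (fs a) (fs b)"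
    by (rule has_weak_derivI) (simp_all add: fs_L1 la lb fourier_coeff_fs[OF la a(2)] fourier_coeff_fs[OF lb hbm] b_def)
  have i: "integrable circle_measure (\<lambda>x. fs a x * fs b x)"
    by (intro continuous_imp_integrable_real continuous_intros continuous_on_fs la lb)
  have c: "fourier_coeff (\<lambda>x. fs a x * fs b x) k = \<i> * of_real (pi * k) * conv a a k" for k
  proof -
    have "((\<lambda>j. a j * b (k - j)) has_sum fourier_coeff (\<lambda>x. fs a x * fs b x) k) UNIV"
      using fourier_coeff_fs_mult[OF la a(2) integrable_fs[OF lb], of k] by (simp add: fourier_coeff_fs[OF lb hbm])
    then have "fourier_coeff (\<lambda>x. fs a x * fs b x) k = (\<Sum>\<^sub>\<infinity>j. 2 * pi * \<i> * (a j * (of_int (k - j) * a (k - j))))"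
      by (subst infsumI[symmetric]) (auto simp: b_def mult_ac)
    also have "\<dots> = 2 * pi * \<i> * conv a (\<lambda>k. of_int k * a k) k" unfolding conv_def by (rule infsum_cmult_right')
    also have "conv a (\<lambda>k. of_int k * a k) k = of_int k / 2 * conv a a k"
      by (rule conv_times_freq[OF hb_1[OF a(1,3)] hb_one_sq[OF ka]]) simp
    finally show ?thesis by (simp add: mult_ac)
  qed
  have "has_weak_deriv (\<lambda>x. fs (ost \<gamma> a) x + fs a x * fs b x) (\<lambda>x. \<gamma> * fs a x)"
  proof (rule has_weak_derivI)
    show "(\<lambda>x. fs (ost \<gamma> a) x + fs a x * fs b x) \<in> circle_L1"
      using i integrable_fs[OF lo] by (auto simp: circle_L1_def intro!: circle_fun_comb circle_fun_fs la lb lo)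
    show "(\<lambda>x. \<gamma> * fs a x) \<in> circle_L1"
      using integrable_fs[OF la] by (auto simp: circle_L1_def intro!: circle_fun_comb circle_fun_fs la)
    fix k
    have "fourier_coeff (\<lambda>x. fs (ost \<gamma> a) x + fs a x * fs b x) k = - (\<i> * of_real (\<gamma> / (2 * pi * k)) * a k)"
      by (simp add: fourier_coeff_add[OF integrable_fs[OF lo] i] fourier_coeff_fs[OF lo ho] c ost_def)
    then show "fourier_coeff (\<lambda>x. \<gamma> * fs a x) k = 2 * pi * \<i> * of_int k * fourier_coeff (\<lambda>x. fs (ost \<gamma> a) x + fs a x * fs b x) k"
      using a(3) by (cases "k = 0") (simp_all add: fourier_coeff_cmult fourier_coeff_fs[OF la a(2)])
  qed
  with 1 show ?thesis by blast
qed

lemma solution_of_hs: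
  assumes u0: "u0 \<in> sobolev_mean_zero s" and T: "T > 0" and 0: "a 0 = fourier_coeff u0"
    and a: "\<And>S. 0 \<le> S \<Longrightarrow> ereal S < T \<Longrightarrow> hs S a"
  shows "solution \<gamma> s u0 T (\<lambda>t. fs (a t)) (\<lambda>t. fs (ost \<gamma> (a t)))"
proof -
  have pt: "herm (a t)" "a t 0 = 0" "\<exists>A. hb (ws s) (a t) A" if "t \<in> life_span T" for t
  proof -
    have "hs t a" "t \<in> {0..t}" using a that by (auto simp: life_span_def)
    then show "herm (a t)" "a t 0 = 0" "\<exists>A. hb (ws s) (a t) A" by (auto simp: hsol_def)
  qed
  have l: "l1 (a t)" "l1 (ost \<gamma> (a t))" "herm (ost \<gamma> (a t))" if "t \<in> life_span T" for t
    using pt[OF that] l1_ws l1_ost herm_ost' by blast+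
  have fc: "fourier_coeff (fs (a t)) = a t" "fourier_coeff (fs (ost \<gamma> (a t))) = ost \<gamma> (a t)" if "t \<in> life_span T" for t
    using fourier_coeff_fs l[OF that] pt[OF that] by blast+
  have fcd: "fourier_coeff (\<lambda>x. fs (a \<tau>) x - fs (a t) x) = (\<lambda>k. a \<tau> k - a t k)"
    "fourier_coeff (\<lambda>x. fs (ost \<gamma> (a \<tau>)) x - fs (ost \<gamma> (a t)) x) = (\<lambda>k. ost \<gamma> (a \<tau>) k - ost \<gamma> (a t) k)"
    "fourier_coeff (\<lambda>x. (fs (a \<tau>) x - fs (a t) x) / (\<tau> - t) - fs (ost \<gamma> (a t)) x) = (\<lambda>k. (a \<tau> k - a t k) / of_real (\<tau> - t) - ost \<gamma> (a t) k)"
    if "t \<in> life_span T" "\<tau> \<in> life_span T" for t \<tau>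
    using integrable_fs[OF l(1)[OF that(1)]] integrable_fs[OF l(1)[OF that(2)]] integrable_fs[OF l(2)[OF that(1)]] integrable_fs[OF l(2)[OF that(2)]]
    by (auto simp: fourier_coeff_diff fourier_coeff_divide fc that simp del: of_real_diff)
  have ev: "\<forall>\<^sub>F \<tau> in at t within life_span T. \<tau> \<in> life_span T" for t by (simp add: eventually_at_filter)
  have near: "\<forall>\<^sub>F \<tau> in at t within life_span T. P \<tau>"
    if t: "t \<in> life_span T" and P: "\<And>S. hs S a \<Longrightarrow> t \<in> {0..S} \<Longrightarrow> \<forall>\<^sub>F \<tau> in at t within {0..S}. P \<tau>" for t P
  proof -
    obtain S where S: "t < S" "ereal S < T" using life_span_dense[OF t] by blast
    have t0: "0 \<le> t" using t by (simp add: life_span_def)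
    show ?thesis unfolding at_within_life_span[OF t0 S] using S t0 by (intro P a) auto
  qed
  have C: "sobolev_C s (life_span T) (\<lambda>t. fs (a t))"
    unfolding sobolev_C_def
  proof (intro ballI conjI sobolev_tendstoI)
    fix t assume t: "t \<in> life_span T"
    show "fs (a t) \<in> sobolev s" using pt[OF t] l[OF t] fs_sobolev by blast
    fix \<epsilon> :: real assume "0 < \<epsilon>"
    then have "\<forall>\<^sub>F \<tau> in at t within life_span T. hb (ws s) (\<lambda>k. a \<tau> k - a t k) \<epsilon>" by (intro near t hsol_continuous)
    with ev show "\<forall>\<^sub>F \<tau> in at t within life_span T. hb (ws s) (fourier_coeff (\<lambda>x. fs (a \<tau>) x - fs (a t) x)) \<epsilon>"
      by eventually_elim (simp add: fcd t)
  qed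
  have C': "sobolev_C (s - 1) (life_span T) (\<lambda>t. fs (a t))"
    unfolding sobolev_C_def
  proof (intro ballI conjI sobolev_tendstoI)
    fix t assume t: "t \<in> life_span T"
    show "fs (a t) \<in> sobolev (s - 1)" using pt[OF t] l[OF t] fs_sobolev hb_ws_pred by blast
    fix \<epsilon> :: real assume "0 < \<epsilon>"
    then have "\<forall>\<^sub>F \<tau> in at t within life_span T. hb (ws s) (\<lambda>k. a \<tau> k - a t k) \<epsilon>" by (intro near t hsol_continuous)
    with ev show "\<forall>\<^sub>F \<tau> in at t within life_span T. hb (ws (s - 1)) (fourier_coeff (\<lambda>x. fs (a \<tau>) x - fs (a t) x)) \<epsilon>"
      by eventually_elim (simp add: fcd t hb_ws_pred)
  qed
  have D: "sobolev_C (s - 1) (life_span T) (\<lambda>t. fs (ost \<gamma> (a t)))"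
    unfolding sobolev_C_def
  proof (intro ballI conjI sobolev_tendstoI)
    fix t assume t: "t \<in> life_span T"
    show "fs (ost \<gamma> (a t)) \<in> sobolev (s - 1)" using pt[OF t] l[OF t] fs_sobolev hb_ost by blast
    fix \<epsilon> :: real assume "0 < \<epsilon>"
    then have "\<forall>\<^sub>F \<tau> in at t within life_span T. hb (ws (s - 1)) (\<lambda>k. ost \<gamma> (a \<tau>) k - ost \<gamma> (a t) k) \<epsilon>" by (intro near t hs_ost_continuous)
    with ev show "\<forall>\<^sub>F \<tau> in at t within life_span T. hb (ws (s - 1)) (fourier_coeff (\<lambda>x. fs (ost \<gamma> (a \<tau>)) x - fs (ost \<gamma> (a t)) x)) \<epsilon>"
      by eventually_elim (simp add: fcd t)
  qed
  have E: "((\<lambda>\<tau>. sobolev_norm (s - 1) (\<lambda>x. (fs (a \<tau>) x - fs (a t) x) / (\<tau> - t) - fs (ost \<gamma> (a t)) x)) \<longlongrightarrow> 0) (at t within life_span T)"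
    if t: "t \<in> life_span T" for t
  proof (rule sobolev_tendstoI)
    fix \<epsilon> :: real assume "0 < \<epsilon>"
    then have "\<forall>\<^sub>F \<tau> in at t within life_span T. hb (ws (s - 1)) (\<lambda>k. (a \<tau> k - a t k) / of_real (\<tau> - t) - ost \<gamma> (a t) k) \<epsilon>" by (intro near t hs_C1)
    with ev show "\<forall>\<^sub>F \<tau> in at t within life_span T. hb (ws (s - 1)) (fourier_coeff (\<lambda>x. (fs (a \<tau>) x - fs (a t) x) / (\<tau> - t) - fs (ost \<gamma> (a t)) x)) \<epsilon>"
      by eventually_elim (simp add: fcd(3)[OF t] del: of_real_diff)
  qed
  have "0 \<in> life_span T" using T by (simp add: life_span_def zero_ereal_def)
  then have "l1 (fourier_coeff u0)" using l(1)[of 0] 0 by simp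
  then have "circle_ae_eq u0 (fs (a 0))" unfolding 0 using data_coeffs[OF u0] by (intro ae_eq_fs sobolev_integrable)
  then have I: "circle_ae_eq (fs (a 0)) u0" unfolding circle_ae_eq_def by eventually_elim simp
  have "\<exists>ux. has_weak_deriv (fs (a t)) ux \<and> has_weak_deriv (\<lambda>x. fs (ost \<gamma> (a t)) x + fs (a t) x * ux x) (\<lambda>x. \<gamma> * fs (a t) x)"
    if "t \<in> life_span T" for t
    using pt[OF that] fs_weak_deriv by blast
  then show ?thesis using C C' D E I by (simp add: solution_def sobolev_C1_def)
qed

end

section \<open>From weak solutions back to Fourier variables\<close>

lemma sobolev_divide:
  assumes "f \<in> sobolev r"
  shows "(\<lambda>x. f x / c) \<in> sobolev r"
proof (rule sobolevI)
  show "(\<lambda>x. f x / c) \<in> circle_L2" using assms by (intro circle_L2_divide) (simp add: sobolev_def)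
  show "hb (ws r) (fourier_coeff (\<lambda>x. f x / c)) ((1 / c)\<^sup>2 * (sobolev_norm r f)\<^sup>2)"
    by (rule hb_dominate[OF sobolev_hb[OF assms]]) (auto simp: fourier_coeff_divide norm_divide power_divide)
qed

text \<open>Local bounds become uniform through a finite subcover; the sum of the nonnegative local
  bounds serves as a common one.\<close>

lemma bounded_on_compact_interval:
  fixes P :: "real \<Rightarrow> real \<Rightarrow> bool"
  assumes mono: "\<And>t A B. P t A \<Longrightarrow> A \<le> B \<Longrightarrow> P t B"
    and loc: "\<And>t. t \<in> {0..S} \<Longrightarrow> \<exists>A\<ge>0. \<exists>d>0. \<forall>\<tau>\<in>{0..S}. dist \<tau> t < d \<longrightarrow> P \<tau> A"
  shows "\<exists>M. \<forall>t\<in>{0..S}. P t M"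
proof -
  obtain A d where Ad: "\<And>t. t \<in> {0..S} \<Longrightarrow> 0 \<le> A t" "\<And>t. t \<in> {0..S} \<Longrightarrow> 0 < d t"
    "\<And>t \<tau>. t \<in> {0..S} \<Longrightarrow> \<tau> \<in> {0..S} \<Longrightarrow> dist \<tau> t < d t \<Longrightarrow> P \<tau> (A t)"
    using loc by metis
  have "{0..S} \<subseteq> (\<Union>t\<in>{0..S}. ball t (d t))" using Ad(2) by auto
  then obtain C where C: "C \<subseteq> {0..S}" "finite C" "{0..S} \<subseteq> (\<Union>t\<in>C. ball t (d t))"
    using compactE_image[OF compact_Icc, of "{0..S}" "\<lambda>t. ball t (d t)" 0 S] by auto
  have "P t (sum A C)" if t: "t \<in> {0..S}" for t
  proof -
    obtain c where c: "c \<in> C" "dist t c < d c" using C(3) t by (auto simp: dist_commute)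
    then have "P t (A c)" using C(1) t by (intro Ad(3)) auto
    moreover have "A c \<le> sum A C" using c C Ad(1) by (intro member_le_sum) auto
    ultimately show ?thesis by (rule mono)
  qed
  then show ?thesis by blast
qed

context ostrovsky
begin

text \<open>The outer derivative can be undone by dividing by \<open>2 * pi * \<i> * k\<close>,
  which is why \<open>k = 0\<close> is excluded and has to be treated separately.\<close>

lemma solution_coeff_equation:
  assumes v: "v \<in> sobolev s" "fourier_coeff v 0 = 0" and w: "w \<in> sobolev (s - 1)"
    and ux: "has_weak_deriv v ux" and eq: "has_weak_deriv (\<lambda>x. w x + v x * ux x) (\<lambda>x. \<gamma> * v x)" and k: "k \<noteq> 0"
  shows "fourier_coeff w k = ost \<gamma> (fourier_coeff v) k"
proof -
  define a where "a = fourier_coeff v"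
  note vi = sobolev_integrable[OF v(1)] and wi = sobolev_integrable[OF w]
  have a: "hb (ws s) a ((sobolev_norm s v)\<^sup>2)" "a 0 = 0" "herm a"
    using sobolev_hb[OF v(1)] v(2) herm_fourier_coeff[OF vi] by (auto simp: a_def)
  have la: "l1 a" by (rule l1_ws[OF a(1,2)])
  have ae: "circle_ae_eq v (fs a)" unfolding a_def by (rule ae_eq_fs[OF vi]) (use la in \<open>simp add: a_def\<close>)
  have uxi: "integrable circle_measure ux" and uxc: "fourier_coeff ux j = 2 * pi * \<i> * of_int j * a j" for j
    using ux has_weak_deriv_coeff[OF ux] by (auto simp: has_weak_deriv_def circle_L1_def a_def)
  have hi: "integrable circle_measure (\<lambda>x. w x + v x * ux x)" using eq by (auto simp: has_weak_deriv_def circle_L1_def)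
  \<comment> \<open>Integrability of the product is not given directly; it follows from that of the
    whole expression and of \<open>w\<close>.\<close>
  then have vui: "integrable circle_measure (\<lambda>x. v x * ux x)"
    using Bochner_Integration.integrable_diff[OF hi wi] by simp
  have ka: "hb (\<lambda>k. (real_of_int k)\<^sup>2) (\<lambda>k. of_int k * a k) ((sobolev_norm s v)\<^sup>2)" by (rule hb_times_freq[OF hb_p4[OF a(1)]])
  \<comment> \<open>Passing to the series representative makes the product formula available for a
    merely integrable \<open>ux\<close>.\<close>
  have "fourier_coeff (\<lambda>x. v x * ux x) k = fourier_coeff (\<lambda>x. fs a x * ux x) k"
  proof (rule fourier_coeff_cong_AE)
    show "(\<lambda>x. v x * ux x) \<in> borel_measurable circle_measure" using vui by auto
    show "(\<lambda>x. fs a x * ux x) \<in> borel_measurable circle_measure"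
      using continuous_measurable_circle[OF continuous_on_fs[OF la]] borel_measurable_integrable[OF uxi] by (rule borel_measurable_times)
    show "AE x in circle_measure. v x * ux x = fs a x * ux x" using ae unfolding circle_ae_eq_def by eventually_elim simp
  qed
  also have "\<dots> = (\<Sum>\<^sub>\<infinity>j. 2 * pi * \<i> * (a j * (of_int (k - j) * a (k - j))))"
    using infsumI[OF fourier_coeff_fs_mult[OF la a(3) uxi, of k]] by (simp add: uxc mult_ac)
  also have "\<dots> = 2 * pi * \<i> * conv a (\<lambda>k. of_int k * a k) k" unfolding conv_def by (rule infsum_cmult_right')
  also have "conv a (\<lambda>k. of_int k * a k) k = of_int k / 2 * conv a a k"
    by (rule conv_times_freq[OF hb_1[OF a(1,2)] hb_one_sq[OF ka]]) simp
  finally have vu: "fourier_coeff (\<lambda>x. v x * ux x) k = \<i> * of_real (pi * k) * conv a a k" by (simp add: mult_ac)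
  have "of_real \<gamma> * a k = 2 * pi * \<i> * of_int k * (fourier_coeff w k + \<i> * of_real (pi * k) * conv a a k)"
    using has_weak_deriv_coeff[OF eq, of k] by (simp add: fourier_coeff_cmult fourier_coeff_add[OF wi vui] vu a_def)
  moreover define c where "c = 2 * pi * \<i> * of_int k"
  moreover have c: "c \<noteq> 0" using k by (simp add: c_def)
  ultimately have "fourier_coeff w k = of_real \<gamma> * a k / c - \<i> * of_real (pi * k) * conv a a k"
    by (simp add: field_simps)
  moreover have "of_real \<gamma> * a k / c = - (\<i> * of_real (\<gamma> / (2 * pi * k)) * a k)"
    using k by (simp add: c_def divide_simps) 
  ultimately show ?thesis by (simp add: ost_def a_def)
qed

text \<open>Each coefficient is a functional bounded by the Sobolev norms, so continuity and
  differentiability in time are inherited by the coefficients. This makes the uniqueness theory in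
  Fourier variables applicable to any competing solution.\<close>

lemma hs_of_solution:
  assumes u0: "u0 \<in> sobolev_mean_zero s" and sol: "solution \<gamma> s u0 T v v'" and S: "0 \<le> S" "ereal S < T"
  shows "hs S (\<lambda>t. fourier_coeff (v t))" and "fourier_coeff (v 0) = fourier_coeff u0"
proof -
  have sub: "t \<in> life_span T" if "t \<in> {0..S}" for t
    using that S(2) unfolding life_span_def by (auto intro: order_le_less_trans[of "ereal t" "ereal S"])
  have vC: "v t \<in> sobolev s" "((\<lambda>\<tau>. sobolev_norm s (\<lambda>x. v \<tau> x - v t x)) \<longlongrightarrow> 0) (at t within life_span T)"
    if "t \<in> life_span T" for t using sol that by (auto simp: solution_def sobolev_C_def)
  have v1: "v t \<in> sobolev (s - 1)" "v' t \<in> sobolev (s - 1)"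
    "((\<lambda>\<tau>. sobolev_norm (s - 1) (\<lambda>x. (v \<tau> x - v t x) / (\<tau> - t) - v' t x)) \<longlongrightarrow> 0) (at t within life_span T)"
    if "t \<in> life_span T" for t using sol that by (auto simp: solution_def sobolev_C1_def sobolev_C_def)
  have weak: "\<exists>ux. has_weak_deriv (v t) ux \<and> has_weak_deriv (\<lambda>x. v' t x + v t x * ux x) (\<lambda>x. \<gamma> * v t x)"
    if "t \<in> life_span T" "t > 0" for t using sol that by (auto simp: solution_def)
  have i0: "0 \<in> life_span T" using sub[of 0] S by simp
  show f0: "fourier_coeff (v 0) = fourier_coeff u0"
    using sol circle_ae_eq_coeffs[OF sobolev_L1[OF vC(1)[OF i0]] sobolev_L1[OF data_coeffs(4)[OF u0]]]
    by (auto simp: solution_def)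
  \<comment> \<open>For positive times zero mean is forced by the equation:
    \<open>\<gamma> * v t\<close> is a weak derivative, so its zeroth coefficient vanishes, and
    \<gamma> is nonzero. At time 0 it comes from the datum.\<close>
  have mean: "fourier_coeff (v t) 0 = 0" if t: "t \<in> life_span T" for t
  proof (cases "t = 0")
    case True then show ?thesis using f0 data_coeffs(2)[OF u0] by simp
  next
    case False
    then have "0 < t" using t by (simp add: life_span_def)
    then obtain H where "has_weak_deriv H (\<lambda>x. \<gamma> * v t x)" using weak[OF t] by blast
    from has_weak_deriv_coeff[OF this, of 0] \<gamma> show ?thesis by (simp add: fourier_coeff_cmult)
  qed
  have ev: "\<forall>\<^sub>F \<tau> in at t within life_span T. \<tau> \<in> life_span T" for t by (simp add: eventually_at_filter)
  have der: "((\<lambda>t. fourier_coeff (v t) k) has_vector_derivative fourier_coeff (v' t) k) (at t)"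
    if t: "t \<in> {0<..<S}" for t k
  proof -
    have tI: "t \<in> life_span T" using t by (intro sub) auto
    have at: "at t within life_span T = at t"
    proof -
      have "at t within life_span T = at t within {0..S}" using t S by (intro at_within_life_span) auto
      also have "\<dots> = at t" using t by (intro at_within_interior) auto
      finally show ?thesis .
    qed
    \<comment> \<open>The quotient is the modulus of the \<open>k\<close>-th coefficient of the
      error of the difference quotient, hence at most its \<open>H^(s-1)\<close> norm.\<close>
    have "((\<lambda>\<tau>. norm (fourier_coeff (v \<tau>) k - fourier_coeff (v t) k - (\<tau> - t) *\<^sub>R fourier_coeff (v' t) k) / norm (\<tau> - t)) \<longlongrightarrow> 0) (at t within life_span T)"
    proof (rule Lim_null_comparison[OF _ v1(3)[OF tI]])
      have ne: "\<forall>\<^sub>F \<tau> in at t within life_span T. \<tau> \<noteq> t" by (simp add: eventually_at_filter)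
      show "\<forall>\<^sub>F \<tau> in at t within life_span T. norm (norm (fourier_coeff (v \<tau>) k - fourier_coeff (v t) k - (\<tau> - t) *\<^sub>R fourier_coeff (v' t) k) / norm (\<tau> - t))
        \<le> sobolev_norm (s - 1) (\<lambda>x. (v \<tau> x - v t x) / (\<tau> - t) - v' t x)"
        using ev ne
      proof eventually_elim
        case (elim \<tau>)
        let ?c = "complex_of_real (\<tau> - t)"
        have c: "?c \<noteq> 0" using elim by simp
        have m: "(\<lambda>x. (v \<tau> x - v t x) / (\<tau> - t)) \<in> sobolev (s - 1)"
          by (intro sobolev_divide sobolev_diff v1 tI elim)
        have "fourier_coeff (\<lambda>x. (v \<tau> x - v t x) / (\<tau> - t) - v' t x) k = (fourier_coeff (v \<tau>) k - fourier_coeff (v t) k) / ?c - fourier_coeff (v' t) k"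
          by (simp add: fun_cong[OF fourier_coeff_sobolev_diff[OF m v1(2)[OF tI]]] fourier_coeff_divide
              fun_cong[OF fourier_coeff_sobolev_diff[OF v1(1)[OF elim(1)] v1(1)[OF tI]]] del: of_real_diff)
        also have "\<dots> = (fourier_coeff (v \<tau>) k - fourier_coeff (v t) k - ?c * fourier_coeff (v' t) k) / ?c"
          using c by (simp only: diff_divide_distrib) simp
        finally have "norm (fourier_coeff (v \<tau>) k - fourier_coeff (v t) k - (\<tau> - t) *\<^sub>R fourier_coeff (v' t) k) / norm (\<tau> - t)
           = cmod (fourier_coeff (\<lambda>x. (v \<tau> x - v t x) / (\<tau> - t) - v' t x) k)"
          by (simp only: scaleR_conv_of_real norm_divide norm_of_real real_norm_def)
        also have "\<dots> \<le> sobolev_norm (s - 1) (\<lambda>x. (v \<tau> x - v t x) / (\<tau> - t) - v' t x)"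
          using s by (intro sobolev_norm_coeff_le sobolev_diff m v1 tI) auto
        finally show ?case by simp
      qed
    qed
    then show ?thesis unfolding at has_vector_derivative_def has_derivative_iff_norm
      by (auto intro: bounded_linear_scaleR_left)
  qed
  show "hs S (\<lambda>t. fourier_coeff (v t))"
    unfolding hsol_def
  proof (intro conjI ballI allI)
    show "herm (fourier_coeff (v t))" "fourier_coeff (v t) 0 = 0" if "t \<in> {0..S}" for t
      using herm_fourier_coeff[OF sobolev_integrable[OF vC(1)[OF sub[OF that]]]] mean[OF sub[OF that]] by auto
    show "\<exists>M. \<forall>t\<in>{0..S}. hb (ws s) (fourier_coeff (v t)) M"
    proof (rule bounded_on_compact_interval)
      show "hb (ws s) (fourier_coeff (v t)) B" if "hb (ws s) (fourier_coeff (v t)) A" "A \<le> B" for t A B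
        using that by (rule hb_le)
      fix t assume t: "t \<in> {0..S}"
      note tI = sub[OF t]
      have "\<forall>\<^sub>F \<tau> in at t within life_span T. sobolev_norm s (\<lambda>x. v \<tau> x - v t x) < 1"
        using vC(2)[OF tI] by (rule order_tendstoD) simp
      then obtain d where d: "0 < d" "\<And>\<tau>. \<tau> \<in> life_span T \<Longrightarrow> \<tau> \<noteq> t \<Longrightarrow> dist \<tau> t < d \<Longrightarrow> sobolev_norm s (\<lambda>x. v \<tau> x - v t x) < 1"
        unfolding eventually_at by blast
      let ?A = "2 * 1 + 2 * (sobolev_norm s (v t))\<^sup>2"
      have "hb (ws s) (fourier_coeff (v \<tau>)) ?A" if \<tau>: "\<tau> \<in> {0..S}" "dist \<tau> t < d" for \<tau>
      proof (cases "\<tau> = t")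
        case True
        then show ?thesis using hb_le[OF sobolev_hb[OF vC(1)[OF tI]]] by simp
      next
        case False
        note n = d(2)[OF sub[OF \<tau>(1)] False \<tau>(2)]
        have "(sobolev_norm s (\<lambda>x. v \<tau> x - v t x))\<^sup>2 \<le> 1\<^sup>2" using n by (intro power_mono sobolev_norm_nonneg) auto
        then have "hb (ws s) (\<lambda>k. fourier_coeff (v \<tau>) k - fourier_coeff (v t) k) 1"
          by (intro hb_le[OF hb_sobolev_diff[OF vC(1)[OF sub[OF \<tau>(1)]] vC(1)[OF tI]]]) simp
        from hb_add[OF this sobolev_hb[OF vC(1)[OF tI]] ws_nonneg] show ?thesis by simp
      qed
      then show "\<exists>A\<ge>0. \<exists>d>0. \<forall>\<tau>\<in>{0..S}. dist \<tau> t < d \<longrightarrow> hb (ws s) (fourier_coeff (v \<tau>)) A"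
        using d(1) by (intro exI[of _ ?A] conjI exI[of _ d]) auto
    qed
    show "continuous_on {0..S} (\<lambda>t. fourier_coeff (v t) k)" for k
      unfolding continuous_on_def
    proof
      fix t assume t: "t \<in> {0..S}"
      note tI = sub[OF t]
      have "((\<lambda>\<tau>. fourier_coeff (v \<tau>) k - fourier_coeff (v t) k) \<longlongrightarrow> 0) (at t within life_span T)"
      proof (rule Lim_null_comparison[OF _ vC(2)[OF tI]])
        show "\<forall>\<^sub>F \<tau> in at t within life_span T. norm (fourier_coeff (v \<tau>) k - fourier_coeff (v t) k) \<le> sobolev_norm s (\<lambda>x. v \<tau> x - v t x)"
          using ev
        proof eventually_elim
          case (elim \<tau>)
          have "cmod (fourier_coeff (\<lambda>x. v \<tau> x - v t x) k) \<le> sobolev_norm s (\<lambda>x. v \<tau> x - v t x)"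
            using s by (intro sobolev_norm_coeff_le sobolev_diff vC tI elim) auto
          then show ?case by (simp add: fourier_coeff_sobolev_diff[OF vC(1)[OF elim] vC(1)[OF tI]])
        qed
      qed
      then have "((\<lambda>\<tau>. fourier_coeff (v \<tau>) k) \<longlongrightarrow> fourier_coeff (v t) k) (at t within life_span T)"
        by (simp add: LIM_zero_iff)
      then show "((\<lambda>\<tau>. fourier_coeff (v \<tau>) k) \<longlongrightarrow> fourier_coeff (v t) k) (at t within {0..S})"
        by (rule tendsto_within_subset) (use sub in auto)
    qed
    fix k t assume t: "t \<in> {0<..<S}"
    then have tI: "t \<in> life_span T" "0 < t" by (auto intro: sub)
    \<comment> \<open>At \<open>k = 0\<close> the equation gives no information on
      \<open>v'\<close>; there the coefficient of \<open>v\<close> is identically zero, hence so is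
      its derivative.\<close>
    have "fourier_coeff (v' t) k = ost \<gamma> (fourier_coeff (v t)) k"
    proof (cases "k = 0")
      case True
      have "((\<lambda>t. fourier_coeff (v t) 0) has_vector_derivative 0) (at t)"
        by (rule has_vector_derivative_transform_within_open[of "\<lambda>_. 0" _ _ "{0<..<S}"])
           (use t mean sub in auto)
      then have "fourier_coeff (v' t) 0 = 0" using der[OF t, of 0] vector_derivative_unique_at by blast
      then show ?thesis using True ost_0 by simp
    next
      case False
      then show ?thesis using weak[OF tI] solution_coeff_equation[OF vC(1)[OF tI(1)] mean[OF tI(1)] v1(2)[OF tI(1)]] by blast
    qed
    then show "((\<lambda>t. fourier_coeff (v t) k) has_vector_derivative ost \<gamma> (fourier_coeff (v t)) k) (at t)"
      using der[OF t, of k] by simp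
  qed
qed

section \<open>The maximal flow and its continuity\<close>

definition exist_time :: "(real \<Rightarrow> real) \<Rightarrow> ereal" where
  "exist_time u0 = Sup {ereal S |S. 0 < S \<and> (\<exists>a. hs S a \<and> a 0 = fourier_coeff u0)}"

text \<open>A value is chosen separately at each time, among all solutions reaching that time. By
  uniqueness they agree, see \<open>coeff_flow_eq\<close>, so this is the union of all
  solutions.\<close>

definition coeff_flow :: "(real \<Rightarrow> real) \<Rightarrow> real \<Rightarrow> int \<Rightarrow> complex" where
  "coeff_flow u0 t = (SOME c. \<exists>S a. t \<le> S \<and> hs S a \<and> a 0 = fourier_coeff u0 \<and> c = a t)"

lemma coeff_flow_eq:
  assumes a: "hs S a" "a 0 = fourier_coeff u0" and t: "t \<in> {0..S}"
  shows "coeff_flow u0 t = a t"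
proof -
  have "\<exists>c S a. t \<le> S \<and> hs S a \<and> a 0 = fourier_coeff u0 \<and> c = a t" using a t by auto
  from someI_ex[OF this] obtain S' a' where a': "t \<le> S'" "hs S' a'" "a' 0 = fourier_coeff u0" "coeff_flow u0 t = a' t"
    unfolding coeff_flow_def by blast
  have "a' t = a t"
    by (rule hsol_unique[of t]) (use a a' t in \<open>auto intro: hsol_subset\<close>)
  then show ?thesis using a'(4) by simp
qed

lemma exist_time_ge: "hs S a \<Longrightarrow> a 0 = fourier_coeff u0 \<Longrightarrow> 0 < S \<Longrightarrow> ereal S \<le> exist_time u0"
  unfolding exist_time_def by (rule Sup_upper) auto

lemma exist_time_pos:
  assumes "u0 \<in> sobolev_mean_zero s"
  shows "0 < exist_time u0"
proof -
  obtain S a where a: "0 < S" "hs S a" "a 0 = fourier_coeff u0" using local_existence[OF data_coeffs(1-3)[OF assms]] by blast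
  have "0 < ereal S" using a(1) by simp
  also have "\<dots> \<le> exist_time u0" by (rule exist_time_ge[OF a(2,3,1)])
  finally show ?thesis .
qed

lemma coeff_flow_hs:
  assumes S: "0 \<le> S" "ereal S < exist_time u0"
  shows "hs S (coeff_flow u0)" and "coeff_flow u0 0 = fourier_coeff u0"
proof -
  obtain S' a where a: "ereal S < ereal S'" "hs S' a" "a 0 = fourier_coeff u0"
    using S(2) unfolding exist_time_def less_Sup_iff by auto
  have SS: "S \<le> S'" using a(1) by simp
  show "hs S (coeff_flow u0)"
    by (rule hsol_cong[OF hsol_subset[OF a(2) SS]]) (use SS in \<open>auto intro!: coeff_flow_eq[OF a(2,3)]\<close>)
  show "coeff_flow u0 0 = fourier_coeff u0" using coeff_flow_eq[OF a(2,3), of 0] a(3) S SS by simp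
qed

lemma flow_solution:
  assumes "u0 \<in> sobolev_mean_zero s"
  shows "solution \<gamma> s u0 (exist_time u0) (\<lambda>t. fs (coeff_flow u0 t)) (\<lambda>t. fs (ost \<gamma> (coeff_flow u0 t)))"
  using coeff_flow_hs exist_time_pos[OF assms]
  by (intro solution_of_hs[OF assms]) (auto simp: coeff_flow_hs(2)[of 0] zero_ereal_def)

text \<open>A solution living beyond \<open>exist_time u0\<close> would yield a solution in Fourier
  variables on some \<open>[0, r]\<close> with \<open>r\<close> above the supremum. Equality almost
  everywhere follows because both sides have the same coefficients.\<close>

lemma flow_maximal:
  assumes u0: "u0 \<in> sobolev_mean_zero s" and T: "T > 0" and v: "solution \<gamma> s u0 T v v'"
  shows "T \<le> exist_time u0" and "t \<in> life_span T \<Longrightarrow> circle_ae_eq (v t) (fs (coeff_flow u0 t))"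
proof -
  note h = hs_of_solution[OF u0 v]
  show "T \<le> exist_time u0"
  proof (rule ccontr)
    assume "\<not> T \<le> exist_time u0"
    then obtain r where r: "exist_time u0 < ereal r" "ereal r < T" using ereal_dense2 by (metis not_le)
    have "0 < ereal r" using exist_time_pos[OF u0] r(1) by (rule order_less_trans)
    then have r0: "0 < r" by simp
    have "ereal r \<le> exist_time u0" using r r0 by (intro exist_time_ge[OF h]) auto
    then show False using r by simp
  qed
  assume t: "t \<in> life_span T"
  then have t': "0 \<le> t" "ereal t < T" by (auto simp: life_span_def)
  have e: "coeff_flow u0 t = fourier_coeff (v t)"
    using coeff_flow_eq[OF h[OF t'], of t] t' by simp
  have vt: "v t \<in> sobolev s" using v t by (auto simp: solution_def sobolev_C_def)
  have "fourier_coeff (v t) 0 = 0" using hsolD(2)[OF h(1)[OF t'], of t] t' by simp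
  then have "l1 (fourier_coeff (v t))" by (rule l1_ws[OF sobolev_hb[OF vt]])
  then show "circle_ae_eq (v t) (fs (coeff_flow u0 t))"
    unfolding e by (rule ae_eq_fs[OF sobolev_integrable[OF vt]])
qed

lemma flow_l1:
  assumes "t \<in> life_span (exist_time u0)"
  shows "l1 (coeff_flow u0 t)" "herm (coeff_flow u0 t)" "coeff_flow u0 t 0 = 0" "\<exists>A. hb (ws s) (coeff_flow u0 t) A"
    "l1 (ost \<gamma> (coeff_flow u0 t))" "herm (ost \<gamma> (coeff_flow u0 t))"
proof -
  have t: "0 \<le> t" "ereal t < exist_time u0" using assms by (auto simp: life_span_def)
  have tt: "t \<in> {0..t}" using t by simp
  note h = coeff_flow_hs(1)[OF t]
  show 1: "herm (coeff_flow u0 t)" and 2: "coeff_flow u0 t 0 = 0" by (rule hsolD(1)[OF h tt], rule hsolD(2)[OF h tt])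
  show "\<exists>A. hb (ws s) (coeff_flow u0 t) A" using hsol_M[OF h] tt by blast
  then obtain A where A: "hb (ws s) (coeff_flow u0 t) A" by blast
  show "l1 (coeff_flow u0 t)" "l1 (ost \<gamma> (coeff_flow u0 t))" "herm (ost \<gamma> (coeff_flow u0 t))"
    by (rule l1_ws[OF A 2], rule l1_ost[OF A 2], rule herm_ost'[OF 1])
qed

lemma flow_mean: "t \<in> life_span (exist_time u0) \<Longrightarrow> circle_integral (fs (coeff_flow u0 t)) = 0"
  using fourier_coeff_0[of "fs (coeff_flow u0 t)"] flow_l1[of t u0] by (simp add: fourier_coeff_fs)

lemma en_limit:
  assumes "l1 a" "herm a"
  shows "(\<lambda>n. en (\<lambda>_. 1) n a) \<longlonglongrightarrow> circle_integral (\<lambda>x. (fs a x)\<^sup>2)"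
  using filterlim_compose[OF parseval_fs[OF assms, unfolded has_sum_def] band_filterlim] by (simp add: en_def)

lemma flow_energy:
  assumes u0: "u0 \<in> sobolev_mean_zero s" and t: "t \<in> life_span (exist_time u0)"
  shows "circle_integral (\<lambda>x. (fs (coeff_flow u0 t) x)\<^sup>2) = circle_integral (\<lambda>x. (u0 x)\<^sup>2)"
proof -
  have t': "0 \<le> t" "ereal t < exist_time u0" using t by (auto simp: life_span_def)
  have 0: "coeff_flow u0 0 = fourier_coeff u0" by (rule coeff_flow_hs(2)[OF t'])
  have l0: "l1 (fourier_coeff u0)" using l1_ws data_coeffs[OF u0] by blast
  have "(\<lambda>n. en (\<lambda>_. 1) n (coeff_flow u0 t) - en (\<lambda>_. 1) n (coeff_flow u0 0)) \<longlonglongrightarrow> 0"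
    using t' by (intro hsol_conservation[OF coeff_flow_hs(1)[OF t']]) auto
  moreover have "(\<lambda>n. en (\<lambda>_. 1) n (coeff_flow u0 t) - en (\<lambda>_. 1) n (coeff_flow u0 0)) \<longlonglongrightarrow>
     circle_integral (\<lambda>x. (fs (coeff_flow u0 t) x)\<^sup>2) - circle_integral (\<lambda>x. (fs (fourier_coeff u0) x)\<^sup>2)"
    unfolding 0 using flow_l1[OF t] l0 data_coeffs[OF u0] by (intro tendsto_diff en_limit)
  ultimately have "circle_integral (\<lambda>x. (fs (coeff_flow u0 t) x)\<^sup>2) = circle_integral (\<lambda>x. (fs (fourier_coeff u0) x)\<^sup>2)"
    using LIMSEQ_unique by fastforce
  also have "\<dots> = circle_integral (\<lambda>x. (u0 x)\<^sup>2)"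
    unfolding circle_integral_def
  proof (rule integral_cong_AE)
    have "u0 \<in> borel_measurable circle_measure" using sobolev_integrable[OF data_coeffs(4)[OF u0]] by auto
    then show "(\<lambda>x. (u0 x)\<^sup>2) \<in> borel_measurable circle_measure" by simp
    have "fs (fourier_coeff u0) \<in> borel_measurable circle_measure" using integrable_fs[OF l0] by auto
    then show "(\<lambda>x. (fs (fourier_coeff u0) x)\<^sup>2) \<in> borel_measurable circle_measure" by simp
    show "AE x in circle_measure. (fs (fourier_coeff u0) x)\<^sup>2 = (u0 x)\<^sup>2"
      using ae_eq_fs[OF sobolev_integrable[OF data_coeffs(4)[OF u0]] l0] unfolding circle_ae_eq_def by eventually_elim simp
  qed
  finally show ?thesis .
qed

lemma sobolev_norm_less: "hb (ws r) (fourier_coeff f) A \<Longrightarrow> A < e\<^sup>2 \<Longrightarrow> 0 < e \<Longrightarrow> sobolev_norm r f < e"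
  using sobolev_norm_le[of r f A] real_sqrt_less_mono[of A "e\<^sup>2"] by simp

lemma flow_continuous:
  "solution_map_continuous s exist_time (\<lambda>u0 t. fs (coeff_flow u0 t)) (\<lambda>u0 t. fs (ost \<gamma> (coeff_flow u0 t)))"
  unfolding solution_map_continuous_def
proof (intro ballI allI impI)
  fix u0 T1 and \<epsilon> :: real
  assume u0: "u0 \<in> sobolev_mean_zero s" and T1: "T1 \<in> life_span (exist_time u0)" and \<epsilon>: "0 < \<epsilon>"
  have T10: "0 \<le> T1" using T1 by (simp add: life_span_def)
  \<comment> \<open>Room beyond \<open>T1\<close> is needed: nearby data are solvable on the closed
    interval up to \<open>S\<close>, which puts \<open>T1\<close> strictly inside their life
    span.\<close>
  obtain S where S: "T1 < S" "ereal S < exist_time u0" using life_span_dense[OF T1] by blast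
  have S0: "0 \<le> S" "0 < S" using S T10 by auto
  note h = coeff_flow_hs[OF S0(1) S(2)]
  obtain M where M: "\<And>t. t \<in> {0..S} \<Longrightarrow> hb (ws s) (coeff_flow u0 t) M" using hsol_M[OF h(1)] by blast
  have M0: "0 \<le> M" using hb_bound_nonneg[OF M[of 0]] S0 by simp
  \<comment> \<open>Lipschitz constant from \<open>hb_ost_diff\<close>, with \<open>M\<close> for
    the given solution and \<open>2 * 1 + 2 * M\<close> for a nearby one at squared distance at most
    1.\<close>
  define C where "C = ost_const * ((2 * 1 + 2 * M) + M) + 2 * \<gamma>\<^sup>2"
  have C: "0 \<le> C" using M0 ost_const_nonneg by (simp add: C_def)
  define \<eta> where "\<eta> = min 1 (min (\<epsilon>\<^sup>2 / 2) (\<epsilon>\<^sup>2 / (2 * (C + 1))))"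
  have \<eta>: "0 < \<eta>" "\<eta> \<le> 1" "\<eta> < \<epsilon>\<^sup>2" "C * \<eta> < \<epsilon>\<^sup>2"
  proof -
    show "0 < \<eta>" "\<eta> \<le> 1" using \<epsilon> C by (auto simp: \<eta>_def)
    have "\<eta> \<le> \<epsilon>\<^sup>2 / 2" unfolding \<eta>_def by (rule min.coboundedI2[OF min.cobounded1])
    also have "\<dots> < \<epsilon>\<^sup>2" using \<epsilon> by simp
    finally show "\<eta> < \<epsilon>\<^sup>2" .
    have x: "x * (\<epsilon>\<^sup>2 / (2 * x)) = \<epsilon>\<^sup>2 / 2" if "0 < x" for x using that by simp
    have "C * \<eta> \<le> (C + 1) * (\<epsilon>\<^sup>2 / (2 * (C + 1)))"
      using C \<open>0 < \<eta>\<close> by (intro mult_mono) (auto simp: \<eta>_def)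
    also have "\<dots> = \<epsilon>\<^sup>2 / 2" using C by (intro x) simp
    also have "\<dots> < \<epsilon>\<^sup>2" using \<epsilon> by simp
    finally show "C * \<eta> < \<epsilon>\<^sup>2" .
  qed
  obtain \<delta> where \<delta>: "0 < \<delta>" and dep: "\<forall>v0. herm v0 \<and> v0 0 = 0 \<and> hb (ws s) (\<lambda>k. v0 k - coeff_flow u0 0 k) \<delta> \<longrightarrow>
    (\<exists>v. hs S v \<and> v 0 = v0 \<and> (\<forall>t\<in>{0..S}. hb (ws s) (\<lambda>k. v t k - coeff_flow u0 t k) \<eta>))"
    using continuous_dependence[OF h(1) S0(1) \<eta>(1)] by (elim exE conjE) (rule that; assumption)
  have "T1 \<in> life_span (exist_time v0) \<and>
      (\<forall>t\<in>{0..T1}.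
         sobolev_norm s (\<lambda>x. fs (coeff_flow v0 t) x - fs (coeff_flow u0 t) x) < \<epsilon> \<and>
         sobolev_norm (s - 1) (\<lambda>x. fs (coeff_flow v0 t) x - fs (coeff_flow u0 t) x) < \<epsilon> \<and>
         sobolev_norm (s - 1) (\<lambda>x. fs (ost \<gamma> (coeff_flow v0 t)) x - fs (ost \<gamma> (coeff_flow u0 t)) x) < \<epsilon>)"
    if v0: "v0 \<in> sobolev_mean_zero s" and n: "sobolev_norm s (\<lambda>x. v0 x - u0 x) < sqrt \<delta>" for v0
  proof -
    \<comment> \<open>Bounds in \<open>hb\<close> concern squared norms, so the neighbourhood of the
      datum has radius \<open>sqrt \<delta>\<close>.\<close>
    have "(sobolev_norm s (\<lambda>x. v0 x - u0 x))\<^sup>2 \<le> (sqrt \<delta>)\<^sup>2" using n by (intro power_mono sobolev_norm_nonneg) auto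
    then have "hb (ws s) (\<lambda>k. fourier_coeff v0 k - coeff_flow u0 0 k) \<delta>"
      unfolding h(2) using \<delta> by (intro hb_le[OF hb_sobolev_diff[OF data_coeffs(4)[OF v0] data_coeffs(4)[OF u0]]]) simp
    then have "herm (fourier_coeff v0) \<and> fourier_coeff v0 0 = 0 \<and> hb (ws s) (\<lambda>k. fourier_coeff v0 k - coeff_flow u0 0 k) \<delta>"
      using data_coeffs[OF v0] by simp
    from mp[OF spec[OF dep] this] obtain v where v: "hs S v" "v 0 = fourier_coeff v0"
      "\<forall>t\<in>{0..S}. hb (ws s) (\<lambda>k. v t k - coeff_flow u0 t k) \<eta>" by (elim exE conjE)
    have "ereal T1 < ereal S" using S by simp
    also have "\<dots> \<le> exist_time v0" by (rule exist_time_ge[OF v(1,2) S0(2)])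
    finally have T1v: "T1 \<in> life_span (exist_time v0)" using T10 by (simp add: life_span_def)
    have "sobolev_norm s (\<lambda>x. fs (coeff_flow v0 t) x - fs (coeff_flow u0 t) x) < \<epsilon> \<and>
         sobolev_norm (s - 1) (\<lambda>x. fs (coeff_flow v0 t) x - fs (coeff_flow u0 t) x) < \<epsilon> \<and>
         sobolev_norm (s - 1) (\<lambda>x. fs (ost \<gamma> (coeff_flow v0 t)) x - fs (ost \<gamma> (coeff_flow u0 t)) x) < \<epsilon>"
      if t: "t \<in> {0..T1}" for t
    proof -
      have le: "t' \<in> life_span T" if "T1 \<in> life_span T" "t' \<in> {0..T1}" for t' T
        using that by (auto simp: life_span_def intro: order_le_less_trans[of "ereal t'" "ereal T1"])
      note lu = flow_l1[OF le[OF T1 t]] and lv = flow_l1[OF le[OF T1v t]]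
      have tS: "t \<in> {0..S}" using t S by auto
      have d: "hb (ws s) (\<lambda>k. coeff_flow v0 t k - coeff_flow u0 t k) \<eta>"
        using v(3) tS coeff_flow_eq[OF v(1,2) tS] by simp
      have fd: "fourier_coeff (\<lambda>x. fs (coeff_flow v0 t) x - fs (coeff_flow u0 t) x) = (\<lambda>k. coeff_flow v0 t k - coeff_flow u0 t k)"
        "fourier_coeff (\<lambda>x. fs (ost \<gamma> (coeff_flow v0 t)) x - fs (ost \<gamma> (coeff_flow u0 t)) x) = (\<lambda>k. ost \<gamma> (coeff_flow v0 t) k - ost \<gamma> (coeff_flow u0 t) k)"
        using lu lv by (auto simp: fourier_coeff_diff integrable_fs fourier_coeff_fs)
      have "hb (ws s) (\<lambda>k. (coeff_flow v0 t k - coeff_flow u0 t k) + coeff_flow u0 t k) (2 * \<eta> + 2 * M)"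
        by (rule hb_add[OF d M[OF tS] ws_nonneg])
      then have "hb (ws s) (coeff_flow v0 t) (2 * \<eta> + 2 * M)" by simp
      then have vb: "hb (ws s) (coeff_flow v0 t) (2 * 1 + 2 * M)" by (rule hb_le) (use \<eta>(2) in simp)
      have o: "hb (ws (s - 1)) (\<lambda>k. ost \<gamma> (coeff_flow v0 t) k - ost \<gamma> (coeff_flow u0 t) k) (C * \<eta>)"
        unfolding C_def by (rule hb_ost_diff[OF vb lv(3) M[OF tS] lu(3) d])
      show ?thesis
      proof (intro conjI)
        show "sobolev_norm s (\<lambda>x. fs (coeff_flow v0 t) x - fs (coeff_flow u0 t) x) < \<epsilon>"
          by (rule sobolev_norm_less[OF _ \<eta>(3) \<epsilon>]) (unfold fd, rule d)
        show "sobolev_norm (s - 1) (\<lambda>x. fs (coeff_flow v0 t) x - fs (coeff_flow u0 t) x) < \<epsilon>"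
          by (rule sobolev_norm_less[OF _ \<eta>(3) \<epsilon>]) (unfold fd, rule hb_ws_pred[OF d])
        show "sobolev_norm (s - 1) (\<lambda>x. fs (ost \<gamma> (coeff_flow v0 t)) x - fs (ost \<gamma> (coeff_flow u0 t)) x) < \<epsilon>"
          by (rule sobolev_norm_less[OF _ \<eta>(4) \<epsilon>]) (unfold fd, rule o)
      qed
    qed
    then show ?thesis using T1v by blast
  qed
  then show "\<exists>\<delta>>0. \<forall>v0\<in>sobolev_mean_zero s. sobolev_norm s (\<lambda>x. v0 x - u0 x) < \<delta> \<longrightarrow>
          T1 \<in> life_span (exist_time v0) \<and>
          (\<forall>t\<in>{0..T1}.
             sobolev_norm s (\<lambda>x. fs (coeff_flow v0 t) x - fs (coeff_flow u0 t) x) < \<epsilon> \<and>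
             sobolev_norm (s - 1) (\<lambda>x. fs (coeff_flow v0 t) x - fs (coeff_flow u0 t) x) < \<epsilon> \<and>
             sobolev_norm (s - 1) (\<lambda>x. fs (ost \<gamma> (coeff_flow v0 t)) x - fs (ost \<gamma> (coeff_flow u0 t)) x) < \<epsilon>)"
    using \<delta> by (intro exI[of _ "sqrt \<delta>"]) simp
qed

end

theorem lemma1:
  fixes \<gamma> s :: real
  assumes "\<gamma> > 0" and "s \<ge> 2"
  shows "\<exists>(T :: (real \<Rightarrow> real) \<Rightarrow> ereal) U U'.
     (\<forall>u0\<in>sobolev_mean_zero s.
        T u0 > 0 \<and>
        solution \<gamma> s u0 (T u0) (U u0) (U' u0) \<and>
        (\<forall>T' v v'. T' > 0 \<and> solution \<gamma> s u0 T' v v' \<longrightarrow>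
           T' \<le> T u0 \<and> (\<forall>t\<in>life_span T'. circle_ae_eq (v t) (U u0 t))) \<and>
        (\<forall>t\<in>life_span (T u0).
           circle_integral (U u0 t) = 0 \<and>
           circle_integral (\<lambda>x. (U u0 t x)\<^sup>2) = circle_integral (\<lambda>x. (u0 x)\<^sup>2))) \<and>
     solution_map_continuous s T U U'"
proof -
  interpret ostrovsky \<gamma> s by unfold_locales (use assms in auto)
  show ?thesis
  proof (rule exI[of _ exist_time], rule exI[of _ "\<lambda>u0 t. fs (coeff_flow u0 t)"],
      rule exI[of _ "\<lambda>u0 t. fs (ost \<gamma> (coeff_flow u0 t))"], intro conjI ballI allI impI)
    fix u0 assume u0: "u0 \<in> sobolev_mean_zero s"
    show "0 < exist_time u0" by (rule exist_time_pos[OF u0])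
    show "solution \<gamma> s u0 (exist_time u0) (\<lambda>t. fs (coeff_flow u0 t)) (\<lambda>t. fs (ost \<gamma> (coeff_flow u0 t)))"
      by (rule flow_solution[OF u0])
    show "T' \<le> exist_time u0" if "0 < T' \<and> solution \<gamma> s u0 T' v v'" for T' v v'
      using flow_maximal(1)[OF u0] that by blast
    show "circle_ae_eq (v t) (fs (coeff_flow u0 t))" if "0 < T' \<and> solution \<gamma> s u0 T' v v'" "t \<in> life_span T'" for T' v v' t
      using flow_maximal(2)[OF u0] that by blast
    fix t assume t: "t \<in> life_span (exist_time u0)"
    show "circle_integral (fs (coeff_flow u0 t)) = 0" by (rule flow_mean[OF t])
    show "circle_integral (\<lambda>x. (fs (coeff_flow u0 t) x)\<^sup>2) = circle_integral (\<lambda>x. (u0 x)\<^sup>2)" by (rule flow_energy[OF u0 t])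
  qed (rule flow_continuous)
qed

end
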